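(* Let $0<r<1/2$, $s=\frac{2r}{1-2r}$ (so $r=\frac{s}{2+2s}$), and let $\phi_j(t)=\sqrt2\cos(\pi jt)$, $t\in[0,1)$, $j=1,2,\ldots$. Then for every $P_0>0$ the body $$\bar{\mathbb{B}}^s_{2\infty}(P_0)=\Bigl\{f=\sum_{j=1}^\infty\theta_j\phi_j:\ \theta_j\in\mathbb{R},\ \sup_{\lambda>0}\lambda^{2s}\sum_{j>\lambda}\theta_j^2\le P_0\Bigr\}$$ is a maxiset for the Cramer–von Mises test statistics.
   Context: Setting. $X_1,\ldots,X_n$ are i.i.d. on $(0,1)$ with c.d.f. $F$ having density $1+f$, $f\in L_2(0,1)$. The hypothesis is $f=0$, i.e. $F=F_0$, $F_0(x)=x$; an alternative is a sequence $f_n$ such that $1+f_n$ is a density. With $\hat F_n$ the empirical c.d.f., the Cramer–von Mises statistic is $T^2(\hat F_n-F_0)=\int_0^1(\hat F_n(x)-F_0(x))^2\,dF_0(x)$; tests $K_n$ generated by it reject the hypothesis when it exceeds a threshold. $\alpha(K_n)$, $\beta(K_n,f)$ are the type I error probability and the type II error probability at $f$; $\|\cdot\|$ is the $L_2(0,1)$ norm. A sequence $f_n$ is consistent if for any $\alpha\in(0,1)$, for Cramer–von Mises tests $K_n$ with $\alpha(K_n)=\alpha(1+o(1))$, one has $\limsup_n\beta(K_n,f_n)<1-\alpha$. It is inconsistent if $\liminf_n(\alpha(K_n)+\beta(K_n,f_n))\ge1$ for each sequence of Cramer–von Mises tests $K_n$. For alternatives given only along $n_i\to\infty$ the limits are taken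 along $n_i$. A set $W$ of functions is ortho-symmetric if $\sum_j\theta_j\phi_j\in W$ implies $\sum_j\tilde\theta_j\phi_j\in W$ for all $\tilde\theta_j\in\{\theta_j,-\theta_j\}$. For a closed, bounded, convex, ortho-symmetric set $U$ let $\Xi=\bigcup_{\gamma>0}\gamma U$. A bounded ortho-symmetric closed set $U\subset L_2(0,1)$ is called a maxiset if: (i) any subsequence of alternatives $f_{n_i}\in\gamma U$ ($\gamma>0$) with $cn_i^{-r}<\|f_{n_i}\|<Cn_i^{-r}$ (constants $0<c<C$), $n_i\to\infty$, is consistent; (ii) if $f=\sum_{j\ge1}\theta_j\phi_j\notin\Xi$ is such that for some $l_0=l_0(f)$ the functions $1+\sum_{j>l}\theta_j\phi_j$ are nonnegative (are densities) for all $l>l_0$, then in any convex ortho-symmetric set $V$ containing $f$ there is an inconsistent subsequence of alternatives $f_{n_i}\in V$ with $cn_i^{-r}<\|f_{n_i}\|<Cn_i^{-r}$ for some $0<c<C$, where $n_i\to\infty$. *)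

theory Defs
  imports "HOL-Probability.Probability"
begin

definition unit_leb :: "real measure" where
  "unit_leb = restrict_space lborel {0<..<1}"

definition sq_integrable :: "(real \<Rightarrow> real) \<Rightarrow> bool" where
  "sq_integrable f \<longleftrightarrow> f \<in> borel_measurable unit_leb \<and> integrable unit_leb (\<lambda>x. (f x)\<^sup>2)"

text \<open>Elements of L2(0,1) are classes of square integrable functions modulo equality a.e.\<close>

definition l2_rel :: "(real \<Rightarrow> real) \<Rightarrow> (real \<Rightarrow> real) \<Rightarrow> bool" where
  "l2_rel f g \<longleftrightarrow> sq_integrable f \<and> sq_integrable g \<and> (AE x in unit_leb. f x = g x)"

lemma finite_measure_unit_leb: "finite_measure unit_leb"
  unfolding unit_leb_def by (rule finite_measureI) (simp add: space_restrict_space emeasure_restrict_space)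

lemma sq_integrable_mult:
  assumes "sq_integrable f" "sq_integrable g"
  shows "integrable unit_leb (\<lambda>x. f x * g x)"
proof (rule Bochner_Integration.integrable_bound)
  show "integrable unit_leb (\<lambda>x. (f x)\<^sup>2 + (g x)\<^sup>2)"
    using assms unfolding sq_integrable_def by simp
  show "(\<lambda>x. f x * g x) \<in> borel_measurable unit_leb"
    using assms unfolding sq_integrable_def by (auto intro: borel_measurable_times)
  have "\<bar>a * b\<bar> \<le> a\<^sup>2 + b\<^sup>2" for a b :: real
  proof -
    have "0 \<le> (\<bar>a\<bar> - \<bar>b\<bar>)\<^sup>2" "0 \<le> \<bar>a\<bar> * \<bar>b\<bar>" by simp_all
    moreover have "(\<bar>a\<bar> - \<bar>b\<bar>)\<^sup>2 = a\<^sup>2 + b\<^sup>2 - 2 * (\<bar>a\<bar> * \<bar>b\<bar>)"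
      by (simp add: power2_diff)
    ultimately show ?thesis unfolding abs_mult by linarith
  qed
  then show "AE x in unit_leb. norm (f x * g x) \<le> norm ((f x)\<^sup>2 + (g x)\<^sup>2)"
    by simp
qed

lemma sq_integrable_add:
  assumes "sq_integrable f" "sq_integrable g"
  shows "sq_integrable (\<lambda>x. f x + g x)"
  using assms sq_integrable_mult[OF assms]
  unfolding sq_integrable_def by (auto simp: power2_sum mult.assoc intro: borel_measurable_add)

lemma sq_integrable_scale: "sq_integrable f \<Longrightarrow> sq_integrable (\<lambda>x. c * f x)"
  unfolding sq_integrable_def by (auto simp: power_mult_distrib intro: borel_measurable_times)

lemma sq_integrable_bounded:
  assumes [measurable]: "f \<in> borel_measurable borel" and "\<And>x. \<bar>f x\<bar> \<le> B"
  shows "sq_integrable f"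
  unfolding sq_integrable_def
proof
  show m: "f \<in> borel_measurable unit_leb"
    unfolding unit_leb_def by (intro measurable_restrict_space1) simp
  interpret finite_measure unit_leb by (rule finite_measure_unit_leb)
  have "(f x)\<^sup>2 \<le> B\<^sup>2" for x
    using assms(2)[of x] by (metis abs_ge_zero power2_abs power_mono)
  then show "integrable unit_leb (\<lambda>x. (f x)\<^sup>2)"
    using m by (intro integrable_const_bound[where B = "B\<^sup>2"]) auto
qed

quotient_type l2 = "real \<Rightarrow> real" / partial: l2_rel
proof (rule part_equivpI)
  show "\<exists>f. l2_rel f f"
    by (rule exI[of _ "\<lambda>_. 0"]) (simp add: l2_rel_def sq_integrable_def)
  show "symp l2_rel"
    by (rule sympI) (auto simp: l2_rel_def)
  show "transp l2_rel"
    by (rule transpI) (auto simp: l2_rel_def)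
qed

instantiation l2 :: real_inner
begin

lift_definition zero_l2 :: l2 is "\<lambda>_. 0"
  by (simp add: l2_rel_def sq_integrable_def)

lift_definition plus_l2 :: "l2 \<Rightarrow> l2 \<Rightarrow> l2" is "\<lambda>f g x. f x + g x"
  by (auto simp: l2_rel_def sq_integrable_add)

lift_definition scaleR_l2 :: "real \<Rightarrow> l2 \<Rightarrow> l2" is "\<lambda>c f x. c * f x"
  by (auto simp: l2_rel_def sq_integrable_scale)

definition uminus_l2 :: "l2 \<Rightarrow> l2" where "uminus_l2 f = (-1) *\<^sub>R f"

definition minus_l2 :: "l2 \<Rightarrow> l2 \<Rightarrow> l2" where "minus_l2 f g = f + (- g)"

lift_definition inner_l2 :: "l2 \<Rightarrow> l2 \<Rightarrow> real" is "\<lambda>f g. \<integral>x. f x * g x \<partial>unit_leb"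
  by (rule integral_cong_AE) (auto simp: l2_rel_def sq_integrable_def)

definition norm_l2 :: "l2 \<Rightarrow> real" where "norm_l2 f = sqrt (inner f f)"

definition sgn_l2 :: "l2 \<Rightarrow> l2" where "sgn_l2 f = inverse (norm f) *\<^sub>R f"

definition dist_l2 :: "l2 \<Rightarrow> l2 \<Rightarrow> real" where "dist_l2 f g = norm (f - g)"

definition uniformity_l2 :: "(l2 \<times> l2) filter" where
  "uniformity_l2 = (INF e\<in>{0<..}. principal {(f, g). dist f g < e})"

definition open_l2 :: "l2 set \<Rightarrow> bool" where
  "open_l2 S \<longleftrightarrow> (\<forall>f\<in>S. eventually (\<lambda>(f', g). f' = f \<longrightarrow> g \<in> S) uniformity)"

instance
proof
  fix f g h :: l2 and a b :: real
  show "f + g + h = f + (g + h)"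
    by transfer (auto simp: l2_rel_def intro!: sq_integrable_add)
  show "f + g = g + f"
    by transfer (auto simp: l2_rel_def intro!: sq_integrable_add)
  show "0 + f = f"
    by transfer (auto simp: l2_rel_def)
  show "- f + f = 0"
    unfolding uminus_l2_def
    by transfer (auto simp: l2_rel_def sq_integrable_def)
  show "f - g = f + - g"
    by (simp add: minus_l2_def)
  show "a *\<^sub>R (f + g) = a *\<^sub>R f + a *\<^sub>R g"
    by transfer (auto simp: l2_rel_def distrib_left intro!: sq_integrable_add sq_integrable_scale)
  show "(a + b) *\<^sub>R f = a *\<^sub>R f + b *\<^sub>R f"
    by transfer (auto simp: l2_rel_def distrib_right intro!: sq_integrable_add sq_integrable_scale)
  show "a *\<^sub>R b *\<^sub>R f = (a * b) *\<^sub>R f"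
    by transfer (auto simp: l2_rel_def mult.assoc intro!: sq_integrable_scale)
  show "1 *\<^sub>R f = f"
    by transfer (auto simp: l2_rel_def)
  show "inner f g = inner g f"
    by transfer (simp add: mult.commute)
  show "inner (f + g) h = inner f h + inner g h"
    by transfer (auto simp: l2_rel_def distrib_right sq_integrable_mult)
  show "inner (a *\<^sub>R f) g = a * inner f g"
    by transfer (simp add: mult.assoc)
  show "0 \<le> inner f f"
    by transfer simp
  show "inner f f = 0 \<longleftrightarrow> f = 0"
  proof (transfer, goal_cases)
    case (1 f)
    then have f: "sq_integrable f" by (simp add: l2_rel_def)
    have "(\<integral>x. f x * f x \<partial>unit_leb) = 0 \<longleftrightarrow> (AE x in unit_leb. f x * f x = 0)"
      by (rule integral_nonneg_eq_0_iff_AE) (auto intro: sq_integrable_mult f)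
    then show ?case
      using f by (auto simp: l2_rel_def sq_integrable_def)
  qed
  show "norm f = sqrt (inner f f)" by (simp add: norm_l2_def)
  show "sgn f = inverse (norm f) *\<^sub>R f" by (simp add: sgn_l2_def)
  show "dist f g = norm (f - g)" by (simp add: dist_l2_def)
  show "uniformity = (INF e\<in>{0<..}. principal {(f::l2, g). dist f g < e})"
    by (simp add: uniformity_l2_def)
  show "open S \<longleftrightarrow> (\<forall>f\<in>S. eventually (\<lambda>(f', g). f' = f \<longrightarrow> g \<in> S) uniformity)" for S :: "l2 set"
    by (simp add: open_l2_def)
qed

end

text \<open>
  The system in question starts at index 1. The value at index 0 is never used, and coefficient
  sequences are likewise only relevant at positive indices.
\<close>

lift_definition cos_basis :: "nat \<Rightarrow> l2" is "\<lambda>j x. sqrt 2 * cos (pi * real j * x)"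
  by (auto simp: l2_rel_def intro!: sq_integrable_scale sq_integrable_bounded[where B = 1])

definition has_cos_coeffs :: "l2 \<Rightarrow> (nat \<Rightarrow> real) \<Rightarrow> bool" where
  "has_cos_coeffs f \<theta> \<longleftrightarrow> (\<lambda>j. \<theta> (Suc j) *\<^sub>R cos_basis (Suc j)) sums f"

definition cos_tail :: "(nat \<Rightarrow> real) \<Rightarrow> nat \<Rightarrow> l2" where
  "cos_tail \<theta> l = (\<Sum>j. \<theta> (j + Suc l) *\<^sub>R cos_basis (j + Suc l))"

definition ortho_symmetric :: "l2 set \<Rightarrow> bool" where
  "ortho_symmetric W \<longleftrightarrow>
    (\<forall>f \<theta> f' \<theta>'. has_cos_coeffs f \<theta> \<longrightarrow> f \<in> W \<longrightarrow>
      (\<forall>j. \<theta>' j = \<theta> j \<or> \<theta>' j = - \<theta> j) \<longrightarrow> has_cos_coeffs f' \<theta>' \<longrightarrow> f' \<in> W)"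

text \<open>
  Convergence of the series in L2 forces the coefficients to be square summable, so the
  convention that a divergent infinite sum is 0 never comes into play here.
\<close>

definition besov_body :: "real \<Rightarrow> real \<Rightarrow> l2 set" where
  "besov_body s P\<^sub>0 = {f. \<exists>\<theta>. has_cos_coeffs f \<theta> \<and>
     (SUP u\<in>{0<..}. ereal (u powr (2 * s) * (\<Sum>\<^sub>\<infinity>j\<in>{j::nat. real j > u}. (\<theta> j)\<^sup>2))) \<le> ereal P\<^sub>0}"

lift_definition is_alternative :: "l2 \<Rightarrow> bool" is
  "\<lambda>f. (AE x in unit_leb. 0 \<le> 1 + f x) \<and> (\<integral>x. 1 + f x \<partial>unit_leb) = 1"
proof (goal_cases)
  case (1 f g)
  then have ae: "AE x in unit_leb. f x = g x"
    and m: "f \<in> borel_measurable unit_leb" "g \<in> borel_measurable unit_leb"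
    by (auto simp: l2_rel_def sq_integrable_def)
  have "(AE x in unit_leb. 0 \<le> 1 + f x) \<longleftrightarrow> (AE x in unit_leb. 0 \<le> 1 + g x)"
  proof
    assume "AE x in unit_leb. 0 \<le> 1 + f x"
    with ae show "AE x in unit_leb. 0 \<le> 1 + g x" by eventually_elim simp
  next
    assume "AE x in unit_leb. 0 \<le> 1 + g x"
    with ae show "AE x in unit_leb. 0 \<le> 1 + f x" by eventually_elim simp
  qed
  moreover have "(\<integral>x. 1 + f x \<partial>unit_leb) = (\<integral>x. 1 + g x \<partial>unit_leb)"
    using ae m by (intro integral_cong_AE) auto
  ultimately show ?case by simp
qed

lift_definition law :: "l2 \<Rightarrow> real measure" is
  "\<lambda>f. density unit_leb (\<lambda>x. ennreal (1 + f x))"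
  by (rule density_cong) (auto simp: l2_rel_def sq_integrable_def)

definition sample_law :: "nat \<Rightarrow> l2 \<Rightarrow> (nat \<Rightarrow> real) measure" where
  "sample_law n f = PiM {..<n} (\<lambda>_. law f)"

definition empirical_cdf :: "nat \<Rightarrow> (nat \<Rightarrow> real) \<Rightarrow> real \<Rightarrow> real" where
  "empirical_cdf n X x = real (card {i\<in>{..<n}. X i \<le> x}) / real n"

text \<open>The hypothetical c.d.f. is x, and integration with respect to it is Lebesgue integration on (0,1).\<close>

definition cvm_stat :: "nat \<Rightarrow> (nat \<Rightarrow> real) \<Rightarrow> real" where
  "cvm_stat n X = (\<integral>x. (empirical_cdf n X x - x)\<^sup>2 \<partial>unit_leb)"

text \<open>
  A test with sample size n is identified with its threshold t. The statistic is not multiplied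
  by n; this is immaterial since thresholds may depend on n.
\<close>

definition type1_error :: "nat \<Rightarrow> real \<Rightarrow> real" where
  "type1_error n t = measure (sample_law n 0) {X \<in> space (sample_law n 0). cvm_stat n X > t}"

definition type2_error :: "nat \<Rightarrow> real \<Rightarrow> l2 \<Rightarrow> real" where
  "type2_error n t f = measure (sample_law n f) {X \<in> space (sample_law n f). \<not> cvm_stat n X > t}"

text \<open>
  A subsequence of alternatives is a pair of sequences (N, f): the i-th alternative f i is
  tested with sample size N i. A sequence of tests assigns to each sample size a threshold.
\<close>

definition consistent :: "(nat \<Rightarrow> nat) \<Rightarrow> (nat \<Rightarrow> l2) \<Rightarrow> bool" where
  "consistent N f \<longleftrightarrow>
    (\<forall>\<alpha>\<in>{0<..<1}. \<forall>t :: nat \<Rightarrow> real.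
      (\<lambda>i. type1_error (N i) (t (N i))) \<longlonglongrightarrow> \<alpha> \<longrightarrow>
      limsup (\<lambda>i. ereal (type2_error (N i) (t (N i)) (f i))) < ereal (1 - \<alpha>))"

definition inconsistent :: "(nat \<Rightarrow> nat) \<Rightarrow> (nat \<Rightarrow> l2) \<Rightarrow> bool" where
  "inconsistent N f \<longleftrightarrow>
    (\<forall>t :: nat \<Rightarrow> real.
      liminf (\<lambda>i. ereal (type1_error (N i) (t (N i)) + type2_error (N i) (t (N i)) (f i))) \<ge> 1)"

definition alternatives_of_rate ::
  "real \<Rightarrow> real \<Rightarrow> real \<Rightarrow> (nat \<Rightarrow> nat) \<Rightarrow> (nat \<Rightarrow> l2) \<Rightarrow> bool" where
  "alternatives_of_rate r c C N f \<longleftrightarrow> strict_mono N \<and>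
    (\<forall>i. is_alternative (f i) \<and>
         c * real (N i) powr (- r) < norm (f i) \<and> norm (f i) < C * real (N i) powr (- r))"

definition dilations :: "l2 set \<Rightarrow> l2 set" where
  "dilations U = (\<Union>\<gamma>\<in>{0<..}. (*\<^sub>R) \<gamma> ` U)"

text \<open>
  Convexity is part of the notion because dilations (the set Xi attached to U) are only considered
  for closed, bounded, convex, ortho-symmetric U.
\<close>

definition cvm_maxiset :: "real \<Rightarrow> l2 set \<Rightarrow> bool" where
  "cvm_maxiset r U \<longleftrightarrow>
    bounded U \<and> closed U \<and> convex U \<and> ortho_symmetric U \<and>
    (\<forall>\<gamma>>0. \<forall>c C N f. 0 < c \<longrightarrow> c < C \<longrightarrow> alternatives_of_rate r c C N f \<longrightarrow>
       (\<forall>i. f i \<in> (*\<^sub>R) \<gamma> ` U) \<longrightarrow> consistent N f) \<and>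
    (\<forall>f \<theta>. has_cos_coeffs f \<theta> \<longrightarrow> f \<notin> dilations U \<longrightarrow>
       (\<exists>l\<^sub>0. \<forall>l>l\<^sub>0. is_alternative (cos_tail \<theta> l)) \<longrightarrow>
       (\<forall>V. convex V \<longrightarrow> ortho_symmetric V \<longrightarrow> f \<in> V \<longrightarrow>
          (\<exists>c C N g. 0 < c \<and> c < C \<and> alternatives_of_rate r c C N g \<and>
             (\<forall>i. g i \<in> V) \<and> inconsistent N g)))"

end

theory Submission
  imports Defs "HOL-Real_Asymp.Real_Asymp"
begin


text \<open>
  Write \<open>u\<^sub>y\<close> for the function \<open>x \<mapsto> 1{y \<le> x} - x\<close>. Then \<open>n\<close> times the statistic is the squared L2 norm of
  \<open>n\<^sup>-\<^sup>1\<^sup>/\<^sup>2 (u\<^bsub>X\<^sub>1\<^esub> + ... + u\<^bsub>X\<^sub>n\<^esub>)\<close>, which under the alternative \<open>f\<close> is a centred sum \<open>D\<close> plus the drift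
  \<open>H = n\<^sup>1\<^sup>/\<^sup>2 J f\<close>, where \<open>J\<close> is integration from 0. In the sine basis \<open>u\<^sub>y\<close> has coordinates
  \<open>a\<^sub>j \<phi>\<^sub>j(y)\<close> with \<open>a\<^sub>j = 1 / (\<pi> j)\<close>, and \<open>J\<close> maps \<open>\<phi>\<^sub>j\<close> to \<open>a\<^sub>j\<close> times the \<open>j\<close>-th sine. So when \<open>f\<close>
  tends to 0, the coordinates of \<open>D\<close> are asymptotically independent centred Gaussians with standard
  deviations \<open>a\<^sub>j\<close>, and the statistic behaves like \<open>|B + H|\<^sup>2\<close> for a Brownian bridge \<open>B\<close>. Whether the tests
  detect \<open>f\<close> is decided by the size of \<open>|H|\<^sup>2\<close>, the sum of \<open>n \<theta>\<^sub>j\<^sup>2 / (\<pi> j)\<^sup>2\<close>.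

  The distributional part works with Laplace transforms. Writing \<open>exp (- l |v|\<^sup>2)\<close> as the expectation of
  \<open>exp (i (2 l)\<^sup>1\<^sup>/\<^sup>2 v \<cdot> G)\<close> for a standard Gaussian vector \<open>G\<close> turns the Laplace transform of the statistic into
  an average of characteristic functions of one-dimensional sums (\<open>laplace_as_gaussian_mixture\<close>). The
  drift enters there only as a factor of modulus one, so the limit is uniform in \<open>H\<close>, bounded or
  not (\<open>laplace_limit\<close>). The limit is the product of the transform of \<open>|B|\<^sup>2\<close> and of
  \<open>exp (- \<Sum> l H\<^sub>j\<^sup>2 / (1 + 2 l a\<^sub>j\<^sup>2))\<close>. The second factor is the transform of a nonnegative compound Poisson
  variable \<open>W\<close>: the noncentral statistic is distributed as \<open>|B|\<^sup>2 + W\<close> with \<open>W\<close> independent of \<open>B\<close>.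

  Two facts follow. If \<open>|H|\<^sup>2 \<ge> \<epsilon>\<close>, then \<open>W \<ge> \<epsilon> / 4\<close> with a probability bounded below in terms of \<open>\<epsilon>\<close>
  alone, and as the law of \<open>|B|\<^sup>2\<close> charges every interval of positive numbers, the type II error drops strictly below
  \<open>1 - \<alpha>\<close> (\<open>consistency_criterion\<close>). If \<open>|H|\<^sup>2 \<rightarrow> 0\<close>, then the statistic has the same limit
  under \<open>f\<close> and under the hypothesis, and as the law of \<open>|B|\<^sup>2\<close> has no concentrated mass, the two
  distribution functions agree uniformly in the limit (\<open>inconsistency_criterion\<close>).

  It remains to compare \<open>|H|\<^sup>2\<close> with the body. A function of norm about \<open>n\<^sup>-\<^sup>r\<close> in a multiple of the body has half of
  its squared norm in frequencies up to order \<open>m = n\<^bsup>r/s\<^esup>\<close>, and \<open>2 r / s = 1 - 2 r\<close>, so \<open>|H|\<^sup>2\<close> is at least of order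
  \<open>n m\<^sup>-\<^sup>2 n\<^bsup>-2r\<^esup> = 1\<close> (\<open>besov_consistent\<close>). If \<open>f\<close> lies in no multiple of the body, then some of its tails
  are much larger than the body permits. Let such a tail start at frequency \<open>m\<close> and choose the sample
  size so that \<open>n\<^sup>-\<^sup>r\<close> is about its norm. Then \<open>m\<close> is much larger than \<open>n\<^bsup>r/s\<^esup>\<close>, so \<open>|H|\<^sup>2\<close>, at most of order
  \<open>n m\<^sup>-\<^sup>2 n\<^bsup>-2r\<^esup>\<close>, tends to 0. The tail is the midpoint of \<open>f\<close> and a function obtained from \<open>f\<close> by sign
  changes, so it stays in every convex ortho-symmetric set containing \<open>f\<close> (\<open>besov_inconsistent\<close>).
\<close>

section \<open>Laws on the half-line and their Laplace transforms\<close>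

abbreviation laplace :: "real measure \<Rightarrow> real \<Rightarrow> real" where
  "laplace M l \<equiv> (\<integral>x. exp (- (l * x)) \<partial>M)"

definition has_laplace :: "real measure \<Rightarrow> (real \<Rightarrow> real) \<Rightarrow> bool" where
  "has_laplace M L \<longleftrightarrow> prob_space M \<and> sets M = sets borel \<and> (AE x in M. 0 \<le> x) \<and>
     (\<forall>l\<ge>0. laplace M l = L l)"

lemma has_laplaceD:
  assumes "has_laplace M L"
  shows "prob_space M" "sets M = sets borel" "space M = UNIV" "AE x in M. 0 \<le> x"
    "l \<ge> 0 \<Longrightarrow> laplace M l = L l"
  using assms sets_eq_imp_space_eq[of M borel] by (auto simp: has_laplace_def)

lemma has_laplace_cong:
  assumes "has_laplace M L" "\<And>l. l \<ge> 0 \<Longrightarrow> L l = K l"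
  shows "has_laplace M K"
  using assms by (auto simp: has_laplace_def)

lemma integrable_exp_neg:
  assumes "finite_measure M" "sets M = sets borel" "AE x in M. 0 \<le> x" "l \<ge> 0"
  shows "integrable M (\<lambda>x. exp (- (l * x :: real)))"
proof -
  interpret finite_measure M by fact
  note [measurable_cong] = assms(2)
  show ?thesis
    using assms(3) by (intro integrable_const_bound[where B = 1]) (auto simp: assms(4))
qed

lemma has_laplace_return:
  assumes "c \<ge> 0"
  shows "has_laplace (return borel c) (\<lambda>l. exp (- (l * c)))"
  unfolding has_laplace_def
  by (auto simp: assms prob_space_return AE_return integral_return)

lemma has_laplace_convolution:
  assumes M: "has_laplace M L" and N: "has_laplace N K"
  shows "has_laplace (M \<star> N) (\<lambda>l. L l * K l)"
proof -
  note m[measurable_cong] = has_laplaceD(2)[OF M] and n[measurable_cong] = has_laplaceD(2)[OF N]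
  interpret M: prob_space M by (rule has_laplaceD[OF M])
  interpret N: prob_space N by (rule has_laplaceD[OF N])
  interpret P: pair_prob_space M N ..
  have AE2: "AE z in M \<Otimes>\<^sub>M N. 0 \<le> fst z \<and> 0 \<le> snd z"
  proof -
    have "AE x in M. AE y in N. 0 \<le> fst (x, y) \<and> 0 \<le> snd (x, y)"
      using has_laplaceD(4)[OF M] has_laplaceD(4)[OF N] by auto
    then show ?thesis by (intro P.AE_pair_measure) auto
  qed
  show ?thesis
    unfolding has_laplace_def
  proof (intro conjI allI impI)
    show "prob_space (M \<star> N)"
      unfolding convolution_def by (rule P.prob_space_distr) measurable
    show "sets (M \<star> N) = sets borel" by simp
    show "AE x in M \<star> N. 0 \<le> x"
      unfolding convolution_def using AE2
      by (subst AE_distr_iff) (auto elim!: eventually_elim2 simp: case_prod_beta)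
    fix l :: real assume l: "0 \<le> l"
    have "laplace (M \<star> N) l = (\<integral>z. exp (- (l * fst z)) * exp (- (l * snd z)) \<partial>(M \<Otimes>\<^sub>M N))"
      unfolding convolution_def
      by (subst integral_distr) (auto simp: case_prod_beta algebra_simps exp_add[symmetric])
    also have "\<dots> = (\<integral>x. \<integral>y. exp (- (l * x)) * exp (- (l * y)) \<partial>N \<partial>M)"
    proof (subst P.integral_fst'[symmetric])
      show "integrable (M \<Otimes>\<^sub>M N) (\<lambda>z. exp (- (l * fst z)) * exp (- (l * snd z)))"
      proof (rule P.integrable_const_bound[where B = 1])
        show "AE z in M \<Otimes>\<^sub>M N. norm (exp (- (l * fst z)) * exp (- (l * snd z))) \<le> 1"
          using AE2 by eventually_elim (use l in \<open>auto intro!: mult_le_one\<close>)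
      qed measurable
    qed auto
    also have "\<dots> = L l * K l"
      using has_laplaceD(5)[OF M l] has_laplaceD(5)[OF N l] by simp
    finally show "laplace (M \<star> N) l = L l * K l" .
  qed
qed

lemma has_laplace_prod:
  assumes "\<And>j. j < (m::nat) \<Longrightarrow> \<exists>N. has_laplace N (L j)"
  shows "\<exists>N. has_laplace N (\<lambda>l. \<Prod>j<m. L j l)"
  using assms
proof (induction m)
  case 0
  show ?case using has_laplace_return[of 0] by auto
next
  case (Suc m)
  obtain N where "has_laplace N (\<lambda>l. \<Prod>j<m. L j l)" using Suc by auto
  moreover obtain N' where "has_laplace N' (L m)" using Suc.prems by auto
  ultimately have "has_laplace (N \<star> N') (\<lambda>l. (\<Prod>j<m. L j l) * L m l)"
    by (rule has_laplace_convolution)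
  then show ?case by auto
qed

text \<open>
  The Gaussian density times a Gaussian factor is again Gaussian up to a constant, so after the
  substitution \<open>x = y / sqrt (1 + c)\<close> the integral is a value of the standard normal
  characteristic function. With \<open>t = 0\<close> it is the Laplace transform of a squared
  Gaussian. With general \<open>t\<close> it produces the dependence of the limit on the drift.
\<close>

lemma gaussian_twisted_char:
  fixes c t :: real
  assumes c: "c \<ge> 0"
  shows "(\<integral>x. iexp (t * x) * exp (- (c * x\<^sup>2) / 2) \<partial>std_normal_distribution)
    = complex_of_real (exp (- t\<^sup>2 / (2 * (1 + c))) / sqrt (1 + c))"
proof -
  define s where "s = 1 / sqrt (1 + c)"
  have s: "s > 0" "s\<^sup>2 = 1 / (1 + c)" using c by (auto simp: s_def power_divide)
  have e: "exp (- (c * (s * x)\<^sup>2) / 2) * std_normal_density (s * x) = std_normal_density x" for x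
  proof -
    have "- (c * (s * x)\<^sup>2) / 2 - (s * x)\<^sup>2 / 2 = - ((1 + c) * s\<^sup>2 * x\<^sup>2) / 2"
      by (simp add: power_mult_distrib field_simps)
    also have "\<dots> = - x\<^sup>2 / 2" using s c by (simp add: field_simps)
    finally show ?thesis
      by (simp add: std_normal_density_def exp_add[symmetric])
  qed
  have "(\<integral>x. iexp (t * x) * exp (- (c * x\<^sup>2) / 2) \<partial>std_normal_distribution)
      = (\<integral>x. std_normal_density x *\<^sub>R (iexp (t * x) * exp (- (c * x\<^sup>2) / 2)) \<partial>lborel)"
    by (rule integral_density) auto
  also have "\<dots> = s *\<^sub>R (\<integral>x. std_normal_density (0 + s * x) *\<^sub>R (iexp (t * (0 + s * x)) * exp (- (c * (0 + s * x)\<^sup>2) / 2)) \<partial>lborel)"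
    by (subst lborel_integral_real_affine[where c = s and t = 0]) (use s in auto)
  also have "\<dots> = s *\<^sub>R (\<integral>x. std_normal_density x *\<^sub>R iexp ((t * s) * x) \<partial>lborel)"
  proof (intro arg_cong[where f = "\<lambda>z. s *\<^sub>R z"] Bochner_Integration.integral_cong refl)
    fix x :: real
    have "std_normal_density (0 + s * x) *\<^sub>R (iexp (t * (0 + s * x)) * exp (- (c * (0 + s * x)\<^sup>2) / 2))
      = complex_of_real (exp (- (c * (s * x)\<^sup>2) / 2) * std_normal_density (s * x)) * iexp (t * s * x)"
      by (simp add: scaleR_conv_of_real mult_ac exp_of_real[symmetric])
    also have "\<dots> = std_normal_density x *\<^sub>R iexp ((t * s) * x)"
      unfolding e by (simp add: scaleR_conv_of_real)
    finally show "std_normal_density (0 + s * x) *\<^sub>R (iexp (t * (0 + s * x)) * exp (- (c * (0 + s * x)\<^sup>2) / 2)) = std_normal_density x *\<^sub>R iexp ((t * s) * x)" .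
  qed
  also have "(\<integral>x. std_normal_density x *\<^sub>R iexp ((t * s) * x) \<partial>lborel) = char std_normal_distribution (t * s)"
    unfolding char_def by (rule integral_density[symmetric]) auto
  also have "s *\<^sub>R \<dots> = complex_of_real (exp (- t\<^sup>2 / (2 * (1 + c))) / sqrt (1 + c))"
  proof -
    have e1: "- ((t * s)\<^sup>2) / 2 = - t\<^sup>2 / (2 * (1 + c))"
      using c by (simp add: power_mult_distrib s(2))
    show ?thesis
      unfolding char_std_normal_distribution e1 by (simp add: scaleR_conv_of_real s_def)
  qed
  finally show ?thesis .
qed

definition chi_law :: "real \<Rightarrow> real measure" where
  "chi_law b = distr std_normal_distribution borel (\<lambda>x. b * x\<^sup>2)"

lemma has_laplace_chi:
  assumes b: "b \<ge> 0"
  shows "has_laplace (chi_law b) (\<lambda>l. 1 / sqrt (1 + 2 * l * b))"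
proof -
  interpret G: real_distribution std_normal_distribution by (rule real_dist_normal_dist)
  show ?thesis
    unfolding has_laplace_def
  proof (intro conjI allI impI)
    show "prob_space (chi_law b)" unfolding chi_law_def by (rule G.prob_space_distr) simp
    show "sets (chi_law b) = sets borel" by (simp add: chi_law_def)
    show "AE x in chi_law b. 0 \<le> x" unfolding chi_law_def
      by (subst AE_distr_iff) (auto simp: b)
    fix l :: real assume l: "0 \<le> l"
    have "complex_of_real (laplace (chi_law b) l)
      = (\<integral>x. complex_of_real (exp (- (l * (b * x\<^sup>2)))) \<partial>std_normal_distribution)"
      unfolding chi_law_def by (subst integral_distr) auto
    also have "\<dots> = (\<integral>x. iexp (0 * x) * exp (- ((2 * l * b) * x\<^sup>2) / 2) \<partial>std_normal_distribution)"
      by (intro Bochner_Integration.integral_cong refl) (simp add: mult_ac exp_of_real[symmetric])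
    also have "\<dots> = complex_of_real (1 / sqrt (1 + 2 * l * b))"
      by (subst gaussian_twisted_char) (auto simp: b l)
    finally show "laplace (chi_law b) l = 1 / sqrt (1 + 2 * l * b)"
      by (simp only: of_real_eq_iff)
  qed
qed

primrec convolution_power :: "real measure \<Rightarrow> nat \<Rightarrow> real measure" where
  "convolution_power M 0 = return borel 0"
| "convolution_power M (Suc k) = (convolution_power M k \<star> M)"

lemma has_laplace_convolution_power:
  assumes "has_laplace M L"
  shows "has_laplace (convolution_power M k) (\<lambda>l. L l ^ k)"
proof (induction k)
  case 0
  show ?case using has_laplace_return[of 0] by simp
next
  case (Suc k)
  from has_laplace_convolution[OF Suc assms] show ?case by (simp add: mult.commute)
qed

text \<open>
  A Poisson number of independent copies of the given law. Conditionally on the number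
  \<open>k\<close> of copies the transform is \<open>L l ^ k\<close>, and the exponential series
  sums the mixture.
\<close>

lemma has_laplace_compound_poisson:
  assumes M: "has_laplace M L" and c: "c \<ge> 0"
  shows "\<exists>N. has_laplace N (\<lambda>l. exp (- (c * (1 - L l))))"
proof (cases "c = 0")
  case True
  then show ?thesis using has_laplace_return[of 0] by auto
next
  case False
  with c have c: "0 < c" by simp
  define P where "P = measure_pmf (poisson_pmf c)"
  define N where "N = P \<bind> convolution_power M"
  note C = has_laplace_convolution_power[OF M]
  interpret P: prob_space P by (simp add: P_def prob_space_measure_pmf)
  have C_sub: "convolution_power M k \<in> space (subprob_algebra borel)" for k
    using has_laplaceD(1,2)[OF C] by (auto simp: space_subprob_algebra intro: prob_space_imp_subprob_space)
  have C_meas: "convolution_power M \<in> P \<rightarrow>\<^sub>M subprob_algebra borel"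
    using C_sub by (auto simp: P_def)
  have C_meas': "convolution_power M \<in> P \<rightarrow>\<^sub>M prob_algebra borel"
    using has_laplaceD(1,2)[OF C] by (auto simp: P_def space_prob_algebra)
  have prob: "prob_space N"
    unfolding N_def using has_laplaceD(1)[OF C] C_meas by (intro P.prob_space_bind) auto
  have setsN: "sets N = sets borel"
    unfolding N_def by (rule sets_bind) (use has_laplaceD(2)[OF C] in \<open>auto simp: P_def\<close>)
  have AE: "AE x in N. 0 \<le> x"
    unfolding N_def using has_laplaceD(4)[OF C] C_meas by (subst AE_bind[where B = borel]) auto
  have "has_laplace N (\<lambda>l. exp (- (c * (1 - L l))))"
    unfolding has_laplace_def
  proof (intro conjI allI impI prob setsN AE)
    fix l :: real assume l: "0 \<le> l"
    have L0: "0 \<le> L l"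
      unfolding has_laplaceD(5)[OF M l, symmetric] by (rule integral_nonneg_AE) simp
    have "(\<integral>\<^sup>+x. ennreal (exp (- (l * x))) \<partial>N)
        = (\<integral>\<^sup>+k. \<integral>\<^sup>+x. ennreal (exp (- (l * x))) \<partial>convolution_power M k \<partial>P)"
      unfolding N_def by (rule nn_integral_bind[OF _ C_meas]) simp
    also have "\<dots> = (\<integral>\<^sup>+k. ennreal (L l ^ k) \<partial>P)"
    proof (intro nn_integral_cong)
      fix k
      interpret Ck: prob_space "convolution_power M k" by (rule has_laplaceD[OF C])
      show "(\<integral>\<^sup>+x. ennreal (exp (- (l * x))) \<partial>convolution_power M k) = ennreal (L l ^ k)"
        unfolding has_laplaceD(5)[OF C l, symmetric]
        by (intro nn_integral_eq_integral integrable_exp_neg has_laplaceD[OF C] l) (auto intro: Ck.finite_measure)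
    qed
    also have "\<dots> = (\<integral>\<^sup>+k. ennreal (pmf (poisson_pmf c) k) * ennreal (L l ^ k) \<partial>count_space UNIV)"
      unfolding P_def by (rule nn_integral_measure_pmf)
    also have "\<dots> = (\<Sum>k. ennreal (pmf (poisson_pmf c) k) * ennreal (L l ^ k))"
      by (rule nn_integral_count_space_nat)
    also have "\<dots> = (\<Sum>k. ennreal (exp (- c) * ((c * L l) ^ k /\<^sub>R fact k)))"
      using c L0 by (intro suminf_cong)
        (simp add: ennreal_mult[symmetric] power_mult_distrib divide_inverse mult_ac)
    also have "\<dots> = ennreal (exp (- c) * exp (c * L l))"
      using c L0 by (intro suminf_ennreal_eq sums_mult exp_converges) auto
    also have "exp (- c) * exp (c * L l) = exp (- (c * (1 - L l)))"
      by (simp add: exp_add[symmetric] algebra_simps)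
    finally have *: "(\<integral>\<^sup>+x. ennreal (exp (- (l * x))) \<partial>N) = ennreal (exp (- (c * (1 - L l))))" .
    show "laplace N l = exp (- (c * (1 - L l)))"
      using setsN by (subst integral_eq_nn_integral) (auto simp: * measurable_cong_sets[OF setsN refl])
  qed
  then show ?thesis by blast
qed

text \<open>
  This transform is the ratio of those of \<open>(a G + h)\<^sup>2\<close> and \<open>(a
  G)\<^sup>2\<close>, where \<open>b = a\<^sup>2\<close>, \<open>x = h\<^sup>2\<close> and
  \<open>G\<close> is standard Gaussian. It belongs to a law because \<open>l x / (1 + 2 l b) = (x
  / 2 b) (1 - 1 / (1 + 2 l b))\<close>: it is compound Poisson with exponential jumps, and an
  exponential variable is a sum of two squared Gaussians. Hence shifting a Gaussian amounts to
  adding an independent nonnegative variable to its square, which is a quantitative form of the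
  Anderson inequality.
\<close>

lemma has_laplace_noncentral:
  assumes b: "b > 0" and x: "x \<ge> 0"
  shows "\<exists>N. has_laplace N (\<lambda>l. exp (- (l * x / (1 + 2 * l * b))))"
proof -
  have "has_laplace (chi_law b \<star> chi_law b) (\<lambda>l. 1 / (1 + 2 * l * b))"
    using b by (intro has_laplace_cong[OF has_laplace_convolution[OF has_laplace_chi has_laplace_chi]]) (auto)
  from has_laplace_compound_poisson[OF this, of "x / (2 * b)"] b x
  obtain N where N: "has_laplace N (\<lambda>l. exp (- (x / (2 * b) * (1 - 1 / (1 + 2 * l * b)))))" by auto
  have "x / (2 * b) * (1 - 1 / (1 + 2 * l * b)) = l * x / (1 + 2 * l * b)" if "l \<ge> 0" for l
  proof -
    have p: "1 + 2 * l * b > 0" using that b by (intro add_pos_nonneg) auto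
    have "1 - 1 / (1 + 2 * l * b) = 2 * l * b / (1 + 2 * l * b)" using p by (simp add: field_simps)
    then show ?thesis using b by simp
  qed
  then show ?thesis using has_laplace_cong[OF N] by fastforce
qed

text \<open>
  The Chernoff bound: \<open>exp (- l x)\<close> is at least \<open>exp (- l e)\<close> on the
  event.
\<close>

lemma has_laplace_small_ball:
  assumes N: "has_laplace N L" and l: "l \<ge> 0"
  shows "measure N {..<e} \<le> exp (l * e) * L l"
proof -
  interpret prob_space N by (rule has_laplaceD[OF N])
  note [measurable_cong] = has_laplaceD(2)[OF N]
  have i: "integrable N (\<lambda>x. exp (- (l * x)))"
    by (intro integrable_exp_neg has_laplaceD[OF N] l finite_measure)
  have "measure N {..<e} = (\<integral>x. indicator {..<e} x \<partial>N)"
    using has_laplaceD(3)[OF N] by simp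
  also have "\<dots> \<le> (\<integral>x. exp (l * e) * exp (- (l * x)) \<partial>N)"
  proof (rule integral_mono)
    show "integrable N (\<lambda>x. indicator {..<e} x :: real)" by (simp add: has_laplaceD[OF N] emeasure_eq_measure)
    show "integrable N (\<lambda>x. exp (l * e) * exp (- (l * x)))" using i by simp
    show "indicator {..<e} x \<le> exp (l * e) * exp (- (l * x))" for x :: real
    proof -
      have "l * x \<le> l * e" if "x < e" using that l by (intro mult_left_mono) auto
      then show ?thesis by (auto simp: indicator_def exp_add[symmetric])
    qed
  qed
  also have "\<dots> = exp (l * e) * L l" using has_laplaceD(5)[OF N l] by simp
  finally show ?thesis .
qed


lemma measure_convolution:
  fixes A :: "real set"
  assumes M: "has_laplace M L" and N: "has_laplace N K" and A[measurable]: "A \<in> sets borel"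
  shows "measure (M \<star> N) A = (\<integral>w. measure M {x. x + w \<in> A} \<partial>N)"
    and "integrable N (\<lambda>w. measure M {x. x + w \<in> A})"
proof -
  note m[measurable_cong] = has_laplaceD(2)[OF M] and n[measurable_cong] = has_laplaceD(2)[OF N]
  interpret M: prob_space M by (rule has_laplaceD[OF M])
  interpret N: prob_space N by (rule has_laplaceD[OF N])
  interpret P: pair_prob_space N M ..
  have meas: "(\<lambda>w. measure M {x. x + w \<in> A}) \<in> borel_measurable N"
  proof -
    have "(\<lambda>w. emeasure M (Pair w -` {p \<in> space (N \<Otimes>\<^sub>M M). snd p + fst p \<in> A})) \<in> borel_measurable N"
      by (rule M.measurable_emeasure_Pair) measurable
    also have "(\<lambda>w. emeasure M (Pair w -` {p \<in> space (N \<Otimes>\<^sub>M M). snd p + fst p \<in> A})) = (\<lambda>w. emeasure M {x. x + w \<in> A})"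
      using has_laplaceD(3)[OF M] has_laplaceD(3)[OF N] by (auto simp: space_pair_measure vimage_def)
    finally show ?thesis unfolding measure_def by measurable
  qed
  show i: "integrable N (\<lambda>w. measure M {x. x + w \<in> A})"
    using meas by (intro N.integrable_const_bound[where B = 1]) auto
  interpret C: prob_space "M \<star> N"
    using has_laplaceD(1)[OF has_laplace_convolution[OF M N]] .
  have "emeasure (M \<star> N) A = emeasure (N \<star> M) A"
    using convolution_commutative[OF M.finite_measure_axioms N.finite_measure_axioms n m] by simp
  also have "\<dots> = (\<integral>\<^sup>+w. emeasure M {x. x + w \<in> A} \<partial>N)"
    by (rule convolution_emeasure) (auto simp: has_laplaceD[OF M] has_laplaceD[OF N] M.finite_measure_axioms N.finite_measure_axioms)
  also have "\<dots> = (\<integral>\<^sup>+w. ennreal (measure M {x. x + w \<in> A}) \<partial>N)"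
    by (simp add: M.emeasure_eq_measure)
  also have "\<dots> = ennreal (\<integral>w. measure M {x. x + w \<in> A} \<partial>N)"
    using i by (intro nn_integral_eq_integral) auto
  finally show "measure (M \<star> N) A = (\<integral>w. measure M {x. x + w \<in> A} \<partial>N)"
    by (simp add: C.emeasure_eq_measure integral_nonneg_AE)
qed

text \<open>
  Adding an independent nonnegative variable lowers the distribution function, and strictly so if
  that variable is at least \<open>e\<close> with probability \<open>p\<close>.
\<close>

lemma convolution_shift_bound:
  assumes M: "has_laplace M L" and N: "has_laplace N K"
    and small: "measure N {..<e} \<le> 1 - p" and e: "e \<ge> 0"
  shows "measure (M \<star> N) {..t} \<le> (1 - p) * measure M {..t} + p * measure M {..t - e}"
proof -
  note m[measurable_cong] = has_laplaceD(2)[OF M] and n[measurable_cong] = has_laplaceD(2)[OF N]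
  interpret M: prob_space M by (rule has_laplaceD[OF M])
  interpret N: prob_space N by (rule has_laplaceD[OF N])
  define A where "A = measure M {..t}"
  define B where "B = measure M {..t - e}"
  have "B \<le> A" unfolding A_def B_def by (rule M.finite_measure_mono) (use e in auto)
  have i: "integrable N (indicator {..<e} :: real \<Rightarrow> real)" by (simp add: N.emeasure_eq_measure n)
  have "measure (M \<star> N) {..t} = (\<integral>w. measure M {x. x + w \<in> {..t}} \<partial>N)"
    by (rule measure_convolution[OF M N]) simp
  also have "\<dots> \<le> (\<integral>w. B + (A - B) * indicator {..<e} w \<partial>N)"
  proof (rule integral_mono_AE)
    show "integrable N (\<lambda>w. measure M {x. x + w \<in> {..t}})"
      by (rule measure_convolution[OF M N]) simp
    show "integrable N (\<lambda>w. B + (A - B) * indicator {..<e} w)" using i by simp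
    show "AE w in N. measure M {x. x + w \<in> {..t}} \<le> B + (A - B) * indicator {..<e} w"
      using has_laplaceD(4)[OF N]
    proof eventually_elim
      fix w :: real assume w: "0 \<le> w"
      show "measure M {x. x + w \<in> {..t}} \<le> B + (A - B) * indicator {..<e} w"
      proof (cases "w < e")
        case True
        have "measure M {x. x + w \<in> {..t}} \<le> measure M {..t}"
          by (rule M.finite_measure_mono) (use w in \<open>auto simp: m\<close>)
        then show ?thesis using True by (simp add: A_def)
      next
        case False
        have "measure M {x. x + w \<in> {..t}} \<le> measure M {..t - e}"
          by (rule M.finite_measure_mono) (use False in \<open>auto simp: m\<close>)
        then show ?thesis using False by (simp add: B_def)
      qed
    qed
  qed
  also have "\<dots> = B + (A - B) * measure N {..<e}"
    using i has_laplaceD(3)[OF N] N.prob_space by simp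
  also have "\<dots> \<le> B + (A - B) * (1 - p)"
    using \<open>B \<le> A\<close> small by (intro add_left_mono mult_left_mono) auto
  also have "\<dots> = (1 - p) * A + p * B" by (simp add: algebra_simps)
  finally show ?thesis by (simp add: A_def B_def)
qed

lemma std_normal_density_le: "std_normal_density x \<le> 1 / 2"
proof -
  have "sqrt 4 \<le> sqrt (2 * pi)" using pi_gt3 by (intro real_sqrt_le_mono) auto
  then have "1 / sqrt (2 * pi) \<le> 1 / 2" by (intro divide_left_mono) auto
  moreover have "exp (- x\<^sup>2 / 2) \<le> 1" by simp
  ultimately have "1 / sqrt (2 * pi) * exp (- x\<^sup>2 / 2) \<le> 1 / 2 * 1"
    by (intro mult_mono) auto
  then show ?thesis by (simp add: std_normal_density_def)
qed

lemma chi_law_measure: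
  assumes [measurable]: "A \<in> sets borel"
  shows "measure (chi_law b) A = measure std_normal_distribution {x. b * x\<^sup>2 \<in> A}"
  unfolding chi_law_def by (subst measure_distr) (auto simp: vimage_def)

text \<open>
  The event says that a standard Gaussian lies in one of two intervals, each of length at most
  \<open>sqrt (d / b)\<close> because the square root is subadditive. The density there is at most
  1/2.
\<close>

lemma chi_law_concentration:
  assumes b: "b > 0" and d: "d \<ge> 0"
  shows "measure (chi_law b) {s<..s + d} \<le> sqrt (d / b)"
proof -
  interpret G: real_distribution std_normal_distribution by (rule real_dist_normal_dist)
  define u where "u = sqrt (max 0 s / b)"
  define v where "v = sqrt (max 0 (s + d) / b)"
  have uv: "0 \<le> u" "u \<le> v" using b d by (auto simp: u_def v_def intro!: divide_right_mono)
  have "v \<le> u + sqrt (d / b)"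
  proof -
    have "max 0 (s + d) / b \<le> max 0 s / b + d / b"
      using b d by (simp add: add_divide_distrib[symmetric] divide_right_mono)
    then have "v \<le> sqrt (max 0 s / b + d / b)" by (simp add: v_def)
    also have "\<dots> \<le> u + sqrt (d / b)" unfolding u_def by (rule sqrt_add_le_add_sqrt) (use b d in auto)
    finally show ?thesis .
  qed
  let ?S = "{- v..- u} \<union> {u..v}"
  have sub: "{x. b * x\<^sup>2 \<in> {s<..s + d}} \<subseteq> ?S"
  proof
    fix x assume "x \<in> {x. b * x\<^sup>2 \<in> {s<..s + d}}"
    then have x: "s < b * x\<^sup>2" "b * x\<^sup>2 \<le> s + d" by auto
    have "u \<le> \<bar>x\<bar>" unfolding u_def using x b
      by (intro real_le_lsqrt) (auto simp: field_simps)
    moreover have "\<bar>x\<bar> \<le> v" unfolding v_def using x b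
      by (intro real_le_rsqrt) (auto simp: field_simps)
    ultimately show "x \<in> ?S" by auto
  qed
  have "emeasure std_normal_distribution ?S \<le> (\<integral>\<^sup>+x. ennreal (1 / 2) * indicator ?S x \<partial>lborel)"
    by (subst emeasure_density) (use std_normal_density_le in \<open>auto simp del: ennreal_half intro!: nn_integral_mono mult_right_mono ennreal_leI\<close>)
  also have "\<dots> = ennreal (1 / 2) * emeasure lborel ?S" by (subst nn_integral_cmult_indicator) auto
  also have "\<dots> \<le> ennreal (1 / 2) * (emeasure lborel {- v..- u} + emeasure lborel {u..v})"
    by (intro mult_left_mono emeasure_subadditive) auto
  also have "\<dots> = ennreal (v - u)"
    using uv by (simp add: ennreal_mult[symmetric] ennreal_plus[symmetric] del: ennreal_plus ennreal_half)
  finally have *: "measure std_normal_distribution ?S \<le> v - u"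
    using uv by (simp add: G.emeasure_eq_measure)
  have "measure (chi_law b) {s<..s + d} = measure std_normal_distribution {x. b * x\<^sup>2 \<in> {s<..s + d}}"
    by (rule chi_law_measure) simp
  also have "\<dots> \<le> measure std_normal_distribution ?S"
    by (rule G.finite_measure_mono[OF sub]) simp
  finally show ?thesis using * \<open>v \<le> u + sqrt (d / b)\<close> by simp
qed

text \<open>
  The interval has a preimage of length at least \<open>e / (2 b z)\<close> in the half-line, on
  which the Gaussian density is at least its value at the right end \<open>z\<close> of the range.
\<close>

lemma chi_law_positive:
  assumes b: "b > 0" and e: "e > 0"
  shows "\<exists>c>0. \<forall>v. 0 \<le> v \<longrightarrow> v \<le> T \<longrightarrow> c \<le> measure (chi_law b) {v<..v + e}"
proof -
  interpret G: real_distribution std_normal_distribution by (rule real_dist_normal_dist)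
  define z where "z = sqrt ((max 0 T + e) / b)"
  have z: "z > 0" using b e by (auto simp: z_def intro!: divide_pos_pos)
  define c where "c = std_normal_density z * (e / b / (2 * z))"
  have "c > 0" unfolding c_def using z b e normal_density_pos[of 1 0 z] by (intro mult_pos_pos divide_pos_pos) auto
  moreover have "c \<le> measure (chi_law b) {v<..v + e}" if v: "0 \<le> v" "v \<le> T" for v
  proof -
    define x where "x = sqrt (v / b)"
    define y where "y = sqrt ((v + e) / b)"
    have xy: "0 \<le> x" "x \<le> y" "y \<le> z"
      using v b e by (auto simp: x_def y_def z_def intro!: divide_right_mono)
    have "(y - x) * (y + x) = e / b"
    proof -
      have "(y - x) * (y + x) = y\<^sup>2 - x\<^sup>2" by (simp add: power2_eq_square algebra_simps)
      also have "\<dots> = e / b" using v b e by (simp add: x_def y_def add_divide_distrib)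
      finally show ?thesis .
    qed
    moreover have "(y - x) * (y + x) \<le> (y - x) * (2 * z)" using xy by (intro mult_left_mono) auto
    ultimately have len: "e / b / (2 * z) \<le> y - x" using z by (subst pos_divide_le_eq) auto
    have dens: "std_normal_density z \<le> std_normal_density w" if "w \<in> {x<..y}" for w
    proof -
      have "w\<^sup>2 \<le> z\<^sup>2" using that xy by (intro power_mono) auto
      then show ?thesis by (simp add: std_normal_density_def divide_right_mono)
    qed
    have sub: "{x<..y} \<subseteq> {w. b * w\<^sup>2 \<in> {v<..v + e}}"
    proof
      fix w assume w: "w \<in> {x<..y}"
      have "x\<^sup>2 < w\<^sup>2" "w\<^sup>2 \<le> y\<^sup>2" using w xy by (auto intro!: power_strict_mono power_mono)
      then show "w \<in> {w. b * w\<^sup>2 \<in> {v<..v + e}}"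
        using v b e by (auto simp: x_def y_def field_simps)
    qed
    have "ennreal (std_normal_density z * (y - x)) = (\<integral>\<^sup>+w. ennreal (std_normal_density z) * indicator {x<..y} w \<partial>lborel)"
      using xy by (subst nn_integral_cmult_indicator) (auto simp: ennreal_mult)
    also have "\<dots> \<le> (\<integral>\<^sup>+w. ennreal (std_normal_density w) * indicator {x<..y} w \<partial>lborel)"
      by (intro nn_integral_mono) (auto simp: indicator_def intro!: ennreal_leI dens)
    also have "\<dots> = emeasure std_normal_distribution {x<..y}"
      by (subst emeasure_density) auto
    finally have "std_normal_density z * (y - x) \<le> measure std_normal_distribution {x<..y}"
      by (simp add: G.emeasure_eq_measure)
    also have "\<dots> \<le> measure std_normal_distribution {w. b * w\<^sup>2 \<in> {v<..v + e}}"
      by (rule G.finite_measure_mono[OF sub]) simp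
    also have "\<dots> = measure (chi_law b) {v<..v + e}"
      by (rule chi_law_measure[symmetric]) simp
    finally show ?thesis
      using len unfolding c_def by (smt (verit) mult_left_mono normal_density_nonneg)
  qed
  ultimately show ?thesis by blast
qed

text \<open>
  An independent summand averages the law over translates, so the concentration bound for one
  squared Gaussian survives with the same constant, whatever the law of the summand.
\<close>

lemma chi_convolution_concentration:
  assumes b: "b > 0" and R: "has_laplace R K" and d: "d \<ge> 0"
  shows "measure (chi_law b \<star> R) {s<..s + d} \<le> sqrt (d / b)"
proof -
  have M: "has_laplace (chi_law b) (\<lambda>l. 1 / sqrt (1 + 2 * l * b))" using has_laplace_chi b by simp
  interpret R: prob_space R by (rule has_laplaceD[OF R])
  have "measure (chi_law b \<star> R) {s<..s + d} = (\<integral>w. measure (chi_law b) {x. x + w \<in> {s<..s + d}} \<partial>R)"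
    by (rule measure_convolution[OF M R]) simp
  also have "\<dots> \<le> (\<integral>w. sqrt (d / b) \<partial>R)"
  proof (rule integral_mono)
    show "integrable R (\<lambda>w. measure (chi_law b) {x. x + w \<in> {s<..s + d}})"
      by (rule measure_convolution[OF M R]) simp
    fix w
    have "{x. x + w \<in> {s<..s + d}} = {s - w<..(s - w) + d}" by auto
    then show "measure (chi_law b) {x. x + w \<in> {s<..s + d}} \<le> sqrt (d / b)"
      using chi_law_concentration[OF b d] by simp
  qed simp
  finally show ?thesis by (simp add: R.prob_space)
qed

text \<open>
  The lower bound is uniform over the second summand \<open>R\<close>, which matters because in
  the application \<open>R\<close> varies with the number of coordinates retained.
\<close>

lemma chi_convolution_gap:
  assumes b: "b > 0" and e: "e > 0" and q: "q > 0"
  shows "\<exists>g>0. \<forall>R K u. has_laplace R K \<longrightarrow> u \<le> T \<longrightarrow> q \<le> measure (chi_law b \<star> R) {..u} \<longrightarrow>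
    g \<le> measure (chi_law b \<star> R) {u - e<..u}"
proof -
  have M: "has_laplace (chi_law b) (\<lambda>l. 1 / sqrt (1 + 2 * l * b))" using has_laplace_chi b by simp
  interpret M: prob_space "chi_law b" by (rule has_laplaceD[OF M])
  note m[measurable_cong] = has_laplaceD(2)[OF M]
  obtain c where c: "c > 0" "\<And>v. 0 \<le> v \<Longrightarrow> v \<le> T \<Longrightarrow> c \<le> measure (chi_law b) {v<..v + e}"
    using chi_law_positive[OF b e] by blast
  define g where "g = min (q / 2) (c * (q / 2))"
  have "g \<le> measure (chi_law b \<star> R) {u - e<..u}"
    if R: "has_laplace R K" and u: "u \<le> T" and Q: "q \<le> measure (chi_law b \<star> R) {..u}" for R K u
  proof -
    note r[measurable_cong] = has_laplaceD(2)[OF R]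
    interpret R: prob_space R by (rule has_laplaceD[OF R])
    interpret C: prob_space "chi_law b \<star> R" by (rule has_laplaceD[OF has_laplace_convolution[OF M R]])
    have "{..u} = {..u - e} \<union> {u - e<..u}" using e by auto
    then have split: "measure (chi_law b \<star> R) {..u} \<le> measure (chi_law b \<star> R) {..u - e} + measure (chi_law b \<star> R) {u - e<..u}"
      using measure_subadditive[of "{..u - e}" "chi_law b \<star> R" "{u - e<..u}"] by (simp add: C.emeasure_eq_measure)
    have i: "integrable R (indicator {..u - e} :: real \<Rightarrow> real)" by (simp add: R.emeasure_eq_measure r)
    have sp: "space R = UNIV" by (rule has_laplaceD[OF R])
    have low: "measure (chi_law b \<star> R) {..u - e} \<le> measure R {..u - e}"
    proof -
      have "measure (chi_law b \<star> R) {..u - e} = (\<integral>w. measure (chi_law b) {x. x + w \<in> {..u - e}} \<partial>R)"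
        by (rule measure_convolution[OF M R]) simp
      also have "\<dots> \<le> (\<integral>w. indicator {..u - e} w \<partial>R)"
      proof (rule integral_mono)
        show "integrable R (\<lambda>w. measure (chi_law b) {x. x + w \<in> {..u - e}})"
          by (rule measure_convolution[OF M R]) simp
        show "measure (chi_law b) {x. x + w \<in> {..u - e}} \<le> indicator {..u - e} w" for w
        proof (cases "w \<le> u - e")
          case False
          have "AE x in chi_law b. \<not> (x + w \<in> {..u - e})"
            using has_laplaceD(4)[OF M] False by (auto elim!: eventually_mono)
          then have "measure (chi_law b) {x. x + w \<in> {..u - e}} = 0"
            using has_laplaceD(3)[OF M] by (subst (asm) AE_iff_measurable[OF _ refl]) (auto simp: measure_def)
          then show ?thesis by simp
        qed auto
      qed (use i in auto)
      finally show ?thesis using sp by simp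
    qed
    show ?thesis
    \<comment> \<open>Either the interval carries half of the mass \<open>q\<close>, or half of it lies below \<open>u - e\<close>. In the second case so does the same mass of \<open>R\<close>, and the squared Gaussian completes it.\<close>
    proof (cases "measure (chi_law b \<star> R) {u - e<..u} \<ge> q / 2")
      case True
      then show ?thesis by (simp add: g_def)
    next
      case False
      then have "q / 2 \<le> measure R {..u - e}" using split Q low by linarith
      then have "c * (q / 2) \<le> c * measure R {..u - e}" using c by (intro mult_left_mono) auto
      also have "\<dots> = (\<integral>w. c * indicator {..u - e} w \<partial>R)" using sp by simp
      also have "\<dots> \<le> (\<integral>w. measure (chi_law b) {x. x + w \<in> {u - e<..u}} \<partial>R)"
      proof (rule integral_mono_AE)
        show "integrable R (\<lambda>w. measure (chi_law b) {x. x + w \<in> {u - e<..u}})"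
          by (rule measure_convolution[OF M R]) simp
        show "integrable R (\<lambda>w. c * indicator {..u - e} w)" using i by simp
        show "AE w in R. c * indicator {..u - e} w \<le> measure (chi_law b) {x. x + w \<in> {u - e<..u}}"
          using has_laplaceD(4)[OF R]
        proof eventually_elim
          fix w :: real assume w: "0 \<le> w"
          have eq: "{x. x + w \<in> {u - e<..u}} = {u - e - w<..u - e - w + e}" by auto
          show "c * indicator {..u - e} w \<le> measure (chi_law b) {x. x + w \<in> {u - e<..u}}"
            unfolding eq using c(2)[of "u - e - w"] w u e by (auto simp: indicator_def)
        qed
      qed
      also have "\<dots> = measure (chi_law b \<star> R) {u - e<..u}"
        by (rule measure_convolution(1)[OF M R, symmetric]) simp
      finally show ?thesis by (simp add: g_def)
    qed
  qed
  moreover have "g > 0" using q c by (simp add: g_def)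
  ultimately show ?thesis by blast
qed

section \<open>From Laplace transforms to distribution functions\<close>

definition nonneg_law :: "real measure \<Rightarrow> bool" where
  "nonneg_law M \<longleftrightarrow> prob_space M \<and> sets M = sets borel \<and> (AE x in M. 0 \<le> x)"

lemma has_laplace_nonneg_law: "has_laplace M L \<Longrightarrow> nonneg_law M"
  by (simp add: has_laplace_def nonneg_law_def)

text \<open>
  In the variable \<open>y = exp (- x)\<close> the values of the transform at the integers are
  moments, so they control the expectation of every function of \<open>y\<close> approximated by a
  polynomial.
\<close>

lemma laplace_close_polynomial:
  assumes M: "nonneg_law M" and N: "nonneg_law N"
    and close: "\<And>i. i \<le> k \<Longrightarrow> \<bar>laplace M (real i) - laplace N (real i)\<bar> \<le> r"
    and g: "continuous_on {0..1} g"
    and p: "\<And>y. y \<in> {0..1} \<Longrightarrow> \<bar>g y - (\<Sum>i\<le>k. a i * y ^ i)\<bar> \<le> h"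
  shows "(\<integral>x. g (exp (- max 0 x)) \<partial>M) \<le> (\<integral>x. g (exp (- max 0 x)) \<partial>N) + 2 * h + (\<Sum>i\<le>k. \<bar>a i\<bar>) * r"
proof -
  have main: "integrable M' (\<lambda>x. g (exp (- max 0 x)))"
    "\<bar>(\<integral>x. g (exp (- max 0 x)) \<partial>M') - (\<Sum>i\<le>k. a i * laplace M' (real i))\<bar> \<le> h"
    if M': "nonneg_law M'" for M'
  proof -
    interpret prob_space M' using M' by (simp add: nonneg_law_def)
    have s[measurable_cong]: "sets M' = sets borel" and AE: "AE x in M'. 0 \<le> x" using M' by (auto simp: nonneg_law_def)
    have cont: "continuous_on UNIV (\<lambda>x::real. g (exp (- max 0 x)))"
      by (rule continuous_on_compose2[OF g]) (auto intro!: continuous_intros)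
    then have [measurable]: "(\<lambda>x::real. g (exp (- max 0 x))) \<in> borel_measurable borel"
      by (rule borel_measurable_continuous_onI)
    obtain B where B: "\<And>y. y \<in> {0..1} \<Longrightarrow> \<bar>g y\<bar> \<le> B"
      using compact_imp_bounded[OF compact_continuous_image[OF g]] by (force simp: bounded_iff)
    show int: "integrable M' (\<lambda>x. g (exp (- max 0 x)))"
      by (rule integrable_const_bound[where B = B]) (auto intro!: B)
    have inte: "integrable M' (\<lambda>x. exp (- (real i * x)))" for i
      by (intro integrable_exp_neg s AE finite_measure) simp
    have sum: "(\<Sum>i\<le>k. a i * laplace M' (real i)) = (\<integral>x. (\<Sum>i\<le>k. a i * exp (- (real i * x))) \<partial>M')"
      using inte by simp
    have inte': "integrable M' (\<lambda>x. \<Sum>i\<le>k. a i * exp (- (real i * x)))" using inte by simp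
    have "\<bar>(\<integral>x. g (exp (- max 0 x)) \<partial>M') - (\<integral>x. (\<Sum>i\<le>k. a i * exp (- (real i * x))) \<partial>M')\<bar>
      = \<bar>\<integral>x. g (exp (- max 0 x)) - (\<Sum>i\<le>k. a i * exp (- (real i * x))) \<partial>M'\<bar>"
      using int inte' by simp
    also have "\<dots> \<le> (\<integral>x. \<bar>g (exp (- max 0 x)) - (\<Sum>i\<le>k. a i * exp (- (real i * x)))\<bar> \<partial>M')"
      by (rule integral_abs_bound)
    also have "\<dots> \<le> (\<integral>x. h \<partial>M')"
    proof (rule integral_mono_AE)
      show "integrable M' (\<lambda>x. \<bar>g (exp (- max 0 x)) - (\<Sum>i\<le>k. a i * exp (- (real i * x)))\<bar>)"
        using int inte' by auto
      show "AE x in M'. \<bar>g (exp (- max 0 x)) - (\<Sum>i\<le>k. a i * exp (- (real i * x)))\<bar> \<le> h"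
        using AE
      proof eventually_elim
        fix x :: real assume "0 \<le> x"
        then show "\<bar>g (exp (- max 0 x)) - (\<Sum>i\<le>k. a i * exp (- (real i * x)))\<bar> \<le> h"
          using p[of "exp (- x)"] by (simp add: exp_of_nat_mult[symmetric])
      qed
    qed simp
    also have "\<dots> = h" by (simp add: prob_space)
    finally show "\<bar>(\<integral>x. g (exp (- max 0 x)) \<partial>M') - (\<Sum>i\<le>k. a i * laplace M' (real i))\<bar> \<le> h"
      unfolding sum .
  qed
  have "(\<Sum>i\<le>k. a i * laplace M (real i)) - (\<Sum>i\<le>k. a i * laplace N (real i))
    = (\<Sum>i\<le>k. a i * (laplace M (real i) - laplace N (real i)))"
    by (simp add: sum_subtractf right_diff_distrib)
  also have "\<dots> \<le> (\<Sum>i\<le>k. \<bar>a i\<bar> * r)"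
  proof (rule sum_mono)
    fix i assume "i \<in> {..k}"
    then have "\<bar>a i\<bar> * \<bar>laplace M (real i) - laplace N (real i)\<bar> \<le> \<bar>a i\<bar> * r"
      by (intro mult_left_mono close) auto
    then show "a i * (laplace M (real i) - laplace N (real i)) \<le> \<bar>a i\<bar> * r"
      unfolding abs_mult[symmetric] by linarith
  qed
  finally show ?thesis
    using main(2)[OF M] main(2)[OF N] by (simp add: sum_distrib_right)
qed

text \<open>
  Finitely many values of the Laplace transform control the distribution function up to a
  horizontal shift \<open>d\<close> and an error \<open>h\<close>, uniformly on \<open>t \<le>
  T\<close>. For one \<open>t\<close> a continuous function between the indicators of \<open>x
  \<le> t\<close> and \<open>x \<le> t + d / 2\<close> is approximated by a polynomial in
  \<open>exp (- x)\<close>. A grid of step \<open>d / 2\<close> then leaves finitely many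
  \<open>t\<close> to consider.
\<close>

lemma laplace_close_imp_cdf_close:
  assumes d: "d > 0" and h: "h > 0"
  shows "\<exists>k. \<exists>r>0. \<forall>M N. nonneg_law M \<longrightarrow> nonneg_law N \<longrightarrow>
    (\<forall>i\<le>k. \<bar>laplace M (real i) - laplace N (real i)\<bar> \<le> r) \<longrightarrow>
    (\<forall>t\<le>T. measure M {..t} \<le> measure N {..t + d} + h)"
proof -
  have single: "\<exists>k. \<exists>r>0. \<forall>M N. nonneg_law M \<longrightarrow> nonneg_law N \<longrightarrow>
    (\<forall>i\<le>k. \<bar>laplace M (real i) - laplace N (real i)\<bar> \<le> r) \<longrightarrow>
    measure M {..t} \<le> measure N {..t + d / 2} + h" if t: "t \<ge> 0" for t
  proof -
    define u where "u = exp (- t)"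
    define v where "v = exp (- (t + d / 2))"
    have uv: "0 < v" "v < u" using d by (auto simp: u_def v_def)
    \<comment> \<open>In the variable \<open>y = exp (- x)\<close>, the linear interpolation between the two indicators.\<close>
    define g where "g y = min 1 (max 0 ((y - v) / (u - v)))" for y :: real
    have g: "continuous_on {0..1} g" unfolding g_def using uv by (intro continuous_intros) auto
    obtain q where q: "real_polynomial_function q" "\<And>y. y \<in> {0..1} \<Longrightarrow> \<bar>g y - q y\<bar> < h / 4"
      using Stone_Weierstrass_real_polynomial_function[OF compact_Icc g, of "h / 4"] h by auto
    then obtain a k where ak: "q = (\<lambda>x. \<Sum>i\<le>k. a i * x ^ i)"
      by (auto simp: real_polynomial_function_iff_sum)
    \<comment> \<open>The added 1 keeps \<open>S\<close> positive when the polynomial is zero.\<close>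
    define S where "S = (\<Sum>i\<le>k. \<bar>a i\<bar>) + 1"
    have S: "S > 0" by (auto simp: S_def intro!: add_nonneg_pos sum_nonneg)
    define r where "r = h / 2 / S"
    have r: "r > 0" using h S by (simp add: r_def)
    have "measure M {..t} \<le> measure N {..t + d / 2} + h"
      if M: "nonneg_law M" and N: "nonneg_law N"
        and close: "\<And>i. i \<le> k \<Longrightarrow> \<bar>laplace M (real i) - laplace N (real i)\<bar> \<le> r" for M N
    proof -
      interpret M: prob_space M using M by (simp add: nonneg_law_def)
      interpret N: prob_space N using N by (simp add: nonneg_law_def)
      have m[measurable_cong]: "sets M = sets borel" and n[measurable_cong]: "sets N = sets borel"
        using M N by (auto simp: nonneg_law_def)
      have sp: "space M = UNIV" "space N = UNIV" using sets_eq_imp_space_eq[OF m] sets_eq_imp_space_eq[OF n] by auto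
      have [measurable]: "g \<in> borel_measurable borel" unfolding g_def by measurable
      have g01: "0 \<le> g y" "g y \<le> 1" for y by (auto simp: g_def)
      have intM: "integrable M (\<lambda>x. g (exp (- max 0 x)))"
        by (rule M.integrable_const_bound[where B = 1]) (auto simp: g01)
      have intN: "integrable N (\<lambda>x. g (exp (- max 0 x)))"
        by (rule N.integrable_const_bound[where B = 1]) (auto simp: g01)
      have "measure M {..t} = (\<integral>x. indicator {..t} x \<partial>M)" using sp by simp
      also have "\<dots> \<le> (\<integral>x. g (exp (- max 0 x)) \<partial>M)"
      proof (rule integral_mono[OF _ intM])
        show "integrable M (indicator {..t} :: real \<Rightarrow> real)" by (simp add: M.emeasure_eq_measure m)
        fix x
        show "indicator {..t} x \<le> g (exp (- max 0 x))"
        proof (cases "x \<le> t")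
          case True
          then have "u \<le> exp (- max 0 x)" using t by (simp add: u_def)
          then have "1 \<le> (exp (- max 0 x) - v) / (u - v)" using uv by simp
          then show ?thesis using True by (simp add: g_def)
        qed (simp add: g01)
      qed
      also have "\<dots> \<le> (\<integral>x. g (exp (- max 0 x)) \<partial>N) + 2 * (h / 4) + (\<Sum>i\<le>k. \<bar>a i\<bar>) * r"
        by (rule laplace_close_polynomial[OF M N close g]) (use q ak in \<open>auto simp: less_imp_le\<close>)
      also have "(\<integral>x. g (exp (- max 0 x)) \<partial>N) \<le> (\<integral>x. indicator {..t + d / 2} x \<partial>N)"
      proof (rule integral_mono[OF intN])
        show "integrable N (indicator {..t + d / 2} :: real \<Rightarrow> real)" by (simp add: N.emeasure_eq_measure n)
        fix x
        show "g (exp (- max 0 x)) \<le> indicator {..t + d / 2} x"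
        proof (cases "x \<le> t + d / 2")
          case False
          then have "exp (- max 0 x) \<le> v" using t by (simp add: v_def)
          then have "(exp (- max 0 x) - v) / (u - v) \<le> 0" using uv by (simp add: divide_nonpos_pos)
          then show ?thesis using False by (simp add: g_def)
        qed (simp add: g01)
      qed
      also have "(\<integral>x. indicator {..t + d / 2} x \<partial>N) = measure N {..t + d / 2}" using sp by simp
      also have "(\<Sum>i\<le>k. \<bar>a i\<bar>) * r \<le> S * r" using r by (intro mult_right_mono) (auto simp: S_def)
      also have "S * r = h / 2" using S by (simp add: r_def)
      finally show ?thesis by simp
    qed
    then show ?thesis using r by blast
  qed
  obtain k r where kr: "\<And>t. t \<ge> 0 \<Longrightarrow> r t > 0"
    "\<And>t M N. t \<ge> 0 \<Longrightarrow> nonneg_law M \<Longrightarrow> nonneg_law N \<Longrightarrow>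
      (\<forall>i\<le>k t. \<bar>laplace M (real i) - laplace N (real i)\<bar> \<le> r t) \<Longrightarrow>
      measure M {..t} \<le> measure N {..t + d / 2} + h"
    using single by metis
  define n where "n = nat \<lceil>T / (d / 2)\<rceil>"
  define tt where "tt j = real j * (d / 2)" for j
  define K where "K = Max ((\<lambda>j. k (tt j)) ` {..n})"
  define R where "R = Min ((\<lambda>j. r (tt j)) ` {..n})"
  have tt: "tt j \<ge> 0" for j using d by (simp add: tt_def)
  have R: "R > 0" unfolding R_def using kr(1)[OF tt] by (subst Min_gr_iff) auto
  have "measure M {..t} \<le> measure N {..t + d} + h"
    if M: "nonneg_law M" and N: "nonneg_law N" and t: "t \<le> T"
      and close: "\<forall>i\<le>K. \<bar>laplace M (real i) - laplace N (real i)\<bar> \<le> R" for M N t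
  proof (cases "t < 0")
    case True
    interpret M: prob_space M using M by (simp add: nonneg_law_def)
    have "AE x in M. x \<notin> {..t}" using M True by (auto simp: nonneg_law_def elim!: eventually_mono)
    moreover have "{..t} \<in> sets M" using M by (simp add: nonneg_law_def)
    ultimately have "measure M {..t} = 0"
      using M.prob_eq_0 by blast
    then show ?thesis using h by simp
  next
    case False
    define j where "j = nat \<lceil>t / (d / 2)\<rceil>"
    have "\<lceil>t / (d / 2)\<rceil> \<le> \<lceil>T / (d / 2)\<rceil>" using t d by (intro ceiling_mono divide_right_mono) auto
    then have j: "j \<le> n" unfolding j_def n_def by (rule nat_mono)
    have "0 \<le> t / (d / 2)" using False d by simp
    then have "real j = real_of_int \<lceil>t / (d / 2)\<rceil>" unfolding j_def
      by (metis ceiling_mono ceiling_zero of_nat_nat)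
    then have "t / (d / 2) \<le> real j" "real j \<le> t / (d / 2) + 1" by linarith+
    then have "t \<le> tt j" "tt j \<le> t + d / 2" using d by (auto simp: tt_def field_simps)
    have "k (tt j) \<le> K" unfolding K_def using j by (intro Max_ge) auto
    moreover have "R \<le> r (tt j)" unfolding R_def using j by (intro Min_le) auto
    ultimately have "\<forall>i\<le>k (tt j). \<bar>laplace M (real i) - laplace N (real i)\<bar> \<le> r (tt j)"
      using close by (meson order_trans)
    from kr(2)[OF tt M N this]
    have *: "measure M {..tt j} \<le> measure N {..tt j + d / 2} + h" .
    interpret M: prob_space M using M by (simp add: nonneg_law_def)
    interpret N: prob_space N using N by (simp add: nonneg_law_def)
    have "measure M {..t} \<le> measure M {..tt j}"
      using \<open>t \<le> tt j\<close> M by (intro M.finite_measure_mono) (auto simp: nonneg_law_def)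
    moreover have "measure N {..tt j + d / 2} \<le> measure N {..t + d}"
      using \<open>tt j \<le> t + d / 2\<close> N by (intro N.finite_measure_mono) (auto simp: nonneg_law_def)
    ultimately show ?thesis using * by linarith
  qed
  then show ?thesis using R by blast
qed



section \<open>Orthonormal systems\<close>

definition orthonormal :: "(nat \<Rightarrow> 'a::real_inner) \<Rightarrow> bool" where
  "orthonormal e \<longleftrightarrow> (\<forall>j k. inner (e j) (e k) = (if j = k then 1 else 0))"

text \<open>
  The part of \<open>x\<close> orthogonal to the first \<open>m\<close> members of the system.
\<close>

definition resid :: "(nat \<Rightarrow> 'a::real_inner) \<Rightarrow> nat \<Rightarrow> 'a \<Rightarrow> 'a" where
  "resid e m x = x - (\<Sum>j<m. inner x (e j) *\<^sub>R e j)"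

lemma resid_0[simp]: "resid e 0 x = x" by (simp add: resid_def)

lemma resid_add: "resid e m (x + y) = resid e m x + resid e m y"
  by (simp add: resid_def inner_add_left scaleR_add_left sum.distrib)

lemma resid_scaleR: "resid e m (c *\<^sub>R x) = c *\<^sub>R resid e m x"
  by (simp add: resid_def scaleR_right_diff_distrib scaleR_sum_right)

lemma resid_diff: "resid e m (x - y) = resid e m x - resid e m y"
  using resid_add[of e m x "- y"] resid_scaleR[of e m "-1" y] by simp

lemma resid_sum: "resid e m (\<Sum>i\<in>A. f i) = (\<Sum>i\<in>A. resid e m (f i))"
  by (induction A rule: infinite_finite_induct) (auto simp: resid_add, simp_all add: resid_def)

lemma orthonormal_inner_sum:
  assumes "orthonormal e"
  shows "inner (\<Sum>j<m. c j *\<^sub>R e j) (e k) = (if k < m then c k else 0)"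
  using assms by (simp add: orthonormal_def inner_sum_left if_distrib[of "(*) _"] sum.If_cases cong: if_cong)

lemma inner_resid:
  assumes "orthonormal e"
  shows "inner (resid e m x) (e k) = (if k < m then 0 else inner x (e k))"
  using orthonormal_inner_sum[OF assms] by (simp add: resid_def inner_diff_left)

lemma inner_resid_swap: "inner (resid e m x) y = inner x (resid e m y)"
  by (simp add: resid_def inner_diff_left inner_diff_right inner_sum_left inner_sum_right inner_commute mult.commute)

lemma resid_idem:
  assumes "orthonormal e"
  shows "resid e m (resid e m x) = resid e m x"
  by (subst resid_def) (simp add: inner_resid[OF assms])

text \<open>
  The Pythagorean theorem for the projection onto the first \<open>m\<close> members.
\<close>

lemma norm_resid:
  assumes "orthonormal e"
  shows "(norm x)\<^sup>2 = (\<Sum>j<m. (inner x (e j))\<^sup>2) + (norm (resid e m x))\<^sup>2"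
proof -
  have "(norm (resid e m x))\<^sup>2 = inner x (resid e m x)"
    using inner_resid_swap[of e m x "resid e m x"] by (simp add: power2_norm_eq_inner resid_idem[OF assms])
  also have "\<dots> = (norm x)\<^sup>2 - (\<Sum>j<m. (inner x (e j))\<^sup>2)"
    unfolding power2_norm_eq_inner by (simp add: resid_def inner_diff_right inner_sum_right power2_eq_square)
  finally show ?thesis by simp
qed

lemma norm_resid_le:
  assumes "orthonormal e"
  shows "norm (resid e m x) \<le> norm x"
proof (rule power2_le_imp_le)
  show "(norm (resid e m x))\<^sup>2 \<le> (norm x)\<^sup>2"
    by (simp add: norm_resid[OF assms, of x m] sum_nonneg)
qed simp

lemma bessel:
  assumes "orthonormal e"
  shows "(\<Sum>j<m. (inner x (e j))\<^sup>2) \<le> (norm x)\<^sup>2"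
  by (simp add: norm_resid[OF assms, of x m])

lemma norm_sq_orthonormal_sum:
  assumes "orthonormal e"
  shows "(norm (\<Sum>j<m. c j *\<^sub>R e j))\<^sup>2 = (\<Sum>j<m. (c j)\<^sup>2)"
proof -
  have "(norm (\<Sum>j<m. c j *\<^sub>R e j))\<^sup>2 = (\<Sum>k<m. c k * inner (\<Sum>j<m. c j *\<^sub>R e j) (e k))"
    unfolding power2_norm_eq_inner by (subst inner_sum_right) simp
  also have "\<dots> = (\<Sum>j<m. (c j)\<^sup>2)"
    by (intro sum.cong refl) (simp add: orthonormal_inner_sum[OF assms] power2_eq_square)
  finally show ?thesis .
qed

lemma sums_coeff:
  assumes e: "orthonormal e" and s: "(\<lambda>j. c j *\<^sub>R e j) sums x"
  shows "c k = inner x (e k)"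
proof -
  have "(\<lambda>m. inner (\<Sum>j<m. c j *\<^sub>R e j) (e k)) \<longlonglongrightarrow> inner x (e k)"
    using s unfolding sums_def by (intro tendsto_intros)
  moreover have "(\<lambda>m. inner (\<Sum>j<m. c j *\<^sub>R e j) (e k)) \<longlonglongrightarrow> c k"
    by (rule tendsto_eventually) (use orthonormal_inner_sum[OF e] in \<open>auto simp: eventually_sequentially intro!: exI[of _ "Suc k"]\<close>)
  ultimately show ?thesis by (rule LIMSEQ_unique[THEN sym])
qed

lemma sums_iff_resid_tendsto:
  "(\<lambda>j. inner x (e j) *\<^sub>R e j) sums x \<longleftrightarrow> (\<lambda>m. resid e m x) \<longlonglongrightarrow> 0"
proof -
  have "(\<lambda>m. resid e m x) \<longlonglongrightarrow> 0 \<longleftrightarrow> (\<lambda>m. x - resid e m x) \<longlonglongrightarrow> x"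
  proof
    assume "(\<lambda>m. resid e m x) \<longlonglongrightarrow> 0"
    from tendsto_diff[OF tendsto_const this, of x] show "(\<lambda>m. x - resid e m x) \<longlonglongrightarrow> x" by simp
  next
    assume "(\<lambda>m. x - resid e m x) \<longlonglongrightarrow> x"
    from tendsto_diff[OF tendsto_const this, of x] show "(\<lambda>m. resid e m x) \<longlonglongrightarrow> 0" by simp
  qed
  then show ?thesis by (simp add: sums_def resid_def)
qed

text \<open>
  The residual is a contraction, so convergence of the partial sums at a nearby element forces
  small residuals at \<open>x\<close>.
\<close>

lemma resid_closed:
  assumes e: "orthonormal e" and lim: "f \<longlonglongrightarrow> x" and f: "\<And>n. (\<lambda>m. resid e m (f n)) \<longlonglongrightarrow> 0"
  shows "(\<lambda>m. resid e m x) \<longlonglongrightarrow> 0"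
proof (rule LIMSEQ_I)
  fix r :: real assume r: "0 < r"
  obtain n where n: "norm (f n - x) < r / 2" using LIMSEQ_D[OF lim, of "r / 2"] r by auto
  obtain M where M: "\<And>m. m \<ge> M \<Longrightarrow> norm (resid e m (f n)) < r / 2"
    using LIMSEQ_D[OF f, of "r / 2" n] r by auto
  have "norm (resid e m x - 0) < r" if "m \<ge> M" for m
  proof -
    have "resid e m x = resid e m (f n) - resid e m (f n - x)" by (simp add: resid_diff)
    then have "norm (resid e m x) \<le> norm (resid e m (f n)) + norm (resid e m (f n - x))"
      by (simp add: norm_triangle_ineq4)
    also have "\<dots> < r / 2 + r / 2" using M[OF that] n norm_resid_le[OF e, of m "f n - x"] by linarith
    finally show ?thesis by simp
  qed
  then show "\<exists>M. \<forall>m\<ge>M. norm (resid e m x - 0) < r" by blast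
qed

lemma resid_tail_sums:
  assumes e: "orthonormal e" and s: "(\<lambda>m. resid e m x) \<longlonglongrightarrow> 0"
  shows "(\<lambda>j. (inner x (e (j + l)))\<^sup>2) sums (norm (resid e l x))\<^sup>2"
proof -
  have "(\<lambda>m. (norm x)\<^sup>2 - (norm (resid e m x))\<^sup>2) \<longlonglongrightarrow> (norm x)\<^sup>2 - (norm (0::'a))\<^sup>2"
    using s by (intro tendsto_intros)
  moreover have "(\<lambda>m. (norm x)\<^sup>2 - (norm (resid e m x))\<^sup>2) = (\<lambda>m. \<Sum>j<m. (inner x (e j))\<^sup>2)"
    using norm_resid[OF e, of x] by (auto simp: fun_eq_iff algebra_simps)
  ultimately have "(\<lambda>j. (inner x (e j))\<^sup>2) sums (norm x)\<^sup>2" by (simp add: sums_def)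
  from sums_split_initial_segment[OF this, of l]
  show ?thesis by (simp add: norm_resid[OF e, of x l])
qed

section \<open>Elements of L2 given by functions\<close>

lemma space_unit_leb[simp]: "space unit_leb = {0<..<1}"
  by (simp add: unit_leb_def space_restrict_space)

lemma sets_unit_leb: "sets unit_leb = sets (restrict_space borel {0<..<1})"
  by (simp add: unit_leb_def sets_restrict_space)

lemma measurable_unit_leb: "f \<in> borel_measurable borel \<Longrightarrow> f \<in> borel_measurable unit_leb"
  unfolding unit_leb_def by (intro measurable_restrict_space1) simp

lemma id_measurable_unit_leb[measurable]: "(\<lambda>x. x) \<in> unit_leb \<rightarrow>\<^sub>M borel"
  by (rule measurable_unit_leb) simp

lemma prob_space_unit_leb: "prob_space unit_leb"
  by (rule prob_spaceI) (simp add: unit_leb_def space_restrict_space emeasure_restrict_space)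

interpretation U: prob_space unit_leb by (rule prob_space_unit_leb)

lemma sq_integrable_unit_bounded:
  assumes m: "f \<in> borel_measurable unit_leb" and b: "\<And>x. 0 < x \<Longrightarrow> x < 1 \<Longrightarrow> \<bar>f x\<bar> \<le> B"
  shows "sq_integrable f"
  unfolding sq_integrable_def
proof
  have "(f x)\<^sup>2 \<le> B\<^sup>2" if "0 < x" "x < 1" for x
    using b[OF that] by (metis abs_ge_zero power2_abs power_mono)
  then show "integrable unit_leb (\<lambda>x. (f x)\<^sup>2)"
    using m by (intro U.integrable_const_bound[where B = "B\<^sup>2"]) auto
qed (rule m)

lemma sq_integrable_integrable:
  assumes "sq_integrable f"
  shows "integrable unit_leb f"
proof -
  have "sq_integrable (\<lambda>_. 1)" by (simp add: sq_integrable_def)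
  from sq_integrable_mult[OF assms this] show ?thesis by simp
qed

lemma sq_integrable_rep: "sq_integrable (rep_l2 f)"
  using Quotient3_rep_reflp[OF Quotient3_l2, of f] by (simp add: l2_rel_def)

lemma abs_rep_l2[simp]: "abs_l2 (rep_l2 f) = f"
  by (rule Quotient3_abs_rep[OF Quotient3_l2])

lemma abs_l2_eqI:
  assumes "sq_integrable f" "sq_integrable g" "AE x in unit_leb. f x = g x"
  shows "abs_l2 f = abs_l2 g"
  using assms by (intro Quotient3_rel_abs[OF Quotient3_l2]) (simp add: l2_rel_def)

lemma rep_abs_l2:
  assumes "sq_integrable f"
  shows "AE x in unit_leb. rep_l2 (abs_l2 f) x = f x"
  using Quotient3_rep_abs[OF Quotient3_l2, of f] assms by (auto simp: l2_rel_def)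

lemma l2_rel_refl: "sq_integrable f \<Longrightarrow> l2_rel f f"
  by (simp add: l2_rel_def)

lemma inner_abs_l2:
  assumes "sq_integrable f" "sq_integrable g"
  shows "inner (abs_l2 f) (abs_l2 g) = (\<integral>x. f x * g x \<partial>unit_leb)"
  using assms by (intro inner_l2.abs_eq l2_rel_refl)

lemma abs_l2_add:
  assumes "sq_integrable f" "sq_integrable g"
  shows "abs_l2 (\<lambda>x. f x + g x) = abs_l2 f + abs_l2 g"
  using assms by (intro plus_l2.abs_eq[symmetric] l2_rel_refl)

lemma abs_l2_scale:
  assumes "sq_integrable f"
  shows "abs_l2 (\<lambda>x. c * f x) = c *\<^sub>R abs_l2 f"
  using assms by (intro scaleR_l2.abs_eq[symmetric] l2_rel_refl)

lemma abs_l2_sum: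
  assumes "finite A" "\<And>i. i \<in> A \<Longrightarrow> sq_integrable (f i)"
  shows "sq_integrable (\<lambda>x. \<Sum>i\<in>A. f i x) \<and> abs_l2 (\<lambda>x. \<Sum>i\<in>A. f i x) = (\<Sum>i\<in>A. abs_l2 (f i))"
  using assms
proof (induction rule: finite_induct)
  case empty
  then show ?case by (simp add: zero_l2.abs_eq sq_integrable_def)
next
  case (insert i A)
  then show ?case by (simp add: abs_l2_add sq_integrable_add)
qed

lemma integral_unit_leb_FTC:
  fixes f F :: "real \<Rightarrow> real"
  assumes a: "0 \<le> a" "a \<le> 1"
    and F: "\<And>x. a \<le> x \<Longrightarrow> x \<le> 1 \<Longrightarrow> DERIV F x :> f x"
    and f: "\<And>x. a \<le> x \<Longrightarrow> x \<le> 1 \<Longrightarrow> isCont f x"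
  shows "(\<integral>x. indicator {a..} x * f x \<partial>unit_leb) = F 1 - F a"
proof -
  have "(\<integral>x. indicator {a..} x * f x \<partial>unit_leb) = (\<integral>x. indicator {0<..<1} x *\<^sub>R (indicator {a..} x * f x) \<partial>lborel)"
    unfolding unit_leb_def by (rule integral_restrict_space) simp
  also have "\<dots> = (\<integral>x. f x * indicator {a..1} x \<partial>lborel)"
  proof (rule integral_cong_AE)
    have i: "integrable lborel (\<lambda>x. f x * indicator {a..1} x)"
      using has_bochner_integral_FTC_Icc_real[OF a(2) F f] by (auto simp: has_bochner_integral_iff)
    then show m: "(\<lambda>x. f x * indicator {a..1} x) \<in> borel_measurable lborel" by auto
    have eq: "indicator {0<..<1} x *\<^sub>R (indicator {a..} x * f x) = indicator {0<..<1} x * (f x * indicator {a..1} x)" for x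
      by (auto simp: indicator_def)
    show "(\<lambda>x. indicator {0<..<1} x *\<^sub>R (indicator {a..} x * f x)) \<in> borel_measurable lborel"
      unfolding eq by (rule borel_measurable_times[OF _ m]) simp
    have "AE x in lborel. x \<noteq> 0 \<and> x \<noteq> (1::real)"
      using AE_lborel_singleton[of 0] AE_lborel_singleton[of "1::real"] by auto
    then show "AE x in lborel. indicator {0<..<1} x *\<^sub>R (indicator {a..} x * f x) = f x * indicator {a..1} x"
      by eventually_elim (use a in \<open>auto simp: indicator_def\<close>)
  qed
  also have "\<dots> = F 1 - F a"
    using has_bochner_integral_FTC_Icc_real[OF a(2) F f] by (auto simp: has_bochner_integral_iff)
  finally show ?thesis .
qed

lemma integral_unit_leb_FTC0:
  fixes f F :: "real \<Rightarrow> real"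
  assumes F: "\<And>x. DERIV F x :> f x" and f: "\<And>x. isCont f x"
  shows "(\<integral>x. f x \<partial>unit_leb) = F 1 - F 0"
proof -
  have "(\<integral>x. f x \<partial>unit_leb) = (\<integral>x. indicator {0..} x * f x \<partial>unit_leb)"
    by (rule Bochner_Integration.integral_cong) auto
  also have "\<dots> = F 1 - F 0" by (rule integral_unit_leb_FTC[OF _ _ F f]) auto
  finally show ?thesis .
qed

lemma sin_pi_nat[simp]: "sin (pi * real n) = 0"
  by (rule sin_npi2)

definition sin_basis :: "nat \<Rightarrow> l2" where
  "sin_basis j = abs_l2 (\<lambda>x. sqrt 2 * sin (pi * real j * x))"

lemma sq_integrable_cos: "sq_integrable (\<lambda>x. sqrt 2 * cos (pi * real j * x))"
  by (intro sq_integrable_scale sq_integrable_bounded[where B = 1]) auto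

lemma sq_integrable_sin: "sq_integrable (\<lambda>x. sqrt 2 * sin (pi * real j * x))"
  by (intro sq_integrable_scale sq_integrable_bounded[where B = 1]) auto

text \<open>
  Products of cosines or sines are sums of cosines of integer frequencies, whose primitives vanish
  at both ends.
\<close>

lemma integral_cos_sin_products:
  assumes j: "j \<ge> 1" and k: "k \<ge> 1"
  shows "(\<integral>x. (sqrt 2 * cos (pi * real j * x)) * (sqrt 2 * cos (pi * real k * x)) \<partial>unit_leb) = (if j = k then 1 else 0)"
    and "(\<integral>x. (sqrt 2 * sin (pi * real j * x)) * (sqrt 2 * sin (pi * real k * x)) \<partial>unit_leb) = (if j = k then 1 else 0)"
proof -
  define A where "A x = (if j = k then x else sin (pi * (real j - real k) * x) / (pi * (real j - real k)))" for x
  define B where "B x = sin (pi * (real j + real k) * x) / (pi * (real j + real k))" for x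
  have dA: "DERIV A x :> cos (pi * (real j - real k) * x)" for x
    unfolding A_def by (cases "j = k") (auto intro!: derivative_eq_intros)
  have dB: "DERIV B x :> cos (pi * (real j + real k) * x)" for x
    unfolding B_def using j by (auto intro!: derivative_eq_intros)
  have c: "(sqrt 2 * cos (pi * real j * x)) * (sqrt 2 * cos (pi * real k * x))
      = cos (pi * (real j - real k) * x) + cos (pi * (real j + real k) * x)" for x
  proof -
    have "(sqrt 2 * cos (pi * real j * x)) * (sqrt 2 * cos (pi * real k * x)) = 2 * cos (pi * real j * x) * cos (pi * real k * x)"
      by simp
    also have "\<dots> = cos (pi * (real j - real k) * x) + cos (pi * (real j + real k) * x)"
      by (simp add: cos_add cos_diff algebra_simps)
    finally show ?thesis .
  qed
  have s: "(sqrt 2 * sin (pi * real j * x)) * (sqrt 2 * sin (pi * real k * x))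
      = cos (pi * (real j - real k) * x) - cos (pi * (real j + real k) * x)" for x
  proof -
    have "(sqrt 2 * sin (pi * real j * x)) * (sqrt 2 * sin (pi * real k * x)) = 2 * sin (pi * real j * x) * sin (pi * real k * x)"
      by simp
    also have "\<dots> = cos (pi * (real j - real k) * x) - cos (pi * (real j + real k) * x)"
      by (simp add: cos_add cos_diff algebra_simps)
    finally show ?thesis .
  qed
  have A1: "A 1 = (if j = k then 1 else 0)" "A 0 = 0" "B 1 = 0" "B 0 = 0"
    by (auto simp: A_def B_def sin_diff sin_add algebra_simps)
  show "(\<integral>x. (sqrt 2 * cos (pi * real j * x)) * (sqrt 2 * cos (pi * real k * x)) \<partial>unit_leb) = (if j = k then 1 else 0)"
    unfolding c by (subst integral_unit_leb_FTC0[where F = "\<lambda>x. A x + B x"]) (auto intro!: DERIV_add dA dB continuous_intros simp: A1)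
  show "(\<integral>x. (sqrt 2 * sin (pi * real j * x)) * (sqrt 2 * sin (pi * real k * x)) \<partial>unit_leb) = (if j = k then 1 else 0)"
    unfolding s by (subst integral_unit_leb_FTC0[where F = "\<lambda>x. A x - B x"]) (auto intro!: DERIV_diff dA dB continuous_intros simp: A1)
qed

abbreviation cosb :: "nat \<Rightarrow> l2" where "cosb j \<equiv> cos_basis (Suc j)"
abbreviation sinb :: "nat \<Rightarrow> l2" where "sinb j \<equiv> sin_basis (Suc j)"

lemma orthonormal_cosb: "orthonormal cosb"
  unfolding orthonormal_def cos_basis.abs_eq inner_abs_l2[OF sq_integrable_cos sq_integrable_cos]
  by (subst integral_cos_sin_products(1)) simp_all

lemma orthonormal_sinb: "orthonormal sinb"
  unfolding orthonormal_def sin_basis_def inner_abs_l2[OF sq_integrable_sin sq_integrable_sin]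
  by (subst integral_cos_sin_products(2)) simp_all

section \<open>The contribution of one observation\<close>

text \<open>
  The empirical process of a single observation at \<open>y\<close>: the empirical distribution
  function minus the uniform one.
\<close>

definition jump :: "real \<Rightarrow> l2" where
  "jump y = abs_l2 (\<lambda>x. indicator {y..} x - x)"

lemma sq_integrable_jump: "sq_integrable (\<lambda>x. indicator {y..} x - x)"
  by (rule sq_integrable_unit_bounded[where B = 1]) (auto simp: indicator_def)

lemma integrable_indicator_poly: "integrable unit_leb (\<lambda>x. indicator {y..} x * x ^ n :: real)"
proof (rule U.integrable_const_bound[where B = 1])
  have "\<bar>x ^ n\<bar> \<le> 1" if "0 < x" "x < 1" for x :: real using that by (simp add: power_le_one)
  then show "AE x in unit_leb. norm (indicator {y..} x * x ^ n) \<le> 1" by (auto simp: indicator_def)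
qed measurable

lemma integral_indicator_poly:
  assumes "0 \<le> y" "y \<le> 1"
  shows "(\<integral>x. indicator {y..} x * x ^ n \<partial>unit_leb) = (1 - y ^ Suc n) / Suc n"
proof -
  have "(\<integral>x. indicator {y..} x * x ^ n \<partial>unit_leb) = 1 ^ Suc n / Suc n - y ^ Suc n / Suc n"
  proof (rule integral_unit_leb_FTC[OF assms])
    show "DERIV (\<lambda>x. x ^ Suc n / Suc n) x :> x ^ n" for x :: real
      using DERIV_cdivide[OF DERIV_pow[of "Suc n" x], of "real (Suc n)"] by simp
  qed (intro continuous_intros)
  then show ?thesis by (simp add: diff_divide_distrib)
qed

text \<open>
  The statistic is the normalised sum of this kernel over all pairs of observations. Its explicit
  form supplies measurability.
\<close>

lemma inner_jump_jump:
  assumes y: "0 < y" "y < 1" and z: "0 < z" "z < 1"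
  shows "inner (jump y) (jump z) = 1 / 3 + (y\<^sup>2 + z\<^sup>2) / 2 - max y z"
proof -
  have "inner (jump y) (jump z) = (\<integral>x. (indicator {y..} x - x) * (indicator {z..} x - x) \<partial>unit_leb)"
    unfolding jump_def by (rule inner_abs_l2) (rule sq_integrable_jump)+
  also have "\<dots> = (\<integral>x. indicator {max y z..} x * x ^ 0 - indicator {y..} x * x ^ 1 - indicator {z..} x * x ^ 1 + indicator {0..} x * x ^ 2 \<partial>unit_leb)"
    by (rule Bochner_Integration.integral_cong) (auto simp: indicator_def power2_eq_square algebra_simps)
  also have "\<dots> = 1 / 3 + (y\<^sup>2 + z\<^sup>2) / 2 - max y z"
  proof -
    note i = integrable_indicator_poly
    have e: "(1 - max y z ^ Suc 0) / Suc 0 - (1 - y ^ Suc 1) / Suc 1 - (1 - z ^ Suc 1) / Suc 1 + (1 - 0 ^ Suc 2) / Suc 2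
      = 1 / 3 + (y\<^sup>2 + z\<^sup>2) / 2 - max y z"
      by (simp add: field_simps power2_eq_square)
    show ?thesis
      unfolding e[symmetric] using y z
      by (subst Bochner_Integration.integral_add[OF Bochner_Integration.integrable_diff[OF Bochner_Integration.integrable_diff[OF i i] i] i],
          subst Bochner_Integration.integral_diff[OF Bochner_Integration.integrable_diff[OF i i] i],
          subst Bochner_Integration.integral_diff[OF i i],
          subst (1 2 3 4) integral_indicator_poly) auto
  qed
  finally show ?thesis .
qed

lemma norm_jump_sq:
  assumes "0 < y" "y < 1"
  shows "(norm (jump y))\<^sup>2 = 1 / 3 + y\<^sup>2 - y"
  using inner_jump_jump[OF assms assms] by (simp add: power2_norm_eq_inner)

lemma norm_jump_le:
  assumes "0 < y" "y < 1"
  shows "norm (jump y) \<le> 1"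
proof -
  have "y\<^sup>2 \<le> y" using assms by (simp add: power2_eq_square mult_left_le)
  then have "(norm (jump y))\<^sup>2 \<le> 1\<^sup>2" using norm_jump_sq[OF assms] by simp
  then show ?thesis by (rule power2_le_imp_le) simp
qed

text \<open>
  The functions for \<open>y\<close> and \<open>z\<close> differ by the indicator of the interval
  between them. This makes the map continuous, so inner products with a fixed vector are
  measurable in \<open>y\<close>.
\<close>

lemma norm_jump_diff:
  assumes y: "0 < y" "y < 1" and z: "0 < z" "z < 1"
  shows "(norm (jump y - jump z))\<^sup>2 = \<bar>y - z\<bar>"
proof -
  have "(norm (jump y - jump z))\<^sup>2 = (norm (jump y))\<^sup>2 + (norm (jump z))\<^sup>2 - 2 * inner (jump y) (jump z)"
    by (simp add: power2_norm_eq_inner inner_diff_left inner_diff_right inner_commute)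
  also have "\<dots> = 2 * max y z - y - z"
    unfolding norm_jump_sq[OF y] norm_jump_sq[OF z] inner_jump_jump[OF y z] by (simp add: field_simps)
  also have "\<dots> = \<bar>y - z\<bar>" by (simp add: max_def)
  finally show ?thesis .
qed

lemma continuous_on_jump: "continuous_on {0<..<1} jump"
  unfolding continuous_on_iff
proof (intro ballI allI impI)
  fix y e :: real assume y: "y \<in> {0<..<1}" and e: "0 < e"
  show "\<exists>d>0. \<forall>z\<in>{0<..<1}. dist z y < d \<longrightarrow> dist (jump z) (jump y) < e"
  proof (intro exI[of _ "e\<^sup>2"] conjI ballI impI)
    fix z assume z: "z \<in> {0<..<1}" and d: "dist z y < e\<^sup>2"
    have "(norm (jump z - jump y))\<^sup>2 < e\<^sup>2" using norm_jump_diff[of z y] y z d by (simp add: dist_real_def)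
    then show "dist (jump z) (jump y) < e" using e by (simp add: dist_norm power2_less_imp_less)
  qed (use e in simp)
qed

lemma measurable_inner_jump: "(\<lambda>y. inner (jump y) w) \<in> borel_measurable unit_leb"
proof -
  have "(\<lambda>y. inner (jump y) w) \<in> borel_measurable (restrict_space borel {0<..<1})"
    by (rule borel_measurable_continuous_on_restrict) (intro continuous_intros continuous_on_jump)
  then show ?thesis using measurable_cong_sets[OF sets_unit_leb refl] by blast
qed

text \<open>
  The coordinate of the contribution of an observation at \<open>y\<close> is the cosine at
  \<open>y\<close> divided by \<open>\<pi> j\<close>: the Cramer-von Mises statistic weights the
  trigonometric moments of the sample.
\<close>

lemma inner_jump_sinb:
  assumes y: "0 < y" "y < 1"
  shows "inner (jump y) (sinb j) = sqrt 2 * cos (pi * real (Suc j) * y) / (pi * real (Suc j))"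
proof -
  define k where "k = pi * real (Suc j)"
  have k: "k > 0" by (simp add: k_def)
  have sk: "sin k = 0" unfolding k_def by (rule sin_pi_nat)
  have b: "integrable unit_leb (\<lambda>x. indicator {a..} x * g x)" if "\<And>x. 0 < x \<Longrightarrow> x < 1 \<Longrightarrow> \<bar>g x\<bar> \<le> 1" "g \<in> borel_measurable borel" for a and g :: "real \<Rightarrow> real"
    using that by (intro U.integrable_const_bound[where B = 1]) (auto simp: indicator_def)
  have "inner (jump y) (sinb j) = (\<integral>x. (indicator {y..} x - x) * (sqrt 2 * sin (k * x)) \<partial>unit_leb)"
    unfolding jump_def sin_basis_def k_def by (rule inner_abs_l2[OF sq_integrable_jump sq_integrable_sin])
  also have "\<dots> = (\<integral>x. sqrt 2 * (indicator {y..} x * sin (k * x)) - sqrt 2 * (indicator {0..} x * (x * sin (k * x))) \<partial>unit_leb)"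
    by (rule Bochner_Integration.integral_cong) (auto simp: indicator_def algebra_simps)
  also have "\<dots> = sqrt 2 * (\<integral>x. indicator {y..} x * sin (k * x) \<partial>unit_leb) - sqrt 2 * (\<integral>x. indicator {0..} x * (x * sin (k * x)) \<partial>unit_leb)"
    by (subst Bochner_Integration.integral_diff) (auto intro!: b simp: abs_mult mult_le_one)
  also have "(\<integral>x. indicator {y..} x * sin (k * x) \<partial>unit_leb) = - cos (k * 1) / k - (- cos (k * y) / k)"
    using y k by (intro integral_unit_leb_FTC[where F = "\<lambda>x. - cos (k * x) / k"]) (auto intro!: derivative_eq_intros)
  also have "(\<integral>x. indicator {0..} x * (x * sin (k * x)) \<partial>unit_leb)
      = (sin (k * 1) / k\<^sup>2 - 1 * cos (k * 1) / k) - (sin (k * 0) / k\<^sup>2 - 0 * cos (k * 0) / k)"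
    using k by (intro integral_unit_leb_FTC[where F = "\<lambda>x. sin (k * x) / k\<^sup>2 - x * cos (k * x) / k"])
      (auto intro!: derivative_eq_intros simp: power2_eq_square field_simps)
  finally show ?thesis using k sk unfolding k_def[symmetric] by (simp add: field_simps)
qed


section \<open>The integration operator\<close>

definition primitive :: "(real \<Rightarrow> real) \<Rightarrow> real \<Rightarrow> real" where
  "primitive g x = (\<integral>y. indicator {..<x} y * g y \<partial>unit_leb)"

definition volterra :: "l2 \<Rightarrow> l2" where
  "volterra f = abs_l2 (primitive (rep_l2 f))"

lemma integrable_indicator_times:
  assumes "sq_integrable g"
  shows "integrable unit_leb (\<lambda>y. indicator {..<x} y * g y)"
  using sq_integrable_mult[OF sq_integrable_unit_bounded[where B = 1] assms, of "indicator {..<x}"]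
  by (auto simp: indicator_def)

text \<open>
  The Cauchy-Schwarz inequality against the indicator of an interval.
\<close>

lemma primitive_bound:
  assumes g: "sq_integrable g"
  shows "\<bar>primitive g x\<bar> \<le> norm (abs_l2 g)"
proof -
  have i: "sq_integrable (indicator {..<x} :: real \<Rightarrow> real)"
    by (rule sq_integrable_unit_bounded[where B = 1]) (auto simp: indicator_def)
  have "(norm (abs_l2 (indicator {..<x})))\<^sup>2 = (\<integral>y. indicator {..<x} y * indicator {..<x} y \<partial>unit_leb)"
    unfolding power2_norm_eq_inner by (rule inner_abs_l2[OF i i])
  also have "\<dots> \<le> (\<integral>y. 1 \<partial>unit_leb)"
    by (rule integral_mono) (use sq_integrable_mult[OF i i] in \<open>auto simp: indicator_def\<close>)
  finally have "(norm (abs_l2 (indicator {..<x})))\<^sup>2 \<le> 1\<^sup>2" using U.prob_space by simp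
  then have n: "norm (abs_l2 (indicator {..<x})) \<le> 1" by (rule power2_le_imp_le) simp
  have "primitive g x = inner (abs_l2 (indicator {..<x})) (abs_l2 g)"
    unfolding primitive_def by (rule inner_abs_l2[OF i g, symmetric])
  also have "\<bar>\<dots>\<bar> \<le> norm (abs_l2 (indicator {..<x})) * norm (abs_l2 g)" by (rule Cauchy_Schwarz_ineq2)
  also have "\<dots> \<le> 1 * norm (abs_l2 g)" using n by (intro mult_right_mono) auto
  finally show ?thesis by simp
qed

lemma measurable_primitive:
  assumes [measurable]: "g \<in> borel_measurable unit_leb"
  shows "primitive g \<in> borel_measurable unit_leb"
proof -
  have [measurable]: "(\<lambda>p. fst p) \<in> unit_leb \<Otimes>\<^sub>M unit_leb \<rightarrow>\<^sub>M borel" "(\<lambda>p. snd p) \<in> unit_leb \<Otimes>\<^sub>M unit_leb \<rightarrow>\<^sub>M borel"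
    using measurable_compose[OF measurable_fst id_measurable_unit_leb]
      measurable_compose[OF measurable_snd id_measurable_unit_leb] by auto
  have "(\<lambda>(x, y). indicator {..<x} y * g y) = (\<lambda>p. (if snd p < fst p then g (snd p) else 0))"
    by (auto simp: indicator_def fun_eq_iff)
  then have "(\<lambda>(x, y). indicator {..<x} y * g y) \<in> borel_measurable (unit_leb \<Otimes>\<^sub>M unit_leb)"
    by simp
  then show ?thesis
    unfolding primitive_def[abs_def] by (rule U.borel_measurable_lebesgue_integral)
qed

lemma sq_integrable_primitive:
  assumes "sq_integrable g"
  shows "sq_integrable (primitive g)"
  using assms primitive_bound[OF assms] measurable_primitive
  by (intro sq_integrable_unit_bounded[where B = "norm (abs_l2 g)"]) (auto simp: sq_integrable_def)

lemma volterra_abs_l2: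
  assumes g: "sq_integrable g"
  shows "volterra (abs_l2 g) = abs_l2 (primitive g)"
proof -
  have "primitive (rep_l2 (abs_l2 g)) x = primitive g x" for x
    unfolding primitive_def
  proof (rule integral_cong_AE)
    show "AE y in unit_leb. indicator {..<x} y * rep_l2 (abs_l2 g) y = indicator {..<x} y * g y"
      using rep_abs_l2[OF g] by eventually_elim simp
  qed (use integrable_indicator_times[OF g] integrable_indicator_times[OF sq_integrable_rep] in auto)
  then show ?thesis unfolding volterra_def by presburger
qed

lemma norm_volterra_le: "norm (volterra f) \<le> norm f"
proof (rule power2_le_imp_le)
  have p: "sq_integrable (primitive (rep_l2 f))" by (rule sq_integrable_primitive[OF sq_integrable_rep])
  have b: "\<bar>primitive (rep_l2 f) x\<bar> \<le> norm f" for x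
    using primitive_bound[OF sq_integrable_rep, of f x] by simp
  have "(norm (volterra f))\<^sup>2 = (\<integral>x. primitive (rep_l2 f) x * primitive (rep_l2 f) x \<partial>unit_leb)"
    unfolding power2_norm_eq_inner volterra_def by (rule inner_abs_l2[OF p p])
  also have "\<dots> \<le> (\<integral>x. (norm f)\<^sup>2 \<partial>unit_leb)"
  proof (rule integral_mono[OF sq_integrable_mult[OF p p]])
    fix x
    have "\<bar>primitive (rep_l2 f) x\<bar>\<^sup>2 \<le> (norm f)\<^sup>2" by (intro power_mono b) simp
    then show "primitive (rep_l2 f) x * primitive (rep_l2 f) x \<le> (norm f)\<^sup>2" by (simp add: power2_eq_square)
  qed simp
  also have "\<dots> = (norm f)\<^sup>2" using U.prob_space by simp
  finally show "(norm (volterra f))\<^sup>2 \<le> (norm f)\<^sup>2" .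
qed simp

lemma volterra_add: "volterra (f + g) = volterra f + volterra g"
proof -
  have fg: "f + g = abs_l2 (\<lambda>x. rep_l2 f x + rep_l2 g x)"
    by (simp add: abs_l2_add sq_integrable_rep)
  have "primitive (\<lambda>x. rep_l2 f x + rep_l2 g x) = (\<lambda>x. primitive (rep_l2 f) x + primitive (rep_l2 g) x)"
    unfolding primitive_def
    by (simp add: distrib_left integrable_indicator_times sq_integrable_rep fun_eq_iff)
  then have "volterra (f + g) = abs_l2 (\<lambda>x. primitive (rep_l2 f) x + primitive (rep_l2 g) x)"
    unfolding fg by (simp only: volterra_abs_l2[OF sq_integrable_add[OF sq_integrable_rep sq_integrable_rep]])
  also have "\<dots> = volterra f + volterra g"
    unfolding volterra_def by (intro abs_l2_add sq_integrable_primitive sq_integrable_rep)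
  finally show ?thesis .
qed

lemma volterra_scaleR: "volterra (c *\<^sub>R f) = c *\<^sub>R volterra f"
proof -
  have cf: "c *\<^sub>R f = abs_l2 (\<lambda>x. c * rep_l2 f x)"
    by (simp add: abs_l2_scale sq_integrable_rep)
  have "primitive (\<lambda>x. c * rep_l2 f x) = (\<lambda>x. c * primitive (rep_l2 f) x)"
    unfolding primitive_def by (simp add: mult.left_commute fun_eq_iff)
  then have "volterra (c *\<^sub>R f) = abs_l2 (\<lambda>x. c * primitive (rep_l2 f) x)"
    unfolding cf by (simp only: volterra_abs_l2[OF sq_integrable_scale[OF sq_integrable_rep]])
  also have "\<dots> = c *\<^sub>R volterra f"
    unfolding volterra_def by (intro abs_l2_scale sq_integrable_primitive sq_integrable_rep)
  finally show ?thesis .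
qed

lemma volterra_sum: "volterra (\<Sum>i\<in>A. f i) = (\<Sum>i\<in>A. volterra (f i))"
  using volterra_scaleR[of 0 0]
  by (induction A rule: infinite_finite_induct) (auto simp: volterra_add)

lemma primitive_eq_diff:
  assumes g: "sq_integrable g"
  shows "primitive g x = (\<integral>y. g y \<partial>unit_leb) - (\<integral>y. indicator {x..} y * g y \<partial>unit_leb)"
proof -
  have "indicator {..<x} y * g y = g y - indicator {x..} y * g y" for y by (auto simp: indicator_def)
  moreover have "integrable unit_leb (\<lambda>y. indicator {x..} y * g y)"
    using sq_integrable_mult[OF sq_integrable_unit_bounded[where B = 1] g, of "indicator {x..}"]
    by (auto simp: indicator_def)
  ultimately show ?thesis
    unfolding primitive_def using sq_integrable_integrable[OF g] by simp
qed

text \<open>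
  The standard deviations of the Karhunen-Loeve coordinates of the Brownian bridge, which are also
  the singular values of the integration operator.
\<close>

definition kl_sd :: "nat \<Rightarrow> real" where "kl_sd j = 1 / (pi * real (Suc j))"

lemma kl_sd_pos: "kl_sd j > 0" by (simp add: kl_sd_def)

lemma volterra_cosb: "volterra (cosb j) = kl_sd j *\<^sub>R sinb j"
proof -
  define k where "k = pi * real (Suc j)"
  have k: "k > 0" "sin k = 0" unfolding k_def by (simp, rule sin_pi_nat)
  have f: "kl_sd j = 1 / k" by (simp add: kl_sd_def k_def)
  have cosk: "cosb j = abs_l2 (\<lambda>x. sqrt 2 * cos (k * x))" by (simp only: cos_basis.abs_eq k_def)
  have sink: "sinb j = abs_l2 (\<lambda>x. sqrt 2 * sin (k * x))" by (simp only: sin_basis_def k_def)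
  have sqc: "sq_integrable (\<lambda>x. sqrt 2 * cos (k * x))" unfolding k_def by (rule sq_integrable_cos)
  have sqs: "sq_integrable (\<lambda>x. sqrt 2 * sin (k * x))" unfolding k_def by (rule sq_integrable_sin)
  define F where "F x = sqrt 2 * sin (k * x) / k" for x
  have F: "DERIV F x :> sqrt 2 * cos (k * x)" for x
    unfolding F_def using k by (auto intro!: derivative_eq_intros)
  have p: "primitive (\<lambda>x. sqrt 2 * cos (k * x)) x = 1 / k * (sqrt 2 * sin (k * x))" if x: "0 < x" "x < 1" for x
  proof -
    have "(\<integral>y. sqrt 2 * cos (k * y) \<partial>unit_leb) = F 1 - F 0"
      by (rule integral_unit_leb_FTC0[OF F]) (intro continuous_intros)
    moreover have "(\<integral>y. indicator {x..} y * (sqrt 2 * cos (k * y)) \<partial>unit_leb) = F 1 - F x"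
      by (rule integral_unit_leb_FTC[OF _ _ F]) (use x in \<open>auto intro!: continuous_intros\<close>)
    ultimately show ?thesis unfolding primitive_eq_diff[OF sqc] by (simp add: F_def)
  qed
  have "volterra (cosb j) = abs_l2 (primitive (\<lambda>x. sqrt 2 * cos (k * x)))"
    unfolding cosk by (rule volterra_abs_l2[OF sqc])
  also have "\<dots> = abs_l2 (\<lambda>x. 1 / k * (sqrt 2 * sin (k * x)))"
    using p by (intro abs_l2_eqI sq_integrable_primitive sq_integrable_scale[OF sqs] sqc) auto
  also have "\<dots> = (1 / k) *\<^sub>R sinb j"
    unfolding sink by (rule abs_l2_scale[OF sqs])
  finally show ?thesis by (simp add: f)
qed

lemma AE_unit_leb_neq: "AE y in unit_leb. y \<noteq> x"
  unfolding unit_leb_def using AE_lborel_singleton[of x]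
  by (subst AE_restrict_space_iff) auto

text \<open>
  The mean of \<open>1{y \<le> x} - x\<close> under the density \<open>g\<close> is the deviation
  of its distribution function from \<open>x\<close>. Fubini exchanges this mean with the inner
  product.
\<close>

lemma integral_inner_jump:
  assumes g: "sq_integrable g" "(\<integral>y. g y \<partial>unit_leb) = 1"
  shows "(\<integral>y. g y * inner (jump y) w \<partial>unit_leb) = inner (abs_l2 (\<lambda>x. primitive g x - x)) w"
proof -
  interpret P: pair_prob_space unit_leb unit_leb ..
  define v where "v = rep_l2 w"
  have v: "sq_integrable v" "w = abs_l2 v" by (simp_all add: v_def sq_integrable_rep)
  have [measurable]: "v \<in> borel_measurable unit_leb" "g \<in> borel_measurable unit_leb"
    using v g by (auto simp: sq_integrable_def)
  have [measurable]: "(\<lambda>p. fst p) \<in> unit_leb \<Otimes>\<^sub>M unit_leb \<rightarrow>\<^sub>M borel" "(\<lambda>p. snd p) \<in> unit_leb \<Otimes>\<^sub>M unit_leb \<rightarrow>\<^sub>M borel"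
    using measurable_compose[OF measurable_fst id_measurable_unit_leb]
      measurable_compose[OF measurable_snd id_measurable_unit_leb] by auto
  define K where "K x y = (indicator {y..} x - x) * v x * g y" for x y
  have "case_prod K = (\<lambda>p. ((if snd p \<le> fst p then 1 else 0) - fst p) * v (fst p) * g (snd p))"
    by (auto simp: K_def indicator_def fun_eq_iff)
  then have Km: "case_prod K \<in> borel_measurable (unit_leb \<Otimes>\<^sub>M unit_leb)" by simp
  have gi: "integrable unit_leb g" and vi: "integrable unit_leb v"
    using sq_integrable_integrable g v by auto
  have Ki: "integrable (unit_leb \<Otimes>\<^sub>M unit_leb) (case_prod K)"
  proof (rule Bochner_Integration.integrable_bound[OF _ Km])
    show "integrable (unit_leb \<Otimes>\<^sub>M unit_leb) (\<lambda>(x, y). v x * g y)"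
    proof (rule P.Fubini_integrable)
      have "(\<lambda>(x, y). v x * g y) = (\<lambda>p. v (fst p) * g (snd p))" by auto
      then show "(\<lambda>(x, y). v x * g y) \<in> borel_measurable (unit_leb \<Otimes>\<^sub>M unit_leb)" by simp
    qed (use gi vi in \<open>auto simp: abs_mult\<close>)
    show "AE p in unit_leb \<Otimes>\<^sub>M unit_leb. norm (case_prod K p) \<le> norm (case p of (x, y) \<Rightarrow> v x * g y)"
    proof (rule AE_I2)
      fix p assume "p \<in> space (unit_leb \<Otimes>\<^sub>M unit_leb)"
      then obtain x y where p: "p = (x, y)" "0 < x" "x < 1" by (auto simp: space_pair_measure)
      have "\<bar>indicator {y..} x - x\<bar> \<le> 1" using p by (auto simp: indicator_def)
      then have "\<bar>indicator {y..} x - x\<bar> * \<bar>v x * g y\<bar> \<le> 1 * \<bar>v x * g y\<bar>" by (intro mult_right_mono) auto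
      then show "norm (case_prod K p) \<le> norm (case p of (x, y) \<Rightarrow> v x * g y)"
        by (simp add: p K_def abs_mult mult.assoc)
    qed
  qed
  have pid: "sq_integrable (\<lambda>x. primitive g x - x)"
  proof -
    have "sq_integrable (\<lambda>x. primitive g x + (-1) * x)"
      by (intro sq_integrable_add sq_integrable_primitive g sq_integrable_unit_bounded[where B = 1]) auto
    then show ?thesis by simp
  qed
  have "(\<integral>y. g y * inner (jump y) w \<partial>unit_leb) = (\<integral>y. \<integral>x. K x y \<partial>unit_leb \<partial>unit_leb)"
  proof (rule Bochner_Integration.integral_cong[OF refl])
    fix y
    have "inner (jump y) w = (\<integral>x. (indicator {y..} x - x) * v x \<partial>unit_leb)"
      unfolding jump_def v(2) by (rule inner_abs_l2[OF sq_integrable_jump v(1)])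
    then show "g y * inner (jump y) w = (\<integral>x. K x y \<partial>unit_leb)" by (simp add: K_def mult.commute)
  qed
  also have "\<dots> = (\<integral>x. \<integral>y. K x y \<partial>unit_leb \<partial>unit_leb)" by (rule P.Fubini_integral[OF Ki])
  also have "\<dots> = (\<integral>x. (primitive g x - x) * v x \<partial>unit_leb)"
  proof (rule Bochner_Integration.integral_cong[OF refl])
    fix x
    have "(\<integral>y. K x y \<partial>unit_leb) = (\<integral>y. v x * (indicator {..<x} y * g y) - x * v x * g y \<partial>unit_leb)"
    proof (rule integral_cong_AE)
      show "AE y in unit_leb. K x y = v x * (indicator {..<x} y * g y) - x * v x * g y"
        using AE_unit_leb_neq[of x] by eventually_elim (auto simp: K_def indicator_def algebra_simps)
      have "K x = (\<lambda>y. ((if y \<le> x then 1 else 0) - x) * v x * g y)" by (auto simp: K_def indicator_def)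
      then show "K x \<in> borel_measurable unit_leb" by simp
    qed measurable
    also have "\<dots> = (primitive g x - x) * v x"
      using gi integrable_indicator_times[OF g(1)] g(2)
      by (subst Bochner_Integration.integral_diff) (auto simp: primitive_def left_diff_distrib)
    finally show "(\<integral>y. K x y \<partial>unit_leb) = (primitive g x - x) * v x" .
  qed
  also have "\<dots> = inner (abs_l2 (\<lambda>x. primitive g x - x)) w"
    unfolding v(2) by (rule inner_abs_l2[OF pid v(1), symmetric])
  finally show ?thesis .
qed

text \<open>
  In weak form, the mean of the contribution of one observation is the integrated alternative.
\<close>

lemma integral_inner_jump_volterra:
  assumes f: "(\<integral>y. 1 + rep_l2 f y \<partial>unit_leb) = 1"
  shows "(\<integral>y. (1 + rep_l2 f y) * inner (jump y) w \<partial>unit_leb) = inner (volterra f) w"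
proof -
  have one: "sq_integrable (\<lambda>_. 1)" by (simp add: sq_integrable_def)
  have g: "sq_integrable (\<lambda>y. 1 + rep_l2 f y)"
    by (rule sq_integrable_add[OF one sq_integrable_rep])
  have p: "primitive (\<lambda>y. 1 + rep_l2 f y) x - x = primitive (rep_l2 f) x" if "0 < x" "x < 1" for x
  proof -
    have "primitive (\<lambda>y. 1 + rep_l2 f y) x = primitive (\<lambda>_. 1) x + primitive (rep_l2 f) x"
      unfolding primitive_def using integrable_indicator_times[OF one, of x] integrable_indicator_times[OF sq_integrable_rep, of x f]
      by (simp add: distrib_left)
    also have "primitive (\<lambda>_. 1) x = x"
      unfolding primitive_eq_diff[OF one] using integral_indicator_poly[of x 0] that U.prob_space by simp
    finally show ?thesis by simp
  qed
  have "abs_l2 (\<lambda>x. primitive (\<lambda>y. 1 + rep_l2 f y) x - x) = volterra f"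
    unfolding volterra_def
  proof (rule abs_l2_eqI)
    have "sq_integrable (\<lambda>x. primitive (\<lambda>y. 1 + rep_l2 f y) x + (-1) * x)"
      by (intro sq_integrable_add sq_integrable_primitive g sq_integrable_unit_bounded[where B = 1]) auto
    then show "sq_integrable (\<lambda>x. primitive (\<lambda>y. 1 + rep_l2 f y) x - x)" by simp
  qed (use p in \<open>auto intro: sq_integrable_primitive sq_integrable_rep\<close>)
  then show ?thesis using integral_inner_jump[OF g f] by simp
qed

text \<open>
  On frequencies above \<open>l\<close> the operator multiplies coordinates by at most \<open>1 /
  (\<pi> (l + 1))\<close>. Finite sections are estimated by coordinates and the remainder by the
  norm bound of the operator.
\<close>

lemma volterra_tail_bound:
  assumes span: "(\<lambda>m. resid cosb m f) \<longlonglongrightarrow> 0"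
  shows "norm (volterra (resid cosb l f)) \<le> kl_sd l * norm (resid cosb l f)"
proof -
  let ?e = "cosb" and ?c = "\<lambda>j. inner f (cosb j)"
  have part: "norm (volterra (resid ?e l f)) \<le> kl_sd l * norm (resid ?e l f) + norm (resid ?e m f)" if m: "l \<le> m" for m
  proof -
    have "resid ?e l f - resid ?e m f = (\<Sum>j<m. (if j < l then 0 else ?c j) *\<^sub>R cosb j)"
    proof -
      have "(\<Sum>j<m. ?c j *\<^sub>R cosb j) = (\<Sum>j<m. (if j < l then 0 else ?c j) *\<^sub>R cosb j) + (\<Sum>j<m. (if j < l then ?c j else 0) *\<^sub>R cosb j)"
        unfolding sum.distrib[symmetric] by (rule sum.cong) auto
      moreover have "(\<Sum>j<m. (if j < l then ?c j else 0) *\<^sub>R cosb j) = (\<Sum>j<l. ?c j *\<^sub>R cosb j)"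
        using m by (intro sum.mono_neutral_cong_right) auto
      ultimately show ?thesis by (simp add: resid_def)
    qed
    then have eq: "resid ?e l f = (\<Sum>j<m. (if j < l then 0 else ?c j) *\<^sub>R cosb j) + resid ?e m f"
      by (simp add: algebra_simps)
    have v: "volterra (resid ?e l f) = (\<Sum>j<m. ((if j < l then 0 else ?c j) * kl_sd j) *\<^sub>R sinb j) + volterra (resid ?e m f)"
      by (subst eq) (simp add: volterra_add volterra_sum volterra_scaleR volterra_cosb)
    have "(norm (\<Sum>j<m. ((if j < l then 0 else ?c j) * kl_sd j) *\<^sub>R sinb j))\<^sup>2
        = (\<Sum>j<m. ((if j < l then 0 else ?c j) * kl_sd j)\<^sup>2)"
      by (rule norm_sq_orthonormal_sum[OF orthonormal_sinb])
    also have "\<dots> \<le> (\<Sum>j<m. (kl_sd l)\<^sup>2 * (inner (resid ?e l f) (cosb j))\<^sup>2)"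
    proof (rule sum_mono)
      fix j
      have "(kl_sd j)\<^sup>2 \<le> (kl_sd l)\<^sup>2" if "l \<le> j"
        using that kl_sd_pos[of j] unfolding kl_sd_def
        by (intro power_mono divide_left_mono mult_left_mono) (auto simp: less_imp_le)
      then show "((if j < l then 0 else ?c j) * kl_sd j)\<^sup>2 \<le> (kl_sd l)\<^sup>2 * (inner (resid ?e l f) (cosb j))\<^sup>2"
        by (auto simp: inner_resid[OF orthonormal_cosb] power_mult_distrib mult.commute[of "(inner f (cosb j))\<^sup>2"] intro!: mult_right_mono)
    qed
    also have "\<dots> \<le> (kl_sd l)\<^sup>2 * (norm (resid ?e l f))\<^sup>2"
      unfolding sum_distrib_left[symmetric] by (intro mult_left_mono bessel orthonormal_cosb) auto
    finally have "(norm (\<Sum>j<m. ((if j < l then 0 else ?c j) * kl_sd j) *\<^sub>R sinb j))\<^sup>2 \<le> (kl_sd l * norm (resid ?e l f))\<^sup>2"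
      by (simp add: power_mult_distrib)
    then have "norm (\<Sum>j<m. ((if j < l then 0 else ?c j) * kl_sd j) *\<^sub>R sinb j) \<le> kl_sd l * norm (resid ?e l f)"
      by (rule power2_le_imp_le) (use kl_sd_pos[of l] in auto)
    then show ?thesis unfolding v
      using norm_triangle_ineq[of "\<Sum>j<m. ((if j < l then 0 else ?c j) * kl_sd j) *\<^sub>R sinb j" "volterra (resid ?e m f)"]
        norm_volterra_le[of "resid ?e m f"] by linarith
  qed
  have "(\<lambda>m. kl_sd l * norm (resid ?e l f) + norm (resid ?e m f)) \<longlonglongrightarrow> kl_sd l * norm (resid ?e l f) + norm (0::l2)"
    by (intro tendsto_intros span)
  then have "(\<lambda>m. kl_sd l * norm (resid ?e l f) + norm (resid ?e m f)) \<longlonglongrightarrow> kl_sd l * norm (resid ?e l f)" by simp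
  then show ?thesis
    by (rule LIMSEQ_le_const) (use part in blast)
qed

section \<open>Besov bodies\<close>

lemma has_cos_coeffs_iff:
  "has_cos_coeffs f \<theta> \<longleftrightarrow> (\<forall>j. \<theta> (Suc j) = inner f (cosb j)) \<and> (\<lambda>m. resid cosb m f) \<longlonglongrightarrow> 0"
proof
  assume h: "has_cos_coeffs f \<theta>"
  have c: "\<theta> (Suc j) = inner f (cosb j)" for j
    using sums_coeff[OF orthonormal_cosb, of "\<lambda>j. \<theta> (Suc j)"] h by (simp add: has_cos_coeffs_def)
  with h show "(\<forall>j. \<theta> (Suc j) = inner f (cosb j)) \<and> (\<lambda>m. resid cosb m f) \<longlonglongrightarrow> 0"
    by (simp add: has_cos_coeffs_def sums_iff_resid_tendsto)
next
  assume "(\<forall>j. \<theta> (Suc j) = inner f (cosb j)) \<and> (\<lambda>m. resid cosb m f) \<longlonglongrightarrow> 0"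
  then show "has_cos_coeffs f \<theta>" by (simp add: has_cos_coeffs_def sums_iff_resid_tendsto)
qed

text \<open>
  Indices above \<open>u\<close> are those above \<open>\<lfloor>u\<rfloor>\<close>, and the
  squared coefficients beyond that index sum to the squared norm of the residual.
\<close>

lemma infsum_tail_coeffs:
  assumes h: "has_cos_coeffs f \<theta>" and u: "u > 0"
  shows "(\<Sum>\<^sub>\<infinity>j\<in>{j::nat. real j > u}. (\<theta> j)\<^sup>2) = (norm (resid cosb (nat \<lfloor>u\<rfloor>) f))\<^sup>2"
proof -
  define l where "l = nat \<lfloor>u\<rfloor>"
  have "{j::nat. real j > u} = (\<lambda>j. Suc (j + l)) ` UNIV"
  proof (rule set_eqI)
    fix j
    have "real j > u \<longleftrightarrow> l < j" unfolding l_def using u by linarith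
    also have "\<dots> \<longleftrightarrow> j \<in> range (\<lambda>j. Suc (j + l))"
      using less_iff_Suc_add[of l j] by (auto simp: add.commute)
    finally show "j \<in> {j. real j > u} \<longleftrightarrow> j \<in> range (\<lambda>j. Suc (j + l))" by simp
  qed
  then have "(\<Sum>\<^sub>\<infinity>j\<in>{j::nat. real j > u}. (\<theta> j)\<^sup>2) = (\<Sum>\<^sub>\<infinity>j. (\<theta> (Suc (j + l)))\<^sup>2)"
    by (simp add: infsum_reindex inj_on_def o_def)
  also have "\<dots> = (norm (resid cosb l f))\<^sup>2"
  proof (rule infsumI, rule sums_nonneg_imp_has_sum)
    show "(\<lambda>j. (\<theta> (Suc (j + l)))\<^sup>2) sums (norm (resid cosb l f))\<^sup>2"
      using resid_tail_sums[OF orthonormal_cosb, of f l] h by (simp add: has_cos_coeffs_iff)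
  qed simp
  finally show ?thesis by (simp add: l_def)
qed

definition cos_span :: "l2 set" where
  "cos_span = {f. (\<lambda>m. resid cosb m f) \<longlonglongrightarrow> 0}"

abbreviation besov_weight :: "real \<Rightarrow> real \<Rightarrow> l2 \<Rightarrow> real" where
  "besov_weight s u f \<equiv> u powr (2 * s) * (norm (resid cosb (nat \<lfloor>u\<rfloor>) f))\<^sup>2"

text \<open>
  Membership becomes a family of bounds on residual norms, one for each \<open>u\<close>.
  Residuals are linear and continuous, which gives convexity and closedness.
\<close>

lemma besov_body_iff:
  "f \<in> besov_body s P \<longleftrightarrow> f \<in> cos_span \<and>
    (\<forall>u>0. besov_weight s u f \<le> P)"
proof -
  have ex: "(\<exists>\<theta>. has_cos_coeffs f \<theta>) \<longleftrightarrow> f \<in> cos_span"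
    unfolding has_cos_coeffs_iff cos_span_def by (auto intro: exI[of _ "\<lambda>j. inner f (cosb (j - 1))"])
  have "(SUP u\<in>{0<..}. ereal (u powr (2 * s) * (\<Sum>\<^sub>\<infinity>j\<in>{j::nat. real j > u}. (\<theta> j)\<^sup>2))) \<le> ereal P \<longleftrightarrow>
    (\<forall>u>0. besov_weight s u f \<le> P)" if "has_cos_coeffs f \<theta>" for \<theta>
    unfolding SUP_le_iff using infsum_tail_coeffs[OF that] by auto
  then show ?thesis unfolding besov_body_def using ex by auto
qed



lemma resid_tendsto:
  assumes "f \<longlonglongrightarrow> x"
  shows "(\<lambda>n. resid e m (f n)) \<longlonglongrightarrow> resid e m x"
  unfolding resid_def by (intro tendsto_intros assms)

lemma cos_span_add:
  assumes "f \<in> cos_span" "g \<in> cos_span"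
  shows "a *\<^sub>R f + b *\<^sub>R g \<in> cos_span"
proof -
  have "(\<lambda>m. a *\<^sub>R resid cosb m f + b *\<^sub>R resid cosb m g) \<longlonglongrightarrow> a *\<^sub>R 0 + b *\<^sub>R 0"
    using assms unfolding cos_span_def by (intro tendsto_intros) auto
  then show ?thesis by (simp add: cos_span_def resid_add resid_scaleR)
qed

lemma bounded_besov_body: "bounded (besov_body s P)"
proof -
  have "norm f \<le> sqrt (P / (1 / 2) powr (2 * s))" if "f \<in> besov_body s P" for f
  proof (rule real_le_rsqrt)
    have "(1 / 2) powr (2 * s) * (norm (resid cosb (nat \<lfloor>1 / 2 :: real\<rfloor>) f))\<^sup>2 \<le> P"
      using that unfolding besov_body_iff by (metis half_gt_zero_iff zero_less_one)
    then show "(norm f)\<^sup>2 \<le> P / (1 / 2) powr (2 * s)" by (simp add: pos_le_divide_eq mult.commute)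
  qed
  then show ?thesis by (auto simp: bounded_iff)
qed

lemma closed_besov_body: "closed (besov_body s P)"
  unfolding closed_sequential_limits
proof (intro allI impI)
  fix f x assume "(\<forall>n. f n \<in> besov_body s P) \<and> f \<longlonglongrightarrow> x"
  then have f: "\<And>n. f n \<in> besov_body s P" and lim: "f \<longlonglongrightarrow> x" by auto
  have "x \<in> cos_span"
    unfolding cos_span_def using f by (auto intro!: resid_closed[OF orthonormal_cosb lim] simp: besov_body_iff cos_span_def)
  moreover have "besov_weight s u x \<le> P" if u: "u > 0" for u
  proof (rule LIMSEQ_le_const2)
    show "(\<lambda>n. besov_weight s u (f n)) \<longlonglongrightarrow> besov_weight s u x"
      by (intro tendsto_intros resid_tendsto lim)
    show "\<exists>N. \<forall>n\<ge>N. besov_weight s u (f n) \<le> P"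
      using f u by (auto simp: besov_body_iff)
  qed
  ultimately show "x \<in> besov_body s P" by (auto simp: besov_body_iff)
qed

lemma convex_besov_body: "convex (besov_body s P)"
proof (rule convexI)
  fix f g and a b :: real
  assume f: "f \<in> besov_body s P" and g: "g \<in> besov_body s P" and ab: "0 \<le> a" "0 \<le> b" "a + b = 1"
  have "u powr (2 * s) * (norm (resid cosb (nat \<lfloor>u\<rfloor>) (a *\<^sub>R f + b *\<^sub>R g)))\<^sup>2 \<le> P" if u: "u > 0" for u
  proof -
    define c where "c = P / u powr (2 * s)"
    define X where "X = resid cosb (nat \<lfloor>u\<rfloor>) f"
    define Y where "Y = resid cosb (nat \<lfloor>u\<rfloor>) g"
    have up: "u powr (2 * s) > 0" using u by simp
    have X: "(norm X)\<^sup>2 \<le> c" and Y: "(norm Y)\<^sup>2 \<le> c"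
      using f g u up by (auto simp: besov_body_iff c_def X_def Y_def pos_le_divide_eq mult.commute)
    have c0: "0 \<le> c" using X order_trans[OF zero_le_power2] by blast
    have "norm (a *\<^sub>R X + b *\<^sub>R Y) \<le> a * norm X + b * norm Y"
      using norm_triangle_ineq[of "a *\<^sub>R X" "b *\<^sub>R Y"] ab by simp
    also have "\<dots> \<le> a * sqrt c + b * sqrt c"
      using real_le_rsqrt[OF X] real_le_rsqrt[OF Y] ab by (intro add_mono mult_left_mono) auto
    also have "\<dots> = sqrt c" using ab by (simp add: distrib_right[symmetric])
    finally have "(norm (a *\<^sub>R X + b *\<^sub>R Y))\<^sup>2 \<le> (sqrt c)\<^sup>2" by (intro power_mono) auto
    then have "(norm (a *\<^sub>R X + b *\<^sub>R Y))\<^sup>2 \<le> P / u powr (2 * s)" using c0 by (simp add: c_def)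
    then show ?thesis using up by (simp add: resid_add resid_scaleR X_def Y_def pos_le_divide_eq mult.commute)
  qed
  then show "a *\<^sub>R f + b *\<^sub>R g \<in> besov_body s P"
    using f g cos_span_add by (auto simp: besov_body_iff)
qed

lemma ortho_symmetric_besov_body: "ortho_symmetric (besov_body s P)"
  unfolding ortho_symmetric_def
proof (intro allI impI)
  fix f \<theta> f' \<theta>'
  assume h: "has_cos_coeffs f \<theta>" and f: "f \<in> besov_body s P" and sg: "\<forall>j. \<theta>' j = \<theta> j \<or> \<theta>' j = - \<theta> j"
    and h': "has_cos_coeffs f' \<theta>'"
  have "(norm (resid cosb l f'))\<^sup>2 = (norm (resid cosb l f))\<^sup>2" for l
  proof -
    have "(inner f' (cosb j))\<^sup>2 = (inner f (cosb j))\<^sup>2" for j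
      using h h' sg by (metis has_cos_coeffs_iff power2_minus)
    then show ?thesis
      using resid_tail_sums[OF orthonormal_cosb, of f l] resid_tail_sums[OF orthonormal_cosb, of f' l] h h'
      by (simp add: has_cos_coeffs_iff sums_unique2)
  qed
  then show "f' \<in> besov_body s P"
    using f h' by (auto simp: besov_body_iff cos_span_def has_cos_coeffs_iff)
qed

lemma dilation_besov_bound:
  assumes "f \<in> (*\<^sub>R) \<gamma> ` besov_body s P" "u > 0"
  shows "besov_weight s u f \<le> \<gamma>\<^sup>2 * P"
proof -
  obtain g where g: "g \<in> besov_body s P" "f = \<gamma> *\<^sub>R g" using assms(1) by auto
  have "\<gamma>\<^sup>2 * (besov_weight s u g) \<le> \<gamma>\<^sup>2 * P"
    using g(1) assms(2) by (intro mult_left_mono) (auto simp: besov_body_iff)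
  then show ?thesis by (simp add: g(2) resid_scaleR power_mult_distrib mult_ac)
qed

text \<open>
  If the weighted tails were bounded by \<open>K\<close>, then dividing by \<open>sqrt (K /
  P)\<close> would put \<open>f\<close> into the body.
\<close>

lemma not_dilation_unbounded:
  assumes f: "f \<in> cos_span" "f \<notin> dilations (besov_body s P)" and P: "P > 0" and K: "K > 0"
  shows "\<exists>u>0. K < besov_weight s u f"
proof (rule ccontr)
  assume "\<not> ?thesis"
  then have b: "\<And>u. u > 0 \<Longrightarrow> besov_weight s u f \<le> K" by (meson not_less)
  define \<gamma> where "\<gamma> = sqrt (K / P)"
  have \<gamma>: "\<gamma> > 0" "\<gamma>\<^sup>2 = K / P" using K P by (auto simp: \<gamma>_def)
  have "(1 / \<gamma>) *\<^sub>R f \<in> besov_body s P"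
    unfolding besov_body_iff
  proof (intro conjI allI impI)
    show "(1 / \<gamma>) *\<^sub>R f \<in> cos_span" using cos_span_add[OF f(1) f(1), of "1 / \<gamma>" 0] by simp
    fix u :: real assume u: "0 < u"
    have "u powr (2 * s) * (norm (resid cosb (nat \<lfloor>u\<rfloor>) ((1 / \<gamma>) *\<^sub>R f)))\<^sup>2
      = (besov_weight s u f) / \<gamma>\<^sup>2"
      by (simp add: resid_scaleR power_mult_distrib power_divide)
    also have "\<dots> \<le> K / \<gamma>\<^sup>2" by (rule divide_right_mono[OF b[OF u] zero_le_power2])
    also have "\<dots> = P" using \<gamma> K P by simp
    finally show "u powr (2 * s) * (norm (resid cosb (nat \<lfloor>u\<rfloor>) ((1 / \<gamma>) *\<^sub>R f)))\<^sup>2 \<le> P" .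
  qed
  moreover have "f = \<gamma> *\<^sub>R ((1 / \<gamma>) *\<^sub>R f)" using \<gamma> by simp
  ultimately have "f \<in> dilations (besov_body s P)" unfolding dilations_def using \<gamma>(1) by blast
  with f(2) show False by simp
qed

lemma cos_tail_eq_resid:
  assumes "has_cos_coeffs f \<theta>"
  shows "cos_tail \<theta> l = resid cosb l f"
proof -
  have c: "\<theta> (Suc j) = inner f (cosb j)" for j using assms by (simp add: has_cos_coeffs_iff)
  have "(\<lambda>j. \<theta> (Suc (j + l)) *\<^sub>R cosb (j + l)) sums (f - (\<Sum>j<l. \<theta> (Suc j) *\<^sub>R cosb j))"
    by (rule sums_split_initial_segment) (use assms in \<open>simp add: has_cos_coeffs_def\<close>)
  then have "(\<lambda>j. \<theta> (j + Suc l) *\<^sub>R cos_basis (j + Suc l)) sums resid cosb l f"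
    by (simp add: resid_def c)
  then show ?thesis unfolding cos_tail_def by (rule sums_unique[symmetric])
qed

text \<open>
  The residual is the midpoint of \<open>f\<close> and of the function with the first
  \<open>l\<close> signs reversed.
\<close>

lemma resid_in_convex_ortho_symmetric:
  assumes V: "convex V" "ortho_symmetric V" and f: "f \<in> V" "has_cos_coeffs f \<theta>"
  shows "resid cosb l f \<in> V"
proof -
  have c: "\<theta> (Suc j) = inner f (cosb j)" for j using f(2) by (simp add: has_cos_coeffs_iff)
  define \<theta>' where "\<theta>' j = (if j \<le> l then - \<theta> j else \<theta> j)" for j
  define S where "S = (\<Sum>j<l. \<theta> (Suc j) *\<^sub>R cosb j)"
  have "(\<lambda>j. if j < l then \<theta> (Suc j) *\<^sub>R cosb j else 0) sums S"
    using sums_If_finite[of "\<lambda>j. j < l" "\<lambda>j. \<theta> (Suc j) *\<^sub>R cosb j"] by (simp add: S_def lessThan_def)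
  from sums_diff[OF f(2)[unfolded has_cos_coeffs_def] sums_scaleR_right[OF this, of 2]]
  have "(\<lambda>j. \<theta> (Suc j) *\<^sub>R cosb j - 2 *\<^sub>R (if j < l then \<theta> (Suc j) *\<^sub>R cosb j else 0)) sums (f - 2 *\<^sub>R S)" .
  moreover have "\<theta> (Suc j) *\<^sub>R cosb j - 2 *\<^sub>R (if j < l then \<theta> (Suc j) *\<^sub>R cosb j else 0) = \<theta>' (Suc j) *\<^sub>R cosb j" for j
    by (auto simp: \<theta>'_def scaleR_2)
  ultimately have "has_cos_coeffs (f - 2 *\<^sub>R S) \<theta>'" by (simp add: has_cos_coeffs_def)
  moreover have "\<forall>j. \<theta>' j = \<theta> j \<or> \<theta>' j = - \<theta> j" by (simp add: \<theta>'_def)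
  ultimately have "f - 2 *\<^sub>R S \<in> V" using V(2) f unfolding ortho_symmetric_def by blast
  then have "(1 / 2) *\<^sub>R f + (1 / 2) *\<^sub>R (f - 2 *\<^sub>R S) \<in> V"
    using V(1) f(1) by (intro convexD) auto
  moreover have "(1 / 2) *\<^sub>R f + (1 / 2) *\<^sub>R (f - 2 *\<^sub>R S) = resid cosb l f"
    by (simp add: resid_def S_def c scaleR_right_diff_distrib scaleR_add_left[symmetric])
  ultimately show ?thesis by simp
qed

section \<open>Characteristic functions of small bounded summands\<close>

lemma iexp_moment_bound:
  assumes M: "prob_space M" and X[measurable]: "X \<in> borel_measurable M" and B: "\<And>x. x \<in> space M \<Longrightarrow> \<bar>X x\<bar> \<le> B"
    and E: "(\<integral>x. X x \<partial>M) = 0"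
  shows "cmod ((\<integral>x. iexp (t * X x) \<partial>M) - complex_of_real (1 - t\<^sup>2 * (\<integral>x. (X x)\<^sup>2 \<partial>M) / 2)) \<le> \<bar>t\<bar> ^ 3 * B ^ 3 / 6"
proof -
  interpret prob_space M by fact
  obtain x0 where x0: "x0 \<in> space M" using not_empty by auto
  then have B0: "0 \<le> B" using B[OF x0] by linarith
  have i1: "integrable M X" using B by (intro integrable_const_bound[where B = B]) auto
  have i2: "integrable M (\<lambda>x. (X x)\<^sup>2)"
    using B by (intro integrable_const_bound[where B = "B\<^sup>2"]) (auto intro!: AE_I2 simp: abs_le_square_iff[symmetric] B0)
  have c1: "char (distr M borel X) t = (\<integral>x. iexp (t * X x) \<partial>M)"
    unfolding char_def by (subst integral_distr) auto
  have c2: "cmod (char (distr M borel X) t - complex_of_real (1 - t\<^sup>2 * (\<integral>x. (X x)\<^sup>2 \<partial>M) / 2))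
      \<le> (t\<^sup>2 / 6) * expectation (\<lambda>x. min (6 * (X x)\<^sup>2) (\<bar>t\<bar> * \<bar>X x\<bar> ^ 3))"
    using char_approx3'[OF X i1 i2 E _ refl, of "\<integral>x. (X x)\<^sup>2 \<partial>M" t] E by simp
  have "expectation (\<lambda>x. min (6 * (X x)\<^sup>2) (\<bar>t\<bar> * \<bar>X x\<bar> ^ 3)) \<le> expectation (\<lambda>x. \<bar>t\<bar> * B ^ 3)"
  proof (rule integral_mono)
    show "integrable M (\<lambda>x. min (6 * (X x)\<^sup>2) (\<bar>t\<bar> * \<bar>X x\<bar> ^ 3))"
    proof (rule Bochner_Integration.integrable_bound[OF integrable_mult_right[OF i2, of 6]])
      show "AE x in M. norm (min (6 * (X x)\<^sup>2) (\<bar>t\<bar> * \<bar>X x\<bar> ^ 3)) \<le> norm (6 * (X x)\<^sup>2)" by auto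
    qed measurable
    show "min (6 * (X x)\<^sup>2) (\<bar>t\<bar> * \<bar>X x\<bar> ^ 3) \<le> \<bar>t\<bar> * B ^ 3" if "x \<in> space M" for x
      using B[OF that] by (intro min.coboundedI2 mult_left_mono power_mono) auto
  qed simp
  then have c3: "(t\<^sup>2 / 6) * expectation (\<lambda>x. min (6 * (X x)\<^sup>2) (\<bar>t\<bar> * \<bar>X x\<bar> ^ 3)) \<le> (t\<^sup>2 / 6) * (\<bar>t\<bar> * B ^ 3)"
    using prob_space by (intro mult_left_mono) auto
  have "cmod ((\<integral>x. iexp (t * X x) \<partial>M) - complex_of_real (1 - t\<^sup>2 * (\<integral>x. (X x)\<^sup>2 \<partial>M) / 2)) \<le> (t\<^sup>2 / 6) * (\<bar>t\<bar> * B ^ 3)"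
    using order_trans[OF c2 c3] unfolding c1 .
  also have "\<dots> = \<bar>t\<bar> ^ 3 * B ^ 3 / 6"
  proof -
    have "\<bar>t\<bar> ^ 3 = t\<^sup>2 * \<bar>t\<bar>" by (simp add: power3_eq_cube power2_eq_square)
    then show ?thesis by simp
  qed
  finally show ?thesis .
qed

lemma exp_minus_second_order:
  fixes x :: real
  assumes "x \<ge> 0"
  shows "\<bar>exp (- x) - (1 - x)\<bar> \<le> x\<^sup>2"
proof -
  have "1 - x \<le> exp (- x)" using exp_ge_add_one_self[of "- x"] by simp
  moreover have "exp (- x) \<le> 1 - x + x\<^sup>2"
  proof -
    have "exp (- x) \<le> 1 / (1 + x)"
      using exp_ge_add_one_self[of x] assms by (simp add: exp_minus divide_inverse le_imp_inverse_le)
    also have "\<dots> \<le> 1 - x + x\<^sup>2"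
    proof -
      have "(1 - x + x\<^sup>2) * (1 + x) = 1 + x ^ 3" by (simp add: algebra_simps power2_eq_square power3_eq_cube)
      then have "1 \<le> (1 - x + x\<^sup>2) * (1 + x)" using assms by simp
      then show ?thesis using assms by (subst pos_divide_le_eq) auto
    qed
    finally show ?thesis .
  qed
  ultimately show ?thesis by simp
qed

text \<open>
  The central limit theorem for triangular arrays with a uniform bound, for characteristic
  functions at one argument. Both \<open>z\<close> and the Gaussian value \<open>w\<close> agree
  with \<open>1 - S / (2 N)\<close> to an order that survives multiplication by \<open>N\<close>,
  and powers of numbers in the unit disc amplify a difference by at most the exponent.
\<close>

lemma char_power_tendsto:
  fixes N :: "nat \<Rightarrow> nat"
  assumes M: "\<And>i. prob_space (M i)" and X: "\<And>i. X i \<in> borel_measurable (M i)"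
    and B: "\<And>i x. x \<in> space (M i) \<Longrightarrow> \<bar>X i x\<bar> \<le> B"
    and E: "\<And>i. (\<integral>x. X i x \<partial>M i) = 0"
    and v: "(\<lambda>i. \<integral>x. (X i x)\<^sup>2 \<partial>M i) \<longlonglongrightarrow> s"
    and N: "filterlim N at_top sequentially"
  shows "(\<lambda>i. (\<integral>x. iexp (X i x / sqrt (N i)) \<partial>M i) ^ N i) \<longlonglongrightarrow> complex_of_real (exp (- s / 2))"
proof -
  define S where "S i = (\<integral>x. (X i x)\<^sup>2 \<partial>M i)" for i
  define z where "z i = (\<integral>x. iexp (X i x / sqrt (N i)) \<partial>M i)" for i
  define w where "w i = complex_of_real (exp (- (S i / (2 * N i))))" for i
  have B0: "0 \<le> B"
  proof -
    interpret prob_space "M 0" by fact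
    obtain x where "x \<in> space (M 0)" using not_empty by auto
    from B[OF this] show ?thesis by linarith
  qed
  have S: "0 \<le> S i" "S i \<le> B\<^sup>2" for i
  proof -
    interpret prob_space "M i" by fact
    show "0 \<le> S i" by (simp add: S_def)
    have "(X i x)\<^sup>2 \<le> B\<^sup>2" if "x \<in> space (M i)" for x
      using B[OF that] B0 by (simp add: abs_le_square_iff[symmetric])
    then have "S i \<le> (\<integral>x. B\<^sup>2 \<partial>M i)"
      unfolding S_def by (intro integral_mono' ) auto
    then show "S i \<le> B\<^sup>2" by (simp add: prob_space)
  qed
  have diff: "cmod (z i ^ N i - w i ^ N i) \<le> B ^ 3 / (6 * sqrt (N i)) + B ^ 4 / (4 * N i)" if n: "N i > 0" for i
  proof -
    interpret prob_space "M i" by fact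
    note [measurable] = X[of i]
    define t where "t = 1 / sqrt (N i)"
    have t: "t > 0" "t\<^sup>2 = 1 / N i" "\<bar>t\<bar> ^ 3 = 1 / (N i * sqrt (N i))"
      using n by (auto simp: t_def power_divide power3_eq_cube)
    have zi: "z i = (\<integral>x. iexp (t * X i x) \<partial>M i)" by (simp add: z_def t_def)
    have "cmod (z i) \<le> (\<integral>x. 1 \<partial>M i)" unfolding z_def
      by (rule order_trans[OF integral_norm_bound]) simp
    then have z1: "cmod (z i) \<le> 1" by (simp add: prob_space)
    have w1: "cmod (w i) \<le> 1" using S(1)[of i] by (simp add: w_def)
    have "cmod (z i - complex_of_real (1 - t\<^sup>2 * S i / 2)) \<le> \<bar>t\<bar> ^ 3 * B ^ 3 / 6"
      unfolding zi S_def by (rule iexp_moment_bound[OF M X B E])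
    moreover have "cmod (w i - complex_of_real (1 - t\<^sup>2 * S i / 2)) \<le> (S i / (2 * N i))\<^sup>2"
    proof -
      have "w i - complex_of_real (1 - t\<^sup>2 * S i / 2) = complex_of_real (exp (- (S i / (2 * N i))) - (1 - S i / (2 * N i)))"
        by (simp add: w_def t(2))
      then have "cmod (w i - complex_of_real (1 - t\<^sup>2 * S i / 2)) = \<bar>exp (- (S i / (2 * N i))) - (1 - S i / (2 * N i))\<bar>"
        by (simp only: norm_of_real)
      also have "\<dots> \<le> (S i / (2 * N i))\<^sup>2" using S(1)[of i] by (intro exp_minus_second_order) auto
      finally show ?thesis .
    qed
    ultimately have zw: "cmod (z i - w i) \<le> \<bar>t\<bar> ^ 3 * B ^ 3 / 6 + (S i / (2 * N i))\<^sup>2"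
      using norm_triangle_ineq4[of "z i - complex_of_real (1 - t\<^sup>2 * S i / 2)" "w i - complex_of_real (1 - t\<^sup>2 * S i / 2)"] by simp
    have sq: "(S i / (2 * N i))\<^sup>2 \<le> (B\<^sup>2 / (2 * N i))\<^sup>2"
      using S by (intro power_mono divide_right_mono) auto
    have "cmod (z i ^ N i - w i ^ N i) \<le> N i * cmod (z i - w i)"
      by (rule norm_power_diff[OF z1 w1])
    also have "\<dots> \<le> N i * (\<bar>t\<bar> ^ 3 * B ^ 3 / 6 + (B\<^sup>2 / (2 * N i))\<^sup>2)"
      using zw sq by (intro mult_left_mono) auto
    also have "\<dots> = B ^ 3 / (6 * sqrt (N i)) + B ^ 4 / (4 * N i)"
      using n unfolding t(3) by (simp add: field_simps power2_eq_square power4_eq_xxxx)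
    finally show ?thesis .
  qed
  have "(\<lambda>n. B ^ 3 / (6 * sqrt (real n)) + B ^ 4 / (4 * real n)) \<longlonglongrightarrow> 0"
    by real_asymp
  from filterlim_compose[OF this N]
  have lim: "(\<lambda>i. B ^ 3 / (6 * sqrt (real (N i))) + B ^ 4 / (4 * real (N i))) \<longlonglongrightarrow> 0" .
  have pos: "eventually (\<lambda>i. N i > 0) sequentially"
    using N eventually_gt_at_top[of 0] unfolding filterlim_iff by blast
  have "(\<lambda>i. z i ^ N i - w i ^ N i) \<longlonglongrightarrow> 0"
    by (rule Lim_null_comparison[OF _ lim]) (use pos diff in \<open>auto elim!: eventually_mono\<close>)
  moreover have "(\<lambda>i. w i ^ N i) \<longlonglongrightarrow> complex_of_real (exp (- s / 2))"
  proof -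
    have "(\<lambda>i. complex_of_real (exp (- S i / 2))) \<longlonglongrightarrow> complex_of_real (exp (- s / 2))"
      using v unfolding S_def[symmetric] by (intro tendsto_intros) auto
    moreover have "eventually (\<lambda>i. complex_of_real (exp (- S i / 2)) = w i ^ N i) sequentially"
      using pos by eventually_elim (simp add: w_def exp_of_nat_mult[symmetric] flip: of_real_power)
    ultimately show ?thesis by (rule Lim_transform_eventually)
  qed
  ultimately have "(\<lambda>i. (z i ^ N i - w i ^ N i) + w i ^ N i) \<longlonglongrightarrow> 0 + complex_of_real (exp (- s / 2))"
    by (rule tendsto_add)
  then show ?thesis by (simp add: z_def)
qed

section \<open>Sums of independent centred vectors\<close>

lemma norm_sum_sq:
  fixes b :: "nat \<Rightarrow> 'a::real_inner"
  shows "(norm (\<Sum>i<n. b i))\<^sup>2 = (\<Sum>i<n. \<Sum>k<n. inner (b i) (b k))"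
  unfolding power2_norm_eq_inner inner_sum_left inner_sum_right by (rule sum.swap)

text \<open>
  Orthogonality of independent centred vectors, by induction on the number of observations:
  integrating out the last observation kills its inner product with the sum of the others.
\<close>

lemma norm_iid_sum:
  fixes \<zeta> :: "'a \<Rightarrow> 'b::real_inner" and n :: nat
  assumes P: "prob_space P"
    and K[measurable]: "(\<lambda>p. inner (\<zeta> (fst p)) (\<zeta> (snd p))) \<in> borel_measurable (P \<Otimes>\<^sub>M P)"
    and B: "\<And>y. y \<in> space P \<Longrightarrow> norm (\<zeta> y) \<le> B"
    and W: "\<And>w. integrable P (\<lambda>y. inner (\<zeta> y) w)" "\<And>w. (\<integral>y. inner (\<zeta> y) w \<partial>P) = 0"
  shows "integrable (PiM {..<n} (\<lambda>_. P)) (\<lambda>X. (norm (\<Sum>i<n. \<zeta> (X i)))\<^sup>2) \<and>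
    (\<integral>X. (norm (\<Sum>i<n. \<zeta> (X i)))\<^sup>2 \<partial>PiM {..<n} (\<lambda>_. P)) = n * (\<integral>y. (norm (\<zeta> y))\<^sup>2 \<partial>P)"
proof (induction n)
  case 0
  show ?case by simp
next
  case (Suc n)
  interpret P: prob_space P by fact
  interpret PP: product_prob_space "\<lambda>_::nat. P" UNIV ..
  interpret Q: prob_space "PiM {..<Suc n} (\<lambda>_. P)" by (intro prob_space_PiM assms(1))
  interpret Q': prob_space "PiM {..<n} (\<lambda>_. P)" by (intro prob_space_PiM assms(1))
  have B0: "0 \<le> B"
  proof -
    obtain x where "x \<in> space P" using P.not_empty by auto
    from order_trans[OF norm_ge_zero B[OF this]] show ?thesis .
  qed
  have diag: "(\<lambda>y. (norm (\<zeta> y))\<^sup>2) \<in> borel_measurable P"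
    using measurable_compose[OF _ K, of "\<lambda>y. (y, y)" P] by (simp add: power2_norm_eq_inner)
  have idiag: "integrable P (\<lambda>y. (norm (\<zeta> y))\<^sup>2)"
    using B B0 diag by (intro P.integrable_const_bound[where B = "B\<^sup>2"]) (auto intro!: AE_I2 power_mono)
  have meas: "(\<lambda>X. (norm (\<Sum>i<Suc n. \<zeta> (X i)))\<^sup>2) \<in> borel_measurable (PiM {..<Suc n} (\<lambda>_. P))"
  proof -
    have "(\<lambda>X. inner (\<zeta> (X i)) (\<zeta> (X k))) \<in> borel_measurable (PiM {..<Suc n} (\<lambda>_. P))" if "i < Suc n" "k < Suc n" for i k
    proof -
      have "(\<lambda>X. (X i, X k)) \<in> PiM {..<Suc n} (\<lambda>_. P) \<rightarrow>\<^sub>M P \<Otimes>\<^sub>M P"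
        using that by (intro measurable_Pair measurable_component_singleton) auto
      from measurable_compose[OF this K] show ?thesis by simp
    qed
    then have "(\<lambda>X. \<Sum>i<Suc n. \<Sum>k<Suc n. inner (\<zeta> (X i)) (\<zeta> (X k))) \<in> borel_measurable (PiM {..<Suc n} (\<lambda>_. P))"
      by (intro borel_measurable_sum) auto
    then show ?thesis unfolding norm_sum_sq .
  qed
  have bound: "norm (\<Sum>i<Suc n. \<zeta> (X i)) \<le> Suc n * B" if "X \<in> space (PiM {..<Suc n} (\<lambda>_. P))" for X
  proof -
    have "norm (\<Sum>i<Suc n. \<zeta> (X i)) \<le> (\<Sum>i<Suc n. B)"
      using that by (intro sum_norm_le B) (auto simp: space_PiM)
    then show ?thesis by simp
  qed
  have int: "integrable (PiM {..<Suc n} (\<lambda>_. P)) (\<lambda>X. (norm (\<Sum>i<Suc n. \<zeta> (X i)))\<^sup>2)"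
    using bound by (intro Q.integrable_const_bound[OF _ meas, where B = "(Suc n * B)\<^sup>2"]) (auto intro!: AE_I2 power_mono simp del: sum.lessThan_Suc)
  have ins: "{..<Suc n} = insert n {..<n}" by auto
  have "(\<integral>X. (norm (\<Sum>i<Suc n. \<zeta> (X i)))\<^sup>2 \<partial>PiM {..<Suc n} (\<lambda>_. P))
      = (\<integral>X. \<integral>y. (norm (\<Sum>i<Suc n. \<zeta> ((X(n := y)) i)))\<^sup>2 \<partial>P \<partial>PiM {..<n} (\<lambda>_. P))"
    using PP.product_integral_insert[of "{..<n}" n "\<lambda>X. (norm (\<Sum>i<Suc n. \<zeta> (X i)))\<^sup>2"] int by (simp only: ins) simp
  also have "\<dots> = (\<integral>X. (norm (\<Sum>i<n. \<zeta> (X i)))\<^sup>2 + (\<integral>y. (norm (\<zeta> y))\<^sup>2 \<partial>P) \<partial>PiM {..<n} (\<lambda>_. P))"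
  proof (rule Bochner_Integration.integral_cong[OF refl])
    fix X
    define S where "S = (\<Sum>i<n. \<zeta> (X i))"
    have "(\<Sum>i<Suc n. \<zeta> ((X(n := y)) i)) = S + \<zeta> y" for y
      by (simp add: S_def)
    then have "(norm (\<Sum>i<Suc n. \<zeta> ((X(n := y)) i)))\<^sup>2 = (norm S)\<^sup>2 + 2 * inner (\<zeta> y) S + (norm (\<zeta> y))\<^sup>2" for y
      by (simp add: power2_norm_eq_inner inner_add_left inner_add_right inner_commute)
    then show "(\<integral>y. (norm (\<Sum>i<Suc n. \<zeta> ((X(n := y)) i)))\<^sup>2 \<partial>P) = (norm S)\<^sup>2 + (\<integral>y. (norm (\<zeta> y))\<^sup>2 \<partial>P)"
      using W idiag by (simp add: P.prob_space)
  qed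
  also have "\<dots> = Suc n * (\<integral>y. (norm (\<zeta> y))\<^sup>2 \<partial>P)"
    using Suc.IH Q'.prob_space by (simp add: algebra_simps)
  finally show ?case using int by blast
qed

section \<open>The law of an observation\<close>

lemma alternativeD:
  assumes "is_alternative f"
  shows "AE x in unit_leb. 0 \<le> 1 + rep_l2 f x" "(\<integral>x. 1 + rep_l2 f x \<partial>unit_leb) = 1"
  using assms by (auto simp: is_alternative.rep_eq)

lemma rep_l2_measurable[measurable]: "rep_l2 f \<in> borel_measurable unit_leb"
  using sq_integrable_rep[of f] by (simp add: sq_integrable_def)

lemma sets_law[measurable_cong]: "sets (law f) = sets unit_leb"
  by (simp add: law.rep_eq)

lemma space_law[simp]: "space (law f) = {0<..<1}"
  by (simp add: law.rep_eq)

lemma prob_space_law: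
  assumes "is_alternative f"
  shows "prob_space (law f)"
proof (rule prob_spaceI)
  have i: "integrable unit_leb (\<lambda>x. 1 + rep_l2 f x)"
    using sq_integrable_integrable[OF sq_integrable_rep, of f] by simp
  have "emeasure (law f) (space (law f)) = (\<integral>\<^sup>+x. ennreal (1 + rep_l2 f x) * indicator (space unit_leb) x \<partial>unit_leb)"
    unfolding law.rep_eq space_density by (rule emeasure_density) (auto simp del: space_unit_leb)
  also have "\<dots> = (\<integral>\<^sup>+x. ennreal (1 + rep_l2 f x) \<partial>unit_leb)"
    by (rule nn_integral_cong) simp
  also have "\<dots> = ennreal 1"
    using nn_integral_eq_integral[OF i alternativeD(1)[OF assms]] alternativeD(2)[OF assms] by simp
  finally show "emeasure (law f) (space (law f)) = 1" by simp
qed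

lemma integral_law:
  fixes \<psi> :: "real \<Rightarrow> real"
  assumes f: "is_alternative f" and m[measurable]: "\<psi> \<in> borel_measurable unit_leb"
  shows "(\<integral>y. \<psi> y \<partial>law f) = (\<integral>y. (1 + rep_l2 f y) * \<psi> y \<partial>unit_leb)"
  unfolding law.rep_eq using alternativeD(1)[OF f] by (subst integral_density) auto

text \<open>
  The law of an observation differs from the uniform law by the density \<open>f\<close>, so
  moments of bounded functions converge to the uniform ones as \<open>f\<close> tends to 0.
\<close>

lemma integral_law_bounded:
  fixes \<psi> :: "real \<Rightarrow> real"
  assumes f: "is_alternative f" and m[measurable]: "\<psi> \<in> borel_measurable unit_leb"
    and B: "\<And>y. 0 < y \<Longrightarrow> y < 1 \<Longrightarrow> \<bar>\<psi> y\<bar> \<le> B"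
  shows "(\<integral>y. \<psi> y \<partial>law f) = (\<integral>y. \<psi> y \<partial>unit_leb) + inner f (abs_l2 \<psi>)"
    and "\<bar>(\<integral>y. \<psi> y \<partial>law f) - (\<integral>y. \<psi> y \<partial>unit_leb)\<bar> \<le> norm f * B"
proof -
  have sq: "sq_integrable \<psi>" by (rule sq_integrable_unit_bounded[OF m B])
  have "(\<integral>y. (1 + rep_l2 f y) * \<psi> y \<partial>unit_leb) = (\<integral>y. \<psi> y \<partial>unit_leb) + (\<integral>y. rep_l2 f y * \<psi> y \<partial>unit_leb)"
    using sq_integrable_integrable[OF sq] sq_integrable_mult[OF sq_integrable_rep sq] by (simp add: distrib_right)
  also have "(\<integral>y. rep_l2 f y * \<psi> y \<partial>unit_leb) = inner f (abs_l2 \<psi>)"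
    using inner_abs_l2[OF sq_integrable_rep sq, of f] by simp
  finally show eq: "(\<integral>y. \<psi> y \<partial>law f) = (\<integral>y. \<psi> y \<partial>unit_leb) + inner f (abs_l2 \<psi>)"
    unfolding integral_law[OF f m] .
  have B0: "0 \<le> B" using B[of "1 / 2"] by simp
  have "(norm (abs_l2 \<psi>))\<^sup>2 = (\<integral>y. \<psi> y * \<psi> y \<partial>unit_leb)"
    unfolding power2_norm_eq_inner by (rule inner_abs_l2[OF sq sq])
  also have "\<dots> \<le> (\<integral>y. B\<^sup>2 \<partial>unit_leb)"
  proof (rule integral_mono[OF sq_integrable_mult[OF sq sq]])
    fix y assume "y \<in> space unit_leb"
    then have "\<bar>\<psi> y\<bar>\<^sup>2 \<le> B\<^sup>2" using B by (intro power_mono) auto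
    then show "\<psi> y * \<psi> y \<le> B\<^sup>2" by (simp add: power2_eq_square)
  qed simp
  also have "\<dots> = B\<^sup>2" using U.prob_space by simp
  finally have "norm (abs_l2 \<psi>) \<le> B" by (rule power2_le_imp_le) (rule B0)
  then have "norm f * norm (abs_l2 \<psi>) \<le> norm f * B" by (intro mult_left_mono) auto
  then show "\<bar>(\<integral>y. \<psi> y \<partial>law f) - (\<integral>y. \<psi> y \<partial>unit_leb)\<bar> \<le> norm f * B"
    using Cauchy_Schwarz_ineq2[of f "abs_l2 \<psi>"] eq by linarith
qed

lemma integral_law_inner_jump:
  assumes f: "is_alternative f"
  shows "(\<integral>y. inner (jump y) w \<partial>law f) = inner (volterra f) w"
  by (subst integral_law[OF f measurable_inner_jump]) (rule integral_inner_jump_volterra[OF alternativeD(2)[OF f]])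

definition cosf :: "nat \<Rightarrow> real \<Rightarrow> real" where
  "cosf j y = sqrt 2 * cos (pi * real (Suc j) * y)"

lemma cosf_measurable_borel[measurable]: "cosf j \<in> borel_measurable borel"
  unfolding cosf_def[abs_def] by measurable

lemma cosf_measurable: "cosf j \<in> borel_measurable unit_leb"
  by (rule measurable_unit_leb) measurable

lemma cosf_bound: "\<bar>cosf j y\<bar> \<le> 2"
proof -
  have "sqrt 2 \<le> 2" by (rule real_le_lsqrt) auto
  then have "sqrt 2 * \<bar>cos (pi * real (Suc j) * y)\<bar> \<le> 2 * 1" by (intro mult_mono) auto
  then show ?thesis by (simp add: cosf_def abs_mult)
qed

lemma cosb_eq: "cosb j = abs_l2 (cosf j)"
  unfolding cosf_def[abs_def] cos_basis.abs_eq ..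

lemma sq_integrable_cosf: "sq_integrable (cosf j)"
  unfolding cosf_def[abs_def] by (rule sq_integrable_cos)

lemma integral_cosf_products: "(\<integral>y. cosf j y * cosf k y \<partial>unit_leb) = (if j = k then 1 else 0)"
  using orthonormal_cosb inner_abs_l2[OF sq_integrable_cosf sq_integrable_cosf, of j k]
  by (simp only: orthonormal_def cosb_eq)

lemma inner_jump_sinb': "0 < y \<Longrightarrow> y < 1 \<Longrightarrow> inner (jump y) (sinb j) = kl_sd j * cosf j y"
  by (simp only: inner_jump_sinb kl_sd_def cosf_def) simp

lemma integral_cosf: "(\<integral>y. cosf j y \<partial>unit_leb) = 0"
proof -
  define k where "k = pi * real (Suc j)"
  have k: "k > 0" "sin k = 0" unfolding k_def by (simp, rule sin_pi_nat)
  have "(\<integral>y. sqrt 2 * cos (k * y) \<partial>unit_leb) = sqrt 2 * sin (k * 1) / k - sqrt 2 * sin (k * 0) / k"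
    using k by (intro integral_unit_leb_FTC0[where F = "\<lambda>y. sqrt 2 * sin (k * y) / k"])
      (auto intro!: derivative_eq_intros)
  then show ?thesis using k by (simp add: cosf_def[abs_def] k_def)
qed

lemma integral_law_cosf:
  assumes f: "is_alternative f"
  shows "(\<integral>y. cosf j y \<partial>law f) = inner f (cosb j)"
  using integral_law_bounded(1)[OF f cosf_measurable cosf_bound] integral_cosf by (simp add: cosb_eq)

text \<open>
  The coordinate of the drift inherits the factor \<open>1 / (\<pi> j)\<close> of the coordinates
  of a single observation.
\<close>

lemma inner_volterra_sinb:
  assumes f: "is_alternative f"
  shows "inner (volterra f) (sinb j) = kl_sd j * inner f (cosb j)"
proof -
  have "inner (volterra f) (sinb j) = (\<integral>y. inner (jump y) (sinb j) \<partial>law f)"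
    by (rule integral_law_inner_jump[OF f, symmetric])
  also have "\<dots> = (\<integral>y. kl_sd j * cosf j y \<partial>law f)"
    by (rule Bochner_Integration.integral_cong) (auto simp: inner_jump_sinb')
  finally show ?thesis by (simp add: integral_law_cosf[OF f])
qed


section \<open>The statistic as a squared norm\<close>

abbreviation drift :: "nat \<Rightarrow> l2 \<Rightarrow> l2" where
  "drift n f \<equiv> sqrt n *\<^sub>R volterra f"

definition emp_process :: "nat \<Rightarrow> (nat \<Rightarrow> real) \<Rightarrow> l2" where
  "emp_process n X = (1 / sqrt n) *\<^sub>R (\<Sum>i<n. jump (X i))"

text \<open>
  The empirical deviation at \<open>x\<close> is the average of \<open>1{X\<^sub>i \<le> x} -
  x\<close>. For \<open>n = 0\<close> both sides vanish.
\<close>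

lemma cvm_stat_eq_norm: "n * cvm_stat n X = (norm (emp_process n X))\<^sup>2"
proof (cases "n = 0")
  case True
  then show ?thesis by (simp add: emp_process_def)
next
  case False
  define b where "b i x = indicator {X i..} x - x" for i and x :: real
  have b: "sq_integrable (b i)" for i unfolding b_def by (rule sq_integrable_jump)
  have sq: "sq_integrable (\<lambda>x. \<Sum>i<n. b i x)" and sum: "abs_l2 (\<lambda>x. \<Sum>i<n. b i x) = (\<Sum>i<n. jump (X i))"
    using abs_l2_sum[of "{..<n}" b] b by (auto simp: jump_def b_def[abs_def])
  have e: "empirical_cdf n X x - x = (\<Sum>i<n. b i x) / n" for x
  proof -
    have "real (card {i\<in>{..<n}. X i \<le> x}) = (\<Sum>i<n. indicator {X i..} x)"
    proof -
      have "real (card {i\<in>{..<n}. X i \<le> x}) = (\<Sum>i\<in>{i\<in>{..<n}. X i \<le> x}. 1)" by simp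
      also have "\<dots> = (\<Sum>i<n. if X i \<le> x then 1 else 0)" by (rule sum.inter_filter) simp
      also have "\<dots> = (\<Sum>i<n. indicator {X i..} x)" by (rule sum.cong) (auto simp: indicator_def)
      finally show ?thesis .
    qed
    then show ?thesis using False
      by (simp add: empirical_cdf_def b_def sum_subtractf diff_divide_distrib)
  qed
  have "n * cvm_stat n X = n * (\<integral>x. ((\<Sum>i<n. b i x) * (\<Sum>i<n. b i x)) / (n * n) \<partial>unit_leb)"
    unfolding cvm_stat_def e by (simp add: power2_eq_square)
  also have "\<dots> = (\<integral>x. (\<Sum>i<n. b i x) * (\<Sum>i<n. b i x) \<partial>unit_leb) / n"
    using False by simp
  also have "\<dots> = (norm (\<Sum>i<n. jump (X i)))\<^sup>2 / n"
    unfolding sum[symmetric] power2_norm_eq_inner by (simp add: inner_abs_l2[OF sq sq])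
  also have "\<dots> = (norm (emp_process n X))\<^sup>2"
    by (simp add: emp_process_def power_mult_distrib power_divide)
  finally show ?thesis .
qed

lemma prob_space_sample_law: "is_alternative f \<Longrightarrow> prob_space (sample_law n f)"
  unfolding sample_law_def by (intro prob_space_PiM prob_space_law)

lemma space_sample_law: "X \<in> space (sample_law n f) \<Longrightarrow> i < n \<Longrightarrow> 0 < X i \<and> X i < 1"
  using PiE_mem[of X "{..<n}" "\<lambda>_. {0<..<1}" i] by (simp add: sample_law_def space_PiM)

lemma jump_kernel_measurable:
  "(\<lambda>p. inner (jump (fst p)) (jump (snd p))) \<in> borel_measurable (unit_leb \<Otimes>\<^sub>M unit_leb)"
proof -
  have [measurable]: "(\<lambda>p. fst p) \<in> unit_leb \<Otimes>\<^sub>M unit_leb \<rightarrow>\<^sub>M borel" "(\<lambda>p. snd p) \<in> unit_leb \<Otimes>\<^sub>M unit_leb \<rightarrow>\<^sub>M borel"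
    using measurable_compose[OF measurable_fst id_measurable_unit_leb]
      measurable_compose[OF measurable_snd id_measurable_unit_leb] by auto
  have "(\<lambda>p. 1 / 3 + ((fst p)\<^sup>2 + (snd p)\<^sup>2) / 2 - max (fst p) (snd p)) \<in> borel_measurable (unit_leb \<Otimes>\<^sub>M unit_leb)"
    by measurable
  then show ?thesis
    by (rule measurable_cong[THEN iffD1, rotated]) (auto simp: space_pair_measure inner_jump_jump)
qed

lemma sample_component_measurable: "i < n \<Longrightarrow> (\<lambda>X. X i) \<in> sample_law n f \<rightarrow>\<^sub>M unit_leb"
  unfolding sample_law_def
  using measurable_component_singleton[of i "{..<n}" "\<lambda>_. law f"] measurable_cong_sets[OF refl sets_law] by blast

lemma emp_norm_measurable: "(\<lambda>X. (norm (emp_process n X))\<^sup>2) \<in> borel_measurable (sample_law n f)"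
proof -
  have "(\<lambda>X. inner (jump (X i)) (jump (X k))) \<in> borel_measurable (sample_law n f)" if "i < n" "k < n" for i k
  proof -
    have "(\<lambda>X. (X i, X k)) \<in> sample_law n f \<rightarrow>\<^sub>M unit_leb \<Otimes>\<^sub>M unit_leb"
      using that by (intro measurable_Pair sample_component_measurable)
    from measurable_compose[OF this jump_kernel_measurable] show ?thesis by simp
  qed
  then have "(\<lambda>X. \<Sum>i<n. \<Sum>k<n. inner (jump (X i)) (jump (X k))) \<in> borel_measurable (sample_law n f)"
    by (intro borel_measurable_sum) auto
  moreover have "(norm (emp_process n X))\<^sup>2 = (1 / sqrt n)\<^sup>2 * (\<Sum>i<n. \<Sum>k<n. inner (jump (X i)) (jump (X k)))" for X
    unfolding emp_process_def norm_scaleR power_mult_distrib norm_sum_sq by simp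
  ultimately show ?thesis by simp
qed

lemma inner_emp_measurable: "(\<lambda>X. inner (emp_process n X) w) \<in> borel_measurable (sample_law n f)"
proof -
  have "(\<lambda>X. inner (jump (X i)) w) \<in> borel_measurable (sample_law n f)" if "i < n" for i
    using measurable_compose[OF sample_component_measurable[OF that] measurable_inner_jump] .
  then have "(\<lambda>X. (1 / sqrt n) * (\<Sum>i<n. inner (jump (X i)) w)) \<in> borel_measurable (sample_law n f)"
    by (intro borel_measurable_times borel_measurable_sum) auto
  then show ?thesis by (simp add: emp_process_def inner_sum_left)
qed

section \<open>High frequencies\<close>

lemma integrable_law_bounded:
  fixes \<psi> :: "real \<Rightarrow> real"
  assumes f: "is_alternative f" and m: "\<psi> \<in> borel_measurable unit_leb"
    and B: "\<And>y. 0 < y \<Longrightarrow> y < 1 \<Longrightarrow> \<bar>\<psi> y\<bar> \<le> B"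
  shows "integrable (law f) \<psi>"
proof -
  interpret prob_space "law f" by (rule prob_space_law[OF f])
  show ?thesis using m B
    by (intro integrable_const_bound[where B = B]) (auto intro!: AE_I2 simp: measurable_cong_sets[OF sets_law refl])
qed

lemma resid_jump_sq_measurable: "(\<lambda>y. (norm (resid sinb m (jump y)))\<^sup>2) \<in> borel_measurable unit_leb"
proof -
  have "(\<lambda>y. (1 / 3 + y\<^sup>2 - y) - (\<Sum>j<m. (inner (jump y) (sinb j))\<^sup>2)) \<in> borel_measurable unit_leb"
    using measurable_inner_jump by (intro borel_measurable_diff borel_measurable_add borel_measurable_sum borel_measurable_power) auto
  then show ?thesis
  proof (rule measurable_cong[THEN iffD1, rotated])
    fix y assume "y \<in> space unit_leb"
    then show "(1 / 3 + y\<^sup>2 - y) - (\<Sum>j<m. (inner (jump y) (sinb j))\<^sup>2) = (norm (resid sinb m (jump y)))\<^sup>2"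
      using norm_resid[OF orthonormal_sinb, of "jump y" m] norm_jump_sq[of y] by auto
  qed
qed

lemma resid_jump_le:
  assumes "0 < y" "y < 1"
  shows "norm (resid sinb m (jump y)) \<le> 1"
  using norm_resid_le[OF orthonormal_sinb] norm_jump_le[OF assms] by (rule order_trans)

text \<open>
  The mean squared norm of the contribution of one observation is 1/6, the integral of \<open>x (1
  - x)\<close>, and each coordinate removes its variance \<open>1 / (\<pi> j)\<^sup>2\<close>.
\<close>

lemma integral_resid_jump:
  "(\<integral>y. (norm (resid sinb m (jump y)))\<^sup>2 \<partial>unit_leb) = 1 / 6 - (\<Sum>j<m. (kl_sd j)\<^sup>2)"
proof -
  have ip: "integrable unit_leb (\<lambda>y. 1 / 3 + y\<^sup>2 - y)"
  proof (rule U.integrable_const_bound[where B = 2])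
    have "norm (1 / 3 + y\<^sup>2 - y) \<le> 2" if "y \<in> space unit_leb" for y
    proof -
      have "0 < y" "y < 1" "0 \<le> y\<^sup>2" "y\<^sup>2 \<le> 1" using that by (auto simp: power_le_one)
      then show ?thesis unfolding real_norm_def by linarith
    qed
    then show "AE y in unit_leb. norm (1 / 3 + y\<^sup>2 - y) \<le> 2" by (rule AE_I2)
  qed measurable
  have ic: "integrable unit_leb (\<lambda>y. (kl_sd j)\<^sup>2 * (cosf j y * cosf j y))" for j
    using sq_integrable_mult[OF sq_integrable_cosf sq_integrable_cosf] by simp
  have "(\<integral>y. (norm (resid sinb m (jump y)))\<^sup>2 \<partial>unit_leb)
      = (\<integral>y. (1 / 3 + y\<^sup>2 - y) - (\<Sum>j<m. (kl_sd j)\<^sup>2 * (cosf j y * cosf j y)) \<partial>unit_leb)"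
  proof (rule Bochner_Integration.integral_cong[OF refl])
    fix y assume "y \<in> space unit_leb"
    then have y: "0 < y" "y < 1" by auto
    have "(\<Sum>j<m. (inner (jump y) (sinb j))\<^sup>2) = (\<Sum>j<m. (kl_sd j)\<^sup>2 * (cosf j y * cosf j y))"
      using y by (intro sum.cong) (auto simp: inner_jump_sinb' power2_eq_square)
    then show "(norm (resid sinb m (jump y)))\<^sup>2 = (1 / 3 + y\<^sup>2 - y) - (\<Sum>j<m. (kl_sd j)\<^sup>2 * (cosf j y * cosf j y))"
      using norm_resid[OF orthonormal_sinb, of "jump y" m] norm_jump_sq[OF y] by simp
  qed
  also have "\<dots> = (\<integral>y. 1 / 3 + y\<^sup>2 - y \<partial>unit_leb) - (\<Sum>j<m. (kl_sd j)\<^sup>2)"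
    using ip ic by (subst Bochner_Integration.integral_diff) (auto simp: integral_cosf_products)
  also have "(\<integral>y. 1 / 3 + y\<^sup>2 - y \<partial>unit_leb) = (1 / 3 * 1 + 1 ^ 3 / 3 - 1\<^sup>2 / 2) - (1 / 3 * 0 + 0 ^ 3 / 3 - 0\<^sup>2 / (2::real))"
    by (rule integral_unit_leb_FTC0[where F = "\<lambda>y. 1 / 3 * y + y ^ 3 / 3 - y\<^sup>2 / 2"])
      (auto intro!: derivative_eq_intros continuous_intros)
  finally show ?thesis by simp
qed

text \<open>
  The Basel sum. It says that the sine coordinates carry the whole variance 1/6 of the bridge, so
  the residual after \<open>m\<close> coordinates is uniformly negligible.
\<close>

lemma kl_sd_sq_sums: "(\<lambda>j. (kl_sd j)\<^sup>2) sums (1 / 6)"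
proof -
  have "(\<lambda>j. (1 / pi\<^sup>2) * (1 / (real j + 1)\<^sup>2)) sums ((1 / pi\<^sup>2) * (pi\<^sup>2 / 6))"
    by (rule sums_mult) (use inverse_squares_sums in \<open>simp add: add.commute\<close>)
  then show ?thesis by (simp add: kl_sd_def power_divide power_mult_distrib add.commute)
qed

text \<open>
  The centred high frequency part is a normalised sum of independent centred vectors, so its
  second moment is that of a single summand. Centring decreases the second moment, and the
  alternative changes it by at most the norm of \<open>f\<close>.
\<close>

lemma high_freq_second_moment:
  fixes m n :: nat
  assumes f: "is_alternative f" and n: "n > 0"
  defines "D \<equiv> \<lambda>X. resid sinb m (emp_process n X - drift n f)"
  shows "integrable (sample_law n f) (\<lambda>X. (norm (D X))\<^sup>2)"
    and "(\<integral>X. (norm (D X))\<^sup>2 \<partial>sample_law n f) \<le> (1 / 6 - (\<Sum>j<m. (kl_sd j)\<^sup>2)) + norm f"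
proof -
  interpret P: prob_space "law f" by (rule prob_space_law[OF f])
  define J where "J = volterra f"
  define \<zeta> where "\<zeta> y = resid sinb m (jump y - J)" for y
  have D: "D X = (1 / sqrt n) *\<^sub>R (\<Sum>i<n. \<zeta> (X i))" for X
  proof -
    have "(1 / sqrt n) *\<^sub>R (\<Sum>i<n. \<zeta> (X i)) = resid sinb m ((1 / sqrt n) *\<^sub>R (\<Sum>i<n. jump (X i) - J))"
      by (simp add: \<zeta>_def resid_scaleR resid_sum)
    also have "(\<Sum>i<n. jump (X i) - J) = (\<Sum>i<n. jump (X i)) - real n *\<^sub>R J"
      by (simp add: sum_subtractf sum_constant_scaleR)
    also have "(1 / sqrt n) *\<^sub>R ((\<Sum>i<n. jump (X i)) - real n *\<^sub>R J) = emp_process n X - sqrt n *\<^sub>R J"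
      using n by (simp add: emp_process_def scaleR_right_diff_distrib real_div_sqrt)
    finally show ?thesis by (simp add: D_def J_def)
  qed
  have zw: "inner (\<zeta> y) w = inner (jump y) (resid sinb m w) - inner J (resid sinb m w)" for y w
    by (simp add: \<zeta>_def inner_resid_swap inner_diff_left)
  have mlaw: "g \<in> borel_measurable unit_leb \<Longrightarrow> g \<in> borel_measurable (law f)" for g :: "real \<Rightarrow> real"
    using measurable_cong_sets[OF sets_law refl] by blast
  have bw: "\<bar>inner (jump y) w\<bar> \<le> norm w" if "0 < y" "y < 1" for y w
  proof -
    have "\<bar>inner (jump y) w\<bar> \<le> norm (jump y) * norm w" by (rule Cauchy_Schwarz_ineq2)
    also have "\<dots> \<le> 1 * norm w" using norm_jump_le[OF that] by (intro mult_right_mono) auto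
    finally show ?thesis by simp
  qed
  have ib: "integrable (law f) (\<lambda>y. inner (jump y) w)" for w
    by (rule integrable_law_bounded[OF f measurable_inner_jump bw])
  have zi: "integrable (law f) (\<lambda>y. inner (\<zeta> y) w)" for w
    unfolding zw using ib by simp
  have z0: "(\<integral>y. inner (\<zeta> y) w \<partial>law f) = 0" for w
    unfolding zw using ib integral_law_inner_jump[OF f] P.prob_space by (simp add: J_def)
  have zz: "inner (\<zeta> y) (\<zeta> z) = inner (jump y) (jump z) - (\<Sum>j<m. inner (jump y) (sinb j) * inner (jump z) (sinb j))
     - inner (jump y) (resid sinb m J) - inner (jump z) (resid sinb m J) + inner J (resid sinb m J)" for y z
  proof -
    have 1: "inner (\<zeta> y) (\<zeta> z) = inner (jump y - J) (resid sinb m (jump z) - resid sinb m J)"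
      unfolding \<zeta>_def inner_resid_swap resid_idem[OF orthonormal_sinb] by (simp only: resid_diff)
    have 2: "inner J (resid sinb m (jump z)) = inner (jump z) (resid sinb m J)"
      by (metis inner_commute inner_resid_swap)
    have 3: "inner (jump y) (resid sinb m (jump z)) = inner (jump y) (jump z) - (\<Sum>j<m. inner (jump y) (sinb j) * inner (jump z) (sinb j))"
      by (simp add: resid_def inner_diff_right inner_sum_right mult.commute)
    show ?thesis unfolding 1 inner_diff_left inner_diff_right 2 3 by simp
  qed
  have K: "(\<lambda>p. inner (\<zeta> (fst p)) (\<zeta> (snd p))) \<in> borel_measurable (law f \<Otimes>\<^sub>M law f)"
  proof -
    have "(\<lambda>p. inner (\<zeta> (fst p)) (\<zeta> (snd p))) \<in> borel_measurable (unit_leb \<Otimes>\<^sub>M unit_leb)"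
      unfolding zz
      using jump_kernel_measurable measurable_compose[OF measurable_fst measurable_inner_jump, of _ unit_leb]
        measurable_compose[OF measurable_snd measurable_inner_jump, of _ unit_leb]
      by (intro borel_measurable_add borel_measurable_diff borel_measurable_sum borel_measurable_times borel_measurable_const)
    then show ?thesis
      using measurable_cong_sets[OF sets_pair_measure_cong[OF sets_law sets_law] refl] by blast
  qed
  have bz: "norm (\<zeta> y) \<le> 1 + norm J" if "y \<in> space (law f)" for y
  proof -
    have "norm (\<zeta> y) \<le> norm (jump y - J)" unfolding \<zeta>_def by (rule norm_resid_le[OF orthonormal_sinb])
    also have "\<dots> \<le> norm (jump y) + norm J" by (rule norm_triangle_ineq4)
    finally show ?thesis using norm_jump_le[of y] that by auto
  qed
  have iid: "integrable (sample_law n f) (\<lambda>X. (norm (\<Sum>i<n. \<zeta> (X i)))\<^sup>2) \<and>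
    (\<integral>X. (norm (\<Sum>i<n. \<zeta> (X i)))\<^sup>2 \<partial>sample_law n f) = n * (\<integral>y. (norm (\<zeta> y))\<^sup>2 \<partial>law f)"
    unfolding sample_law_def by (rule norm_iid_sum[OF prob_space_law[OF f] K bz zi z0])
  have nD: "(norm (D X))\<^sup>2 = (norm (\<Sum>i<n. \<zeta> (X i)))\<^sup>2 / n" for X
    unfolding D by (simp add: power_mult_distrib power_divide)
  show "integrable (sample_law n f) (\<lambda>X. (norm (D X))\<^sup>2)" unfolding nD using iid by simp
  have "(\<integral>X. (norm (D X))\<^sup>2 \<partial>sample_law n f) = (\<integral>y. (norm (\<zeta> y))\<^sup>2 \<partial>law f)"
    unfolding nD using iid n by simp
  also have "\<dots> = (\<integral>y. (norm (resid sinb m (jump y)))\<^sup>2 - 2 * inner (jump y) (resid sinb m J) + inner J (resid sinb m J) \<partial>law f)"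
  proof (rule Bochner_Integration.integral_cong[OF refl])
    fix y
    have "(norm (resid sinb m (jump y)))\<^sup>2 = inner (jump y) (resid sinb m (jump y))"
      unfolding power2_norm_eq_inner inner_resid_swap resid_idem[OF orthonormal_sinb] ..
    moreover have "inner J (resid sinb m (jump y)) = inner (jump y) (resid sinb m J)"
      by (metis inner_commute inner_resid_swap)
    moreover have "(norm (\<zeta> y))\<^sup>2 = inner (jump y - J) (resid sinb m (jump y) - resid sinb m J)"
      unfolding \<zeta>_def power2_norm_eq_inner inner_resid_swap resid_idem[OF orthonormal_sinb] by (simp only: resid_diff)
    ultimately show "(norm (\<zeta> y))\<^sup>2 = (norm (resid sinb m (jump y)))\<^sup>2 - 2 * inner (jump y) (resid sinb m J) + inner J (resid sinb m J)"
      by (simp add: inner_diff_left inner_diff_right)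
  qed
  also have "\<dots> = (\<integral>y. (norm (resid sinb m (jump y)))\<^sup>2 \<partial>law f) - 2 * inner J (resid sinb m J) + inner J (resid sinb m J)"
  proof -
    have "integrable (law f) (\<lambda>y. (norm (resid sinb m (jump y)))\<^sup>2)"
      using resid_jump_le by (intro integrable_law_bounded[OF f resid_jump_sq_measurable, of m 1]) (auto simp: power_le_one)
    then show ?thesis using ib P.prob_space integral_law_inner_jump[OF f] by (simp add: J_def)
  qed
  also have "\<dots> \<le> (\<integral>y. (norm (resid sinb m (jump y)))\<^sup>2 \<partial>law f)"
  proof -
    have "0 \<le> inner (resid sinb m J) (resid sinb m J)" by simp
    then have "0 \<le> inner J (resid sinb m J)" by (simp only: inner_resid_swap resid_idem[OF orthonormal_sinb])
    then show ?thesis by simp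
  qed
  also have "\<dots> \<le> (1 / 6 - (\<Sum>j<m. (kl_sd j)\<^sup>2)) + norm f"
    using integral_law_bounded(2)[OF f resid_jump_sq_measurable, of m 1] resid_jump_le integral_resid_jump[of m]
    by (auto simp: power_le_one abs_le_iff)
  finally show "(\<integral>X. (norm (D X))\<^sup>2 \<partial>sample_law n f) \<le> (1 / 6 - (\<Sum>j<m. (kl_sd j)\<^sup>2)) + norm f" .
qed

text \<open>
  The derivative \<open>2 l x exp (- l x\<^sup>2)\<close> is bounded by \<open>sqrt l\<close>
  because \<open>2 sqrt l x \<le> 1 + l x\<^sup>2 \<le> exp (l x\<^sup>2)\<close>.
\<close>

lemma exp_neg_sq_lipschitz:
  fixes x y l :: real
  assumes l: "l \<ge> 0"
  shows "\<bar>exp (- (l * x\<^sup>2)) - exp (- (l * y\<^sup>2))\<bar> \<le> sqrt l * \<bar>x - y\<bar>"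
proof -
  define g where "g x = exp (- (l * x\<^sup>2))" for x :: real
  define g' where "g' x = - (2 * l * x) * exp (- (l * x\<^sup>2))" for x :: real
  have d: "(g has_real_derivative g' x) (at x)" for x
    unfolding g_def g'_def by (auto intro!: derivative_eq_intros)
  have b: "\<bar>g' x\<bar> \<le> sqrt l" for x
  proof -
    have "1 + l * x\<^sup>2 \<le> exp (l * x\<^sup>2)" by (rule exp_ge_add_one_self)
    moreover have "2 * (sqrt l * \<bar>x\<bar>) \<le> 1 + l * x\<^sup>2"
      using sum_squares_bound[of 1 "sqrt l * \<bar>x\<bar>"] l by (simp add: power_mult_distrib)
    ultimately have "2 * (sqrt l * \<bar>x\<bar>) \<le> exp (l * x\<^sup>2)" by linarith
    then have "2 * (sqrt l * \<bar>x\<bar>) * exp (- (l * x\<^sup>2)) \<le> exp (l * x\<^sup>2) * exp (- (l * x\<^sup>2))"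
      by (intro mult_right_mono) auto
    then have "2 * (sqrt l * \<bar>x\<bar>) * exp (- (l * x\<^sup>2)) \<le> 1" by (simp add: exp_add[symmetric])
    then have "sqrt l * (2 * (sqrt l * \<bar>x\<bar>) * exp (- (l * x\<^sup>2))) \<le> sqrt l * 1"
      using l by (intro mult_left_mono) auto
    moreover have "sqrt l * (2 * (sqrt l * \<bar>x\<bar>) * exp (- (l * x\<^sup>2))) = (sqrt l * sqrt l) * (2 * \<bar>x\<bar> * exp (- (l * x\<^sup>2)))"
      by (simp only: mult_ac)
    ultimately show ?thesis using l by (simp add: g'_def abs_mult)
  qed
  have "norm (g x - g y) \<le> sqrt l * norm (x - y)"
    by (rule field_differentiable_bound[of UNIV g g']) (use d b in auto)
  then show ?thesis by (simp add: g_def)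
qed



section \<open>The Laplace transform of the statistic\<close>

definition gauss_vec :: "nat \<Rightarrow> (nat \<Rightarrow> real) measure" where
  "gauss_vec m = PiM {..<m} (\<lambda>_. std_normal_distribution)"

lemma prob_space_std_normal: "prob_space std_normal_distribution"
  using real_dist_normal_dist by (simp add: real_distribution_def)

lemma prob_space_gauss_vec: "prob_space (gauss_vec m)"
  unfolding gauss_vec_def by (intro prob_space_PiM prob_space_std_normal)

lemma gauss_component_measurable: "j < m \<Longrightarrow> (\<lambda>G. G j) \<in> borel_measurable (gauss_vec m)"
proof -
  assume "j < m"
  then have "(\<lambda>G. G j) \<in> gauss_vec m \<rightarrow>\<^sub>M std_normal_distribution"
    unfolding gauss_vec_def by (intro measurable_component_singleton) simp
  then show ?thesis by simp
qed

lemma gauss_vec_integral_prod: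
  fixes g :: "nat \<Rightarrow> real \<Rightarrow> complex"
  assumes "\<And>j. j < m \<Longrightarrow> g j \<in> borel_measurable borel" "\<And>j x. j < m \<Longrightarrow> norm (g j x) \<le> 1"
  shows "(\<integral>G. (\<Prod>j<m. g j (G j)) \<partial>gauss_vec m) = (\<Prod>j<m. \<integral>x. g j x \<partial>std_normal_distribution)"
proof -
  interpret G: prob_space std_normal_distribution by (rule prob_space_std_normal)
  interpret PP: product_prob_space "\<lambda>_::nat. std_normal_distribution" UNIV ..
  show ?thesis
    unfolding gauss_vec_def using assms
    by (intro PP.product_integral_prod G.integrable_const_bound[where B = 1]) auto
qed

text \<open>
  Each factor is the standard normal characteristic function. This linearises the square, so that
  sums over observations factorise.
\<close>

lemma exp_sum_squares_gaussian:
  assumes l: "l \<ge> 0"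
  shows "complex_of_real (exp (- (l * (\<Sum>j<m. (s j)\<^sup>2)))) = (\<integral>G. (\<Prod>j<m. iexp (sqrt (2 * l) * s j * G j)) \<partial>gauss_vec m)"
proof -
  have "(\<integral>G. (\<Prod>j<m. iexp (sqrt (2 * l) * s j * G j)) \<partial>gauss_vec m)
      = (\<Prod>j<m. \<integral>x. iexp (sqrt (2 * l) * s j * x) \<partial>std_normal_distribution)"
    by (rule gauss_vec_integral_prod) auto
  also have "\<dots> = (\<Prod>j<m. complex_of_real (exp (- (l * (s j)\<^sup>2))))"
  proof (rule prod.cong[OF refl])
    fix j
    have "(\<integral>x. iexp (sqrt (2 * l) * s j * x) \<partial>std_normal_distribution) = char std_normal_distribution (sqrt (2 * l) * s j)"
      by (simp add: char_def)
    also have "\<dots> = complex_of_real (exp (- (l * (s j)\<^sup>2)))"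
      using l by (simp add: char_std_normal_distribution power_mult_distrib)
    finally show "(\<integral>x. iexp (sqrt (2 * l) * s j * x) \<partial>std_normal_distribution) = complex_of_real (exp (- (l * (s j)\<^sup>2)))" .
  qed
  also have "\<dots> = complex_of_real (exp (- (l * (\<Sum>j<m. (s j)\<^sup>2))))"
    by (simp add: exp_sum sum_distrib_left sum_negf[symmetric] flip: of_real_prod)
  finally show ?thesis by simp
qed

lemma emp_process_coordinate:
  assumes "X \<in> space (sample_law n f)"
  shows "inner (emp_process n X) (sinb j) = kl_sd j * (\<Sum>i<n. cosf j (X i)) / sqrt n"
proof -
  have "(\<Sum>i<n. inner (jump (X i)) (sinb j)) = (\<Sum>i<n. kl_sd j * cosf j (X i))"
    using space_sample_law[OF assms] by (intro sum.cong refl inner_jump_sinb') auto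
  then show ?thesis by (simp add: emp_process_def inner_sum_left sum_distrib_left sum_divide_distrib)
qed

definition centred_form :: "nat \<Rightarrow> (nat \<Rightarrow> real) \<Rightarrow> l2 \<Rightarrow> real \<Rightarrow> real" where
  "centred_form m c f y = (\<Sum>j<m. c j * (cosf j y - inner f (cosb j)))"

text \<open>
  After linearising the square and exchanging the two expectations, the observations are
  independent for each fixed Gaussian vector \<open>G\<close>. Centring splits off the drift as a
  factor of modulus one, and the rest is the power of one characteristic function.
\<close>

lemma laplace_as_gaussian_mixture:
  fixes n :: nat
  assumes f: "is_alternative f" and n: "n > 0" and l: "l \<ge> 0"
  shows "complex_of_real (\<integral>X. exp (- (l * (\<Sum>j<m. (inner (emp_process n X) (sinb j))\<^sup>2))) \<partial>sample_law n f)
    = (\<integral>G. (\<Prod>j<m. iexp (sqrt (2 * l) * inner (drift n f) (sinb j) * G j)) *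
        (\<integral>y. iexp (centred_form m (\<lambda>j. sqrt (2 * l) * kl_sd j * G j) f y / sqrt n) \<partial>law f) ^ n \<partial>gauss_vec m)"
proof -
  interpret P: prob_space "law f" by (rule prob_space_law[OF f])
  interpret S: prob_space "sample_law n f" by (rule prob_space_sample_law[OF f])
  interpret G: prob_space "gauss_vec m" by (rule prob_space_gauss_vec)
  interpret SG: pair_prob_space "sample_law n f" "gauss_vec m" ..
  interpret PP: product_prob_space "\<lambda>_::nat. law f" UNIV ..
  define s where "s X j = inner (emp_process n X) (sinb j)" for X j
  define H where "H j = inner (drift n f) (sinb j)" for j
  define \<zeta> where "\<zeta> G y = centred_form m (\<lambda>j. sqrt (2 * l) * kl_sd j * G j) f y" for G y
  have sm: "(\<lambda>X. s X j) \<in> borel_measurable (sample_law n f)" for j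
    unfolding s_def by (rule inner_emp_measurable)
  have fm: "(\<lambda>(X, G). \<Prod>j<m. iexp (sqrt (2 * l) * s X j * G j)) \<in> borel_measurable (sample_law n f \<Otimes>\<^sub>M gauss_vec m)"
  proof -
    have "(\<lambda>p. sqrt (2 * l) * s (fst p) j * snd p j) \<in> borel_measurable (sample_law n f \<Otimes>\<^sub>M gauss_vec m)" if "j < m" for j
      using measurable_compose[OF measurable_fst sm] measurable_compose[OF measurable_snd gauss_component_measurable[OF that]]
      by (intro borel_measurable_times) auto
    moreover have iexp_m: "iexp \<in> borel_measurable borel" by measurable
    ultimately have "(\<lambda>p. iexp (sqrt (2 * l) * s (fst p) j * snd p j)) \<in> borel_measurable (sample_law n f \<Otimes>\<^sub>M gauss_vec m)" if "j < m" for j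
      using measurable_compose[OF _ iexp_m] that by blast
    then have "(\<lambda>p. \<Prod>j<m. iexp (sqrt (2 * l) * s (fst p) j * snd p j)) \<in> borel_measurable (sample_law n f \<Otimes>\<^sub>M gauss_vec m)"
      by (intro borel_measurable_prod) auto
    then show ?thesis by (simp add: case_prod_beta')
  qed
  have fi: "integrable (sample_law n f \<Otimes>\<^sub>M gauss_vec m) (\<lambda>(X, G). \<Prod>j<m. iexp (sqrt (2 * l) * s X j * G j))"
    by (rule SG.integrable_const_bound[OF _ fm, where B = 1]) (auto simp: prod_norm[symmetric] intro!: prod_le_1)
  have em: "(\<lambda>X. exp (- (l * (\<Sum>j<m. (s X j)\<^sup>2)))) \<in> borel_measurable (sample_law n f)"
    using sm by measurable
  have "complex_of_real (\<integral>X. exp (- (l * (\<Sum>j<m. (s X j)\<^sup>2))) \<partial>sample_law n f)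
      = (\<integral>X. complex_of_real (exp (- (l * (\<Sum>j<m. (s X j)\<^sup>2)))) \<partial>sample_law n f)"
    by (rule integral_complex_of_real[symmetric])
  also have "\<dots> = (\<integral>X. \<integral>G. (\<Prod>j<m. iexp (sqrt (2 * l) * s X j * G j)) \<partial>gauss_vec m \<partial>sample_law n f)"
    unfolding exp_sum_squares_gaussian[OF l] ..
  also have "\<dots> = (\<integral>G. \<integral>X. (\<Prod>j<m. iexp (sqrt (2 * l) * s X j * G j)) \<partial>sample_law n f \<partial>gauss_vec m)"
    by (rule SG.Fubini_integral[OF fi, symmetric])
  also have "\<dots> = (\<integral>G. (\<Prod>j<m. iexp (sqrt (2 * l) * H j * G j)) * (\<integral>y. iexp (\<zeta> G y / sqrt n) \<partial>law f) ^ n \<partial>gauss_vec m)"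
  proof (rule Bochner_Integration.integral_cong[OF refl])
    fix G
    have split: "(\<Prod>j<m. iexp (sqrt (2 * l) * s X j * G j))
        = (\<Prod>j<m. iexp (sqrt (2 * l) * H j * G j)) * (\<Prod>i<n. iexp (\<zeta> G (X i) / sqrt n))"
      if X: "X \<in> space (sample_law n f)" for X
    proof -
      have "(\<Sum>i<n. \<zeta> G (X i) / sqrt n) = (\<Sum>j<m. \<Sum>i<n. sqrt (2 * l) * kl_sd j * G j * (cosf j (X i) - inner f (cosb j)) / sqrt n)"
        unfolding \<zeta>_def centred_form_def sum_divide_distrib by (rule sum.swap)
      also have "\<dots> = (\<Sum>j<m. sqrt (2 * l) * s X j * G j - sqrt (2 * l) * H j * G j)"
      proof (rule sum.cong[OF refl])
        fix j
        have "(\<Sum>i<n. sqrt (2 * l) * kl_sd j * G j * (cosf j (X i) - inner f (cosb j)) / sqrt n)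
            = sqrt (2 * l) * kl_sd j * G j * ((\<Sum>i<n. cosf j (X i)) - n * inner f (cosb j)) / sqrt n"
          by (simp only: sum_divide_distrib[symmetric] sum_distrib_left[symmetric] sum_subtractf) simp
        also have "\<dots> = sqrt (2 * l) * (kl_sd j * (\<Sum>i<n. cosf j (X i)) / sqrt n) * G j
           - sqrt (2 * l) * (real n / sqrt n * (kl_sd j * inner f (cosb j))) * G j"
          by (simp add: algebra_simps diff_divide_distrib)
        also have "real n / sqrt n = sqrt n" by (simp add: real_div_sqrt)
        finally show "(\<Sum>i<n. sqrt (2 * l) * kl_sd j * G j * (cosf j (X i) - inner f (cosb j)) / sqrt n)
          = sqrt (2 * l) * s X j * G j - sqrt (2 * l) * H j * G j"
          unfolding s_def H_def emp_process_coordinate[OF X] inner_scaleR_left inner_volterra_sinb[OF f] .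
      qed
      finally have eq: "(\<Sum>j<m. sqrt (2 * l) * s X j * G j) = (\<Sum>j<m. sqrt (2 * l) * H j * G j) + (\<Sum>i<n. \<zeta> G (X i) / sqrt n)"
        by (simp add: sum_subtractf)
      have ie: "(\<Prod>k\<in>A. iexp (r k)) = iexp (\<Sum>k\<in>A. r k)" if "finite A" for A and r :: "nat \<Rightarrow> real"
        using that by (simp add: exp_sum sum_distrib_left)
      show ?thesis
        by (simp only: ie finite_lessThan eq of_real_add distrib_left exp_add)
    qed
    have zm: "\<zeta> G \<in> borel_measurable (law f)"
      unfolding \<zeta>_def centred_form_def[abs_def] measurable_cong_sets[OF sets_law refl]
      by (intro borel_measurable_sum borel_measurable_times borel_measurable_diff cosf_measurable) auto
    have "(\<integral>X. (\<Prod>j<m. iexp (sqrt (2 * l) * s X j * G j)) \<partial>sample_law n f)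
        = (\<integral>X. (\<Prod>j<m. iexp (sqrt (2 * l) * H j * G j)) * (\<Prod>i<n. iexp (\<zeta> G (X i) / sqrt n)) \<partial>sample_law n f)"
      by (rule Bochner_Integration.integral_cong[OF refl split])
    also have "\<dots> = (\<Prod>j<m. iexp (sqrt (2 * l) * H j * G j)) * (\<integral>X. (\<Prod>i<n. iexp (\<zeta> G (X i) / sqrt n)) \<partial>sample_law n f)"
      by (rule integral_mult_right_zero)
    also have "(\<integral>X. (\<Prod>i<n. iexp (\<zeta> G (X i) / sqrt n)) \<partial>sample_law n f) = (\<Prod>i<n. \<integral>y. iexp (\<zeta> G y / sqrt n) \<partial>law f)"
      unfolding sample_law_def
    proof (rule PP.product_integral_prod)
      show "integrable (law f) (\<lambda>y. iexp (\<zeta> G y / sqrt n))" for i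
        using zm by (intro P.integrable_const_bound[where B = 1]) auto
    qed simp
    finally show "(\<integral>X. (\<Prod>j<m. iexp (sqrt (2 * l) * s X j * G j)) \<partial>sample_law n f)
      = (\<Prod>j<m. iexp (sqrt (2 * l) * H j * G j)) * (\<integral>y. iexp (\<zeta> G y / sqrt n) \<partial>law f) ^ n" by simp
  qed
  finally show ?thesis by (simp add: s_def H_def \<zeta>_def)
qed

lemma centred_form_moments:
  fixes m :: nat and c :: "nat \<Rightarrow> real"
  assumes f: "is_alternative f"
  defines "B \<equiv> 2 * (\<Sum>j<m. \<bar>c j\<bar>)"
  shows "centred_form m c f \<in> borel_measurable (law f)"
    and "\<bar>centred_form m c f y\<bar> \<le> B + norm f * (\<Sum>j<m. \<bar>c j\<bar>)"
    and "(\<integral>y. centred_form m c f y \<partial>law f) = 0"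
    and "\<bar>(\<integral>y. (centred_form m c f y)\<^sup>2 \<partial>law f) - (\<Sum>j<m. (c j)\<^sup>2)\<bar> \<le> norm f * B\<^sup>2 + (norm f * B)\<^sup>2"
proof -
  interpret P: prob_space "law f" by (rule prob_space_law[OF f])
  define A where "A y = (\<Sum>j<m. c j * cosf j y)" for y
  define a where "a = (\<Sum>j<m. c j * inner f (cosb j))"
  have cf: "centred_form m c f y = A y - a" for y
    by (simp add: centred_form_def A_def a_def sum_subtractf right_diff_distrib)
  have Am: "A \<in> borel_measurable unit_leb"
    unfolding A_def[abs_def] by (intro borel_measurable_sum borel_measurable_times cosf_measurable) auto
  have AB: "\<bar>A y\<bar> \<le> B" for y
  proof -
    have "\<bar>A y\<bar> \<le> (\<Sum>j<m. \<bar>c j * cosf j y\<bar>)" unfolding A_def by (rule sum_abs)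
    also have "\<dots> \<le> (\<Sum>j<m. \<bar>c j\<bar> * 2)"
      unfolding abs_mult by (intro sum_mono mult_left_mono cosf_bound) auto
    finally show ?thesis by (simp add: B_def sum_distrib_left mult.commute)
  qed
  have B0: "0 \<le> B" by (simp add: B_def sum_nonneg)
  show "centred_form m c f \<in> borel_measurable (law f)"
    unfolding cf[abs_def] measurable_cong_sets[OF sets_law refl] using Am by measurable
  have "\<bar>a\<bar> \<le> (\<Sum>j<m. \<bar>c j * inner f (cosb j)\<bar>)" unfolding a_def by (rule sum_abs)
  also have "\<dots> \<le> (\<Sum>j<m. \<bar>c j\<bar> * norm f)"
  proof (unfold abs_mult, intro sum_mono mult_left_mono)
    fix j
    have "norm (cosb j) = 1" using orthonormal_cosb by (simp add: norm_eq_sqrt_inner orthonormal_def)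
    then show "\<bar>inner f (cosb j)\<bar> \<le> norm f" using Cauchy_Schwarz_ineq2[of f "cosb j"] by simp
  qed auto
  finally have "\<bar>a\<bar> \<le> norm f * (\<Sum>j<m. \<bar>c j\<bar>)" by (simp add: sum_distrib_left mult.commute)
  then show "\<bar>centred_form m c f y\<bar> \<le> B + norm f * (\<Sum>j<m. \<bar>c j\<bar>)"
    unfolding cf using AB[of y] by linarith
  have Ai: "integrable (law f) A" by (rule integrable_law_bounded[OF f Am AB])
  have A2m: "(\<lambda>y. (A y)\<^sup>2) \<in> borel_measurable unit_leb" using Am by measurable
  have A2B: "\<bar>(A y)\<^sup>2\<bar> \<le> B\<^sup>2" for y
    using AB[of y] B0 by (simp add: abs_le_square_iff[symmetric])
  have A2i: "integrable (law f) (\<lambda>y. (A y)\<^sup>2)" by (rule integrable_law_bounded[OF f A2m A2B])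
  have ci: "integrable (law f) (cosf j)" for j
    by (rule integrable_law_bounded[OF f cosf_measurable cosf_bound])
  have EA: "(\<integral>y. A y \<partial>law f) = a"
    unfolding A_def a_def using ci integral_law_cosf[OF f] by simp
  show "(\<integral>y. centred_form m c f y \<partial>law f) = 0"
    unfolding cf using Ai EA P.prob_space by simp
  have "(\<integral>y. A y \<partial>unit_leb) = 0"
    unfolding A_def using sq_integrable_integrable[OF sq_integrable_cosf] integral_cosf by simp
  with integral_law_bounded(2)[OF f Am AB] have "\<bar>a\<bar> \<le> norm f * B" by (simp add: EA)
  then have a2: "a\<^sup>2 \<le> (norm f * B)\<^sup>2" using B0 by (simp add: abs_le_square_iff[symmetric])
  have "(\<integral>y. (centred_form m c f y)\<^sup>2 \<partial>law f) = (\<integral>y. (A y)\<^sup>2 - 2 * a * A y + a\<^sup>2 \<partial>law f)"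
    unfolding cf by (rule Bochner_Integration.integral_cong) (auto simp: power2_diff)
  also have "\<dots> = (\<integral>y. (A y)\<^sup>2 \<partial>law f) - a\<^sup>2"
    using Ai A2i EA P.prob_space by (simp add: power2_eq_square)
  finally have e1: "(\<integral>y. (centred_form m c f y)\<^sup>2 \<partial>law f) = (\<integral>y. (A y)\<^sup>2 \<partial>law f) - a\<^sup>2" .
  have e2: "(\<integral>y. (A y)\<^sup>2 \<partial>unit_leb) = (\<Sum>j<m. (c j)\<^sup>2)"
  proof -
    have i: "integrable unit_leb (\<lambda>y. c j * c k * (cosf j y * cosf k y))" for j k
      using sq_integrable_mult[OF sq_integrable_cosf sq_integrable_cosf] by simp
    have "(\<integral>y. (A y)\<^sup>2 \<partial>unit_leb) = (\<integral>y. (\<Sum>j<m. \<Sum>k<m. c j * c k * (cosf j y * cosf k y)) \<partial>unit_leb)"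
      unfolding A_def power2_eq_square sum_product by (simp add: mult_ac)
    also have "\<dots> = (\<Sum>j<m. \<Sum>k<m. c j * c k * (if j = k then 1 else 0))"
      using i by (simp add: integral_cosf_products)
    also have "\<dots> = (\<Sum>j<m. (c j)\<^sup>2)"
      by (simp add: if_distrib[of "(*) _"] power2_eq_square cong: if_cong)
    finally show ?thesis .
  qed
  show "\<bar>(\<integral>y. (centred_form m c f y)\<^sup>2 \<partial>law f) - (\<Sum>j<m. (c j)\<^sup>2)\<bar> \<le> norm f * B\<^sup>2 + (norm f * B)\<^sup>2"
    using integral_law_bounded(2)[OF f A2m A2B] a2 zero_le_power2[of a] unfolding e1 e2 by linarith
qed


text \<open>
  The Laplace transform of the sum of the first \<open>m\<close> squared coordinates of the
  Brownian bridge.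
\<close>

definition chi_factor :: "nat \<Rightarrow> real \<Rightarrow> real" where
  "chi_factor m l = (\<Prod>j<m. 1 / sqrt (1 + 2 * l * (kl_sd j)\<^sup>2))"

text \<open>
  The change of that transform caused by shifting the first \<open>m\<close> coordinates by those
  of \<open>H\<close>.
\<close>

definition shift_factor :: "nat \<Rightarrow> l2 \<Rightarrow> real \<Rightarrow> real" where
  "shift_factor m H l = (\<Prod>j<m. exp (- (l * (inner H (sinb j))\<^sup>2 / (1 + 2 * l * (kl_sd j)\<^sup>2))))"

text \<open>
  The limit of the Gaussian mixture factorises over coordinates.
\<close>

lemma gaussian_shift_integral:
  assumes l: "l \<ge> 0"
  shows "(\<integral>G. (\<Prod>j<m. iexp (sqrt (2 * l) * inner H (sinb j) * G j)) *
      complex_of_real (exp (- (\<Sum>j<m. (sqrt (2 * l) * kl_sd j * G j)\<^sup>2) / 2)) \<partial>gauss_vec m)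
    = complex_of_real (chi_factor m l * shift_factor m H l)"
proof -
  define g where "g j x = iexp (sqrt (2 * l) * inner H (sinb j) * x) * complex_of_real (exp (- (2 * l * (kl_sd j)\<^sup>2 * x\<^sup>2) / 2))" for j x
  have "(\<Prod>j<m. iexp (sqrt (2 * l) * inner H (sinb j) * G j)) *
      complex_of_real (exp (- (\<Sum>j<m. (sqrt (2 * l) * kl_sd j * G j)\<^sup>2) / 2)) = (\<Prod>j<m. g j (G j))" for G :: "nat \<Rightarrow> real"
  proof -
    have "exp (- (\<Sum>j<m. (sqrt (2 * l) * kl_sd j * G j)\<^sup>2) / 2) = (\<Prod>j<m. exp (- (2 * l * (kl_sd j)\<^sup>2 * (G j)\<^sup>2) / 2))"
      using l by (simp add: exp_sum[symmetric] power_mult_distrib sum_negf sum_divide_distrib)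
    then show ?thesis by (simp only: g_def prod.distrib of_real_prod)
  qed
  then have "(\<integral>G. (\<Prod>j<m. iexp (sqrt (2 * l) * inner H (sinb j) * G j)) *
      complex_of_real (exp (- (\<Sum>j<m. (sqrt (2 * l) * kl_sd j * G j)\<^sup>2) / 2)) \<partial>gauss_vec m)
     = (\<integral>G. (\<Prod>j<m. g j (G j)) \<partial>gauss_vec m)" by simp
  also have "\<dots> = (\<Prod>j<m. \<integral>x. g j x \<partial>std_normal_distribution)"
    by (rule gauss_vec_integral_prod) (use l in \<open>auto simp: g_def norm_mult\<close>)
  also have "\<dots> = (\<Prod>j<m. complex_of_real (exp (- (l * (inner H (sinb j))\<^sup>2 / (1 + 2 * l * (kl_sd j)\<^sup>2))) * (1 / sqrt (1 + 2 * l * (kl_sd j)\<^sup>2))))"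
  proof (rule prod.cong[OF refl])
    fix j
    have "(\<integral>x. g j x \<partial>std_normal_distribution) = complex_of_real (exp (- (sqrt (2 * l) * inner H (sinb j))\<^sup>2 / (2 * (1 + 2 * l * (kl_sd j)\<^sup>2))) / sqrt (1 + 2 * l * (kl_sd j)\<^sup>2))"
      unfolding g_def by (rule gaussian_twisted_char) (use l in auto)
    also have "- (sqrt (2 * l) * inner H (sinb j))\<^sup>2 / (2 * (1 + 2 * l * (kl_sd j)\<^sup>2)) = - (l * (inner H (sinb j))\<^sup>2 / (1 + 2 * l * (kl_sd j)\<^sup>2))"
    proof -
      have "(sqrt (2 * l) * inner H (sinb j))\<^sup>2 = 2 * (l * (inner H (sinb j))\<^sup>2)" using l by (simp add: power_mult_distrib)
      then show ?thesis by (simp only: minus_divide_left[symmetric] mult_divide_mult_cancel_left)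
    qed
    finally show "(\<integral>x. g j x \<partial>std_normal_distribution) = complex_of_real (exp (- (l * (inner H (sinb j))\<^sup>2 / (1 + 2 * l * (kl_sd j)\<^sup>2))) * (1 / sqrt (1 + 2 * l * (kl_sd j)\<^sup>2)))"
      by simp
  qed
  also have "\<dots> = complex_of_real (chi_factor m l * shift_factor m H l)"
    unfolding of_real_prod[symmetric] prod.distrib chi_factor_def shift_factor_def by (simp only: mult.commute)
  finally show ?thesis .
qed

lemma char_integral_measurable:
  assumes f: "is_alternative f"
  shows "(\<lambda>G. \<integral>y. iexp (centred_form m (\<lambda>j. a j * G j) f y / r) \<partial>law f) \<in> borel_measurable (gauss_vec m)"
proof -
  interpret P: prob_space "law f" by (rule prob_space_law[OF f])
  have "(\<lambda>p. a j * fst p j * (cosf j (snd p) - inner f (cosb j))) \<in> borel_measurable (gauss_vec m \<Otimes>\<^sub>M law f)" if "j < m" for j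
    using measurable_compose[OF measurable_fst gauss_component_measurable[OF that]]
      measurable_compose[OF measurable_snd, of "cosf j" "law f" borel] cosf_measurable[of j]
    by (intro borel_measurable_times borel_measurable_diff borel_measurable_const) (auto simp: measurable_cong_sets[OF sets_law refl])
  then have m: "(\<lambda>p. centred_form m (\<lambda>j. a j * fst p j) f (snd p) / r) \<in> borel_measurable (gauss_vec m \<Otimes>\<^sub>M law f)"
    unfolding centred_form_def by (intro borel_measurable_divide borel_measurable_sum borel_measurable_const) auto
  have "(\<lambda>p. iexp (centred_form m (\<lambda>j. a j * fst p j) f (snd p) / r)) \<in> borel_measurable (gauss_vec m \<Otimes>\<^sub>M law f)"
    using m by measurable
  then show ?thesis
    by (intro P.borel_measurable_lebesgue_integral) (simp add: case_prod_beta')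
qed

text \<open>
  For fixed \<open>G\<close> the power of the characteristic function converges, and dominated
  convergence handles the average over \<open>G\<close>. As the drift enters only through the
  unimodular factor \<open>u\<close>, it drops out of the error bound, and the result holds for
  drifts of any size.
\<close>

lemma finite_laplace_tendsto:
  fixes N :: "nat \<Rightarrow> nat"
  assumes f: "\<And>i. is_alternative (f i)" and N0: "\<And>i. N i > 0" and N: "filterlim N at_top sequentially"
    and f0: "(\<lambda>i. norm (f i)) \<longlonglongrightarrow> 0" and l: "l \<ge> 0"
  shows "(\<lambda>i. (\<integral>X. exp (- (l * (\<Sum>j<m. (inner (emp_process (N i) X) (sinb j))\<^sup>2))) \<partial>sample_law (N i) (f i))
      - chi_factor m l * shift_factor m (drift (N i) (f i)) l) \<longlonglongrightarrow> 0"
proof -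
  interpret G: prob_space "gauss_vec m" by (rule prob_space_gauss_vec)
  define c where "c G j = sqrt (2 * l) * kl_sd j * G j" for G :: "nat \<Rightarrow> real" and j
  define ch where "ch i G = (\<integral>y. iexp (centred_form m (c G) (f i) y / sqrt (N i)) \<partial>law (f i)) ^ N i" for i G
  define E where "E G = complex_of_real (exp (- (\<Sum>j<m. (c G j)\<^sup>2) / 2))" for G
  define u where "u i G = (\<Prod>j<m. iexp (sqrt (2 * l) * inner (drift (N i) (f i)) (sinb j) * G j))" for i G
  define \<Delta> where "\<Delta> i = (\<integral>X. exp (- (l * (\<Sum>j<m. (inner (emp_process (N i) X) (sinb j))\<^sup>2))) \<partial>sample_law (N i) (f i))
      - chi_factor m l * shift_factor m (drift (N i) (f i)) l" for i
  have pointwise: "(\<lambda>i. ch i G) \<longlonglongrightarrow> E G" for G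
  proof -
    define S where "S = (\<Sum>j<m. \<bar>c G j\<bar>)"
    obtain K where K: "\<And>i. norm (f i) \<le> K"
      using convergent_imp_bounded[of "\<lambda>i. norm (f i)"] f0 by (auto simp: bounded_iff convergent_def)
    have S0: "0 \<le> S" by (simp add: S_def sum_nonneg)
    have b: "\<bar>centred_form m (c G) (f i) y\<bar> \<le> 2 * S + K * S" for i y
      using centred_form_moments(2)[OF f[of i], where m = m and c = "c G" and y = y] mult_right_mono[OF K[of i] S0] by (simp add: S_def)
    have "(\<lambda>i. norm (f i) * (2 * S)\<^sup>2 + (norm (f i) * (2 * S))\<^sup>2) \<longlonglongrightarrow> 0 * (2 * S)\<^sup>2 + (0 * (2 * S))\<^sup>2"
      by (intro tendsto_intros f0)
    then have lim: "(\<lambda>i. norm (f i) * (2 * S)\<^sup>2 + (norm (f i) * (2 * S))\<^sup>2) \<longlonglongrightarrow> 0" by simp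
    have "(\<lambda>i. (\<integral>y. (centred_form m (c G) (f i) y)\<^sup>2 \<partial>law (f i)) - (\<Sum>j<m. (c G j)\<^sup>2)) \<longlonglongrightarrow> 0"
      by (rule Lim_null_comparison[OF _ lim]) (use centred_form_moments(4)[OF f, where m = m and c = "c G"] in \<open>simp add: S_def\<close>)
    from tendsto_add[OF this tendsto_const[of "\<Sum>j<m. (c G j)\<^sup>2"]]
    have v: "(\<lambda>i. \<integral>y. (centred_form m (c G) (f i) y)\<^sup>2 \<partial>law (f i)) \<longlonglongrightarrow> (\<Sum>j<m. (c G j)\<^sup>2)" by simp
    show ?thesis
      unfolding ch_def E_def
      by (rule char_power_tendsto[OF prob_space_law[OF f] centred_form_moments(1)[OF f] b centred_form_moments(3)[OF f] v N])
  qed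
  have chm: "ch i \<in> borel_measurable (gauss_vec m)" for i
    unfolding ch_def c_def using char_integral_measurable[OF f] by (intro borel_measurable_power) auto
  have cm: "(\<lambda>G. c G j) \<in> borel_measurable (gauss_vec m)" if "j < m" for j
    unfolding c_def using gauss_component_measurable[OF that] by (intro borel_measurable_times) auto
  have Em: "E \<in> borel_measurable (gauss_vec m)"
  proof -
    have "(\<lambda>G. - (\<Sum>j<m. (c G j)\<^sup>2) / 2) \<in> borel_measurable (gauss_vec m)"
      using cm by (intro borel_measurable_divide borel_measurable_uminus borel_measurable_sum borel_measurable_power) auto
    then show ?thesis unfolding E_def by measurable
  qed
  have um: "u i \<in> borel_measurable (gauss_vec m)" for i
  proof -
    have "(\<lambda>G. iexp (sqrt (2 * l) * inner (drift (N i) (f i)) (sinb j) * G j)) \<in> borel_measurable (gauss_vec m)" if "j < m" for j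
      using gauss_component_measurable[OF that] by measurable
    then show ?thesis unfolding u_def[abs_def] by (intro borel_measurable_prod) auto
  qed
  have u1: "norm (u i G) = 1" for i G by (simp add: u_def prod_norm[symmetric])
  have ch1: "norm (ch i G) \<le> 1" for i G
  proof -
    interpret P: prob_space "law (f i)" by (rule prob_space_law[OF f])
    have "norm (\<integral>y. iexp (centred_form m (c G) (f i) y / sqrt (N i)) \<partial>law (f i)) \<le> (\<integral>y. 1 \<partial>law (f i))"
      by (rule order_trans[OF integral_norm_bound]) simp
    then show ?thesis unfolding ch_def norm_power using P.prob_space by (simp add: power_le_one)
  qed
  have E1: "norm (E G) \<le> 1" for G by (simp add: E_def sum_nonneg)
  have ich: "integrable (gauss_vec m) (\<lambda>G. u i G * ch i G)" for i
    using um chm u1 ch1 by (intro G.integrable_const_bound[where B = 1]) (auto simp: norm_mult)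
  have iE: "integrable (gauss_vec m) (\<lambda>G. u i G * E G)" for i
    using um Em u1 E1 by (intro G.integrable_const_bound[where B = 1]) (auto simp: norm_mult)
  have "(\<lambda>i. \<integral>G. norm (ch i G - E G) \<partial>gauss_vec m) \<longlonglongrightarrow> (\<integral>G. 0 \<partial>gauss_vec m)"
  proof (rule integral_dominated_convergence[where w = "\<lambda>_. 2"])
    show "AE G in gauss_vec m. (\<lambda>i. norm (ch i G - E G)) \<longlonglongrightarrow> 0"
    proof (rule AE_I2)
      fix G
      show "(\<lambda>i. norm (ch i G - E G)) \<longlonglongrightarrow> 0"
        using tendsto_norm[OF tendsto_diff[OF pointwise[of G] tendsto_const[of "E G"]]] by simp
    qed
    show "AE G in gauss_vec m. norm (norm (ch i G - E G)) \<le> 2" for i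
    proof (rule AE_I2)
      fix G
      have "norm (ch i G - E G) \<le> norm (ch i G) + norm (E G)" by (rule norm_triangle_ineq4)
      then show "norm (norm (ch i G - E G)) \<le> 2" using ch1[of i G] E1[of G] by simp
    qed
  qed (use chm Em in auto)
  then have lim: "(\<lambda>i. \<integral>G. norm (ch i G - E G) \<partial>gauss_vec m) \<longlonglongrightarrow> 0" by simp
  have "\<bar>\<Delta> i\<bar> \<le> (\<integral>G. norm (ch i G - E G) \<partial>gauss_vec m)" for i
  proof -
    have "complex_of_real (\<Delta> i) = (\<integral>G. u i G * ch i G \<partial>gauss_vec m) - (\<integral>G. u i G * E G \<partial>gauss_vec m)"
      unfolding \<Delta>_def of_real_diff laplace_as_gaussian_mixture[OF f N0 l]
        gaussian_shift_integral[OF l, symmetric] u_def ch_def E_def c_def ..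
    also have "\<dots> = (\<integral>G. u i G * (ch i G - E G) \<partial>gauss_vec m)"
      using ich iE by (simp add: right_diff_distrib)
    finally have "\<bar>\<Delta> i\<bar> = norm (\<integral>G. u i G * (ch i G - E G) \<partial>gauss_vec m)"
      by (metis norm_of_real)
    also have "\<dots> \<le> (\<integral>G. norm (u i G * (ch i G - E G)) \<partial>gauss_vec m)" by (rule integral_norm_bound)
    finally show ?thesis by (simp add: norm_mult u1)
  qed
  then have "\<Delta> \<longlonglongrightarrow> 0" by (intro Lim_null_comparison[OF _ lim]) auto
  then show ?thesis unfolding \<Delta>_def .
qed

lemma (in prob_space) expectation_le_sqrt_second_moment:
  fixes Y :: "'a \<Rightarrow> real"
  assumes Y: "Y \<in> borel_measurable M" and i: "integrable M (\<lambda>x. (Y x)\<^sup>2)"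
  shows "integrable M Y" "expectation Y \<le> sqrt (expectation (\<lambda>x. (Y x)\<^sup>2))"
proof -
  show iY: "integrable M Y"
  proof (rule Bochner_Integration.integrable_bound[OF _ Y])
    show "integrable M (\<lambda>x. 1 + (Y x)\<^sup>2)" using i by simp
    have "\<bar>y\<bar> \<le> 1 + y\<^sup>2" for y :: real
      using sum_squares_bound[of 1 "\<bar>y\<bar>"] by simp
    then have "norm (Y x) \<le> norm (1 + (Y x)\<^sup>2)" for x by (metis abs_ge_self order_trans real_norm_def)
    then show "AE x in M. norm (Y x) \<le> norm (1 + (Y x)\<^sup>2)" by simp
  qed
  have "(expectation Y)\<^sup>2 \<le> expectation (\<lambda>x. (Y x)\<^sup>2)"
    using variance_positive[of Y] variance_eq[OF iY i] by simp
  then show "expectation Y \<le> sqrt (expectation (\<lambda>x. (Y x)\<^sup>2))" by (rule real_le_rsqrt)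
qed

text \<open>
  The part of the squared norm beyond the first \<open>m\<close> coordinates is replaced by that
  of the drift. The Lipschitz bound is in terms of the norms, not their squares, so the error
  depends on the random part alone and is uniform in the drift.
\<close>

lemma laplace_truncation:
  fixes m n :: nat
  assumes f: "is_alternative f" and n: "n > 0" and l: "l \<ge> 0"
  shows "\<bar>(\<integral>X. exp (- (l * (n * cvm_stat n X))) \<partial>sample_law n f)
     - exp (- (l * (norm (resid sinb m (drift n f)))\<^sup>2)) *
       (\<integral>X. exp (- (l * (\<Sum>j<m. (inner (emp_process n X) (sinb j))\<^sup>2))) \<partial>sample_law n f)\<bar>
    \<le> sqrt l * sqrt ((1 / 6 - (\<Sum>j<m. (kl_sd j)\<^sup>2)) + norm f)"
proof -
  interpret S: prob_space "sample_law n f" by (rule prob_space_sample_law[OF f])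
  define H where "H = drift n f"
  define D where "D X = norm (resid sinb m (emp_process n X - H))" for X
  define A where "A X = (\<Sum>j<m. (inner (emp_process n X) (sinb j))\<^sup>2)" for X
  define d where "d = norm (resid sinb m H)"
  have D2: "integrable (sample_law n f) (\<lambda>X. (D X)\<^sup>2)" "(\<integral>X. (D X)\<^sup>2 \<partial>sample_law n f) \<le> (1 / 6 - (\<Sum>j<m. (kl_sd j)\<^sup>2)) + norm f"
    using high_freq_second_moment[OF f n, of m] by (auto simp: D_def H_def)
  have Dm: "D \<in> borel_measurable (sample_law n f)"
  proof -
    have "(\<lambda>X. sqrt ((D X)\<^sup>2)) \<in> borel_measurable (sample_law n f)"
      using borel_measurable_integrable[OF D2(1)] by measurable
    then show ?thesis by (simp add: D_def[abs_def])
  qed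
  note ED = S.expectation_le_sqrt_second_moment[OF Dm D2(1)]
  have Am: "A \<in> borel_measurable (sample_law n f)"
    unfolding A_def[abs_def] by (intro borel_measurable_sum borel_measurable_power inner_emp_measurable)
  have A0: "0 \<le> A X" for X by (simp add: A_def sum_nonneg)
  have Qm: "(\<lambda>X. exp (- (l * (norm (emp_process n X))\<^sup>2))) \<in> borel_measurable (sample_law n f)"
    using emp_norm_measurable by measurable
  have Qi: "integrable (sample_law n f) (\<lambda>X. exp (- (l * (norm (emp_process n X))\<^sup>2)))"
    using Qm l by (intro S.integrable_const_bound[where B = 1]) auto
  have Ai: "integrable (sample_law n f) (\<lambda>X. exp (- (l * A X)))"
    using Am l A0 by (intro S.integrable_const_bound[where B = 1]) auto
  have pt: "\<bar>exp (- (l * (norm (emp_process n X))\<^sup>2)) - exp (- (l * d\<^sup>2)) * exp (- (l * A X))\<bar> \<le> sqrt l * D X" for X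
  proof -
    define x where "x = norm (resid sinb m (emp_process n X))"
    have "(norm (emp_process n X))\<^sup>2 = A X + x\<^sup>2"
      unfolding A_def x_def by (rule norm_resid[OF orthonormal_sinb])
    then have "exp (- (l * (norm (emp_process n X))\<^sup>2)) = exp (- (l * A X)) * exp (- (l * x\<^sup>2))"
      by (simp add: exp_add[symmetric] algebra_simps)
    then have "\<bar>exp (- (l * (norm (emp_process n X))\<^sup>2)) - exp (- (l * d\<^sup>2)) * exp (- (l * A X))\<bar>
      = exp (- (l * A X)) * \<bar>exp (- (l * x\<^sup>2)) - exp (- (l * d\<^sup>2))\<bar>"
    proof -
      have "exp (- (l * A X)) * exp (- (l * x\<^sup>2)) - exp (- (l * d\<^sup>2)) * exp (- (l * A X))
        = exp (- (l * A X)) * (exp (- (l * x\<^sup>2)) - exp (- (l * d\<^sup>2)))" by (simp add: algebra_simps)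
      then show ?thesis using \<open>exp (- (l * (norm (emp_process n X))\<^sup>2)) = _\<close> by (simp add: abs_mult)
    qed
    also have "\<dots> \<le> 1 * (sqrt l * \<bar>x - d\<bar>)"
      using l by (intro mult_mono exp_neg_sq_lipschitz) (auto simp: A_def sum_nonneg)
    also have "\<bar>x - d\<bar> \<le> D X"
      unfolding x_def d_def D_def resid_diff by (rule norm_triangle_ineq3)
    finally show ?thesis using l by (simp add: mult_left_mono)
  qed
  have "\<bar>(\<integral>X. exp (- (l * (norm (emp_process n X))\<^sup>2)) \<partial>sample_law n f) - exp (- (l * d\<^sup>2)) * (\<integral>X. exp (- (l * A X)) \<partial>sample_law n f)\<bar>
     = \<bar>\<integral>X. exp (- (l * (norm (emp_process n X))\<^sup>2)) - exp (- (l * d\<^sup>2)) * exp (- (l * A X)) \<partial>sample_law n f\<bar>"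
    using Qi Ai by simp
  also have "\<dots> \<le> (\<integral>X. \<bar>exp (- (l * (norm (emp_process n X))\<^sup>2)) - exp (- (l * d\<^sup>2)) * exp (- (l * A X))\<bar> \<partial>sample_law n f)"
    by (rule integral_abs_bound)
  also have "\<dots> \<le> (\<integral>X. sqrt l * D X \<partial>sample_law n f)"
    using Qi Ai ED(1) by (intro integral_mono pt) auto
  also have "\<dots> \<le> sqrt l * sqrt ((1 / 6 - (\<Sum>j<m. (kl_sd j)\<^sup>2)) + norm f)"
  proof -
    have "(\<integral>X. D X \<partial>sample_law n f) \<le> sqrt ((1 / 6 - (\<Sum>j<m. (kl_sd j)\<^sup>2)) + norm f)"
      using ED(2) real_sqrt_le_mono[OF D2(2)] by (rule order_trans)
    then show ?thesis using l by (simp add: mult_left_mono)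
  qed
  finally show ?thesis unfolding cvm_stat_eq_norm A_def d_def H_def .
qed

definition limit_laplace :: "nat \<Rightarrow> l2 \<Rightarrow> real \<Rightarrow> real" where
  "limit_laplace m H l = chi_factor m l * (shift_factor m H l * exp (- (l * (norm (resid sinb m H))\<^sup>2)))"

text \<open>
  The number \<open>m\<close> of coordinates is fixed before the sample size: the truncation error
  is small for large \<open>m\<close>, and for each such \<open>m\<close> the central limit
  theorem applies.
\<close>

theorem laplace_limit:
  fixes N :: "nat \<Rightarrow> nat"
  assumes f: "\<And>i. is_alternative (f i)" and N0: "\<And>i. N i > 0" and N: "filterlim N at_top sequentially"
    and f0: "(\<lambda>i. norm (f i)) \<longlonglongrightarrow> 0" and l: "l \<ge> 0" and \<rho>: "\<rho> > 0"
  shows "eventually (\<lambda>m. eventually (\<lambda>i.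
     \<bar>(\<integral>X. exp (- (l * (N i * cvm_stat (N i) X))) \<partial>sample_law (N i) (f i))
       - limit_laplace m (drift (N i) (f i)) l\<bar> \<le> \<rho>) sequentially) sequentially"
proof -
  have "(\<lambda>m. sqrt l * sqrt ((1 / 6 - (\<Sum>j<m. (kl_sd j)\<^sup>2)) + 0)) \<longlonglongrightarrow> sqrt l * sqrt ((1 / 6 - 1 / 6) + 0)"
    using kl_sd_sq_sums unfolding sums_def by (intro tendsto_intros)
  then have "eventually (\<lambda>m. sqrt l * sqrt ((1 / 6 - (\<Sum>j<m. (kl_sd j)\<^sup>2)) + 0) < \<rho> / 2) sequentially"
    by (rule order_tendstoD) (use \<rho> in auto)
  then show ?thesis
  proof eventually_elim
    fix m assume m: "sqrt l * sqrt ((1 / 6 - (\<Sum>j<m. (kl_sd j)\<^sup>2)) + 0) < \<rho> / 2"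
    have "(\<lambda>i. sqrt l * sqrt ((1 / 6 - (\<Sum>j<m. (kl_sd j)\<^sup>2)) + norm (f i))) \<longlonglongrightarrow> sqrt l * sqrt ((1 / 6 - (\<Sum>j<m. (kl_sd j)\<^sup>2)) + 0)"
      by (intro tendsto_intros f0)
    from order_tendstoD(2)[OF this m]
    have e1: "eventually (\<lambda>i. sqrt l * sqrt ((1 / 6 - (\<Sum>j<m. (kl_sd j)\<^sup>2)) + norm (f i)) < \<rho> / 2) sequentially" .
    have e2: "eventually (\<lambda>i. \<bar>(\<integral>X. exp (- (l * (\<Sum>j<m. (inner (emp_process (N i) X) (sinb j))\<^sup>2))) \<partial>sample_law (N i) (f i))
      - chi_factor m l * shift_factor m (drift (N i) (f i)) l\<bar> < \<rho> / 2) sequentially"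
      using tendstoD[OF finite_laplace_tendsto[OF f N0 N f0 l, of m], of "\<rho> / 2"] \<rho> by (simp add: dist_real_def)
    from e1 e2 show "eventually (\<lambda>i. \<bar>(\<integral>X. exp (- (l * (N i * cvm_stat (N i) X))) \<partial>sample_law (N i) (f i))
       - limit_laplace m (drift (N i) (f i)) l\<bar> \<le> \<rho>) sequentially"
    proof eventually_elim
      fix i
      define H where "H = drift (N i) (f i)"
      define I where "I = (\<integral>X. exp (- (l * (\<Sum>j<m. (inner (emp_process (N i) X) (sinb j))\<^sup>2))) \<partial>sample_law (N i) (f i))"
      define w where "w = exp (- (l * (norm (resid sinb m H))\<^sup>2))"
      define L where "L = (\<integral>X. exp (- (l * (N i * cvm_stat (N i) X))) \<partial>sample_law (N i) (f i))"
      assume a1: "sqrt l * sqrt ((1 / 6 - (\<Sum>j<m. (kl_sd j)\<^sup>2)) + norm (f i)) < \<rho> / 2"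
        and "\<bar>(\<integral>X. exp (- (l * (\<Sum>j<m. (inner (emp_process (N i) X) (sinb j))\<^sup>2))) \<partial>sample_law (N i) (f i))
          - chi_factor m l * shift_factor m (drift (N i) (f i)) l\<bar> < \<rho> / 2"
      then have a2: "\<bar>I - chi_factor m l * shift_factor m H l\<bar> < \<rho> / 2" by (simp add: I_def H_def)
      have w: "0 \<le> w" "w \<le> 1" using l by (auto simp: w_def)
      have "\<bar>w * I - limit_laplace m H l\<bar> = w * \<bar>I - chi_factor m l * shift_factor m H l\<bar>"
      proof -
        have "w * I - limit_laplace m H l = w * (I - chi_factor m l * shift_factor m H l)"
          unfolding limit_laplace_def w_def[symmetric] by (simp add: algebra_simps)
        then show ?thesis using w by (simp add: abs_mult)
      qed
      also have "\<dots> \<le> 1 * \<bar>I - chi_factor m l * shift_factor m H l\<bar>" using w by (intro mult_right_mono) auto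
      finally have b1: "\<bar>w * I - limit_laplace m H l\<bar> < \<rho> / 2" using a2 by simp
      have "\<bar>L - w * I\<bar> < \<rho> / 2"
        using laplace_truncation[OF f[of i] N0[of i] l, of m] a1 by (simp add: L_def w_def I_def H_def)
      with b1 show "\<bar>(\<integral>X. exp (- (l * (N i * cvm_stat (N i) X))) \<partial>sample_law (N i) (f i))
         - limit_laplace m (drift (N i) (f i)) l\<bar> \<le> \<rho>"
        unfolding L_def[symmetric] H_def[symmetric] by linarith
    qed
  qed
qed



section \<open>The law of the statistic\<close>

definition stat_law :: "nat \<Rightarrow> l2 \<Rightarrow> real measure" where
  "stat_law n f = distr (sample_law n f) borel (\<lambda>X. n * cvm_stat n X)"

lemma stat_measurable: "(\<lambda>X. n * cvm_stat n X) \<in> borel_measurable (sample_law n f)"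
  unfolding cvm_stat_eq_norm by (rule emp_norm_measurable)

lemma nonneg_stat_law:
  assumes f: "is_alternative f"
  shows "nonneg_law (stat_law n f)"
proof -
  interpret S: prob_space "sample_law n f" by (rule prob_space_sample_law[OF f])
  have "prob_space (stat_law n f)"
    unfolding stat_law_def by (rule S.prob_space_distr[OF stat_measurable])
  moreover have "AE x in stat_law n f. 0 \<le> x"
    unfolding stat_law_def by (subst AE_distr_iff[OF stat_measurable]) (auto simp: cvm_stat_eq_norm)
  ultimately show ?thesis by (simp add: nonneg_law_def) (simp add: stat_law_def)
qed

lemma stat_law_laplace:
  "laplace (stat_law n f) l = (\<integral>X. exp (- (l * (n * cvm_stat n X))) \<partial>sample_law n f)"
  unfolding stat_law_def by (subst integral_distr[OF stat_measurable]) auto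

lemma stat_law_atMost: "measure (stat_law n f) {..x} = measure (sample_law n f) {X \<in> space (sample_law n f). n * cvm_stat n X \<le> x}"
  unfolding stat_law_def by (subst measure_distr[OF stat_measurable]) (auto simp: vimage_def intro!: arg_cong[where f = "measure _"])

lemma type2_error_eq:
  assumes n: "n > 0"
  shows "type2_error n t f = measure (stat_law n f) {..n * t}"
  unfolding type2_error_def stat_law_atMost using n by (simp add: not_less)

lemma zero_alternative: "is_alternative 0"
proof -
  have "l2_rel (\<lambda>_. 0) (\<lambda>_. 0)" by (simp add: l2_rel_def sq_integrable_def)
  then show ?thesis unfolding zero_l2.abs_eq by (subst is_alternative.abs_eq) (auto simp: U.prob_space[simplified])
qed

lemma type1_error_eq:
  assumes n: "n > 0"
  shows "type1_error n t = 1 - measure (stat_law n 0) {..n * t}"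
proof -
  interpret S: prob_space "sample_law n 0" by (rule prob_space_sample_law[OF zero_alternative])
  have "{X \<in> space (sample_law n 0). n * cvm_stat n X \<le> n * t} \<in> sets (sample_law n 0)"
    using stat_measurable[of n 0] by measurable
  from S.prob_compl[OF this]
  have "measure (sample_law n 0) (space (sample_law n 0) - {X \<in> space (sample_law n 0). n * cvm_stat n X \<le> n * t})
    = 1 - measure (stat_law n 0) {..n * t}" by (simp add: stat_law_atMost)
  moreover have "space (sample_law n 0) - {X \<in> space (sample_law n 0). n * cvm_stat n X \<le> n * t}
    = {X \<in> space (sample_law n 0). cvm_stat n X > t}" using n by auto
  ultimately show ?thesis by (simp add: type1_error_def)
qed

lemma volterra_0[simp]: "volterra 0 = 0"
  using volterra_scaleR[of 0 0] by simp

text \<open>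
  Under the hypothesis the statistic has mean at most 1/6, so the Markov inequality bounds its
  tail.
\<close>

lemma null_tail:
  assumes n: "n > 0" and x: "x > 0"
  shows "1 - measure (stat_law n 0) {..x} \<le> 1 / x"
proof -
  interpret S: prob_space "sample_law n 0" by (rule prob_space_sample_law[OF zero_alternative])
  interpret Q: prob_space "stat_law n 0" using nonneg_stat_law[OF zero_alternative] by (simp add: nonneg_law_def)
  have i: "integrable (sample_law n 0) (\<lambda>X. (norm (emp_process n X))\<^sup>2)"
    and b: "(\<integral>X. (norm (emp_process n X))\<^sup>2 \<partial>sample_law n 0) \<le> 1 / 6"
    using high_freq_second_moment[OF zero_alternative n, of 0] by simp_all
  have "{..x} \<in> sets (stat_law n 0)" by (simp add: stat_law_def)
  from Q.prob_compl[OF this]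
  have "1 - measure (stat_law n 0) {..x} = measure (stat_law n 0) {x<..}"
    by (simp add: stat_law_def Compl_eq_Diff_UNIV[symmetric])
  also have "\<dots> = measure (sample_law n 0) {X \<in> space (sample_law n 0). x < (norm (emp_process n X))\<^sup>2}"
    unfolding stat_law_def by (subst measure_distr[OF stat_measurable]) (auto simp: cvm_stat_eq_norm vimage_def intro!: arg_cong[where f = "measure _"])
  also have "\<dots> \<le> measure (sample_law n 0) {X \<in> space (sample_law n 0). x \<le> (norm (emp_process n X))\<^sup>2}"
    using emp_norm_measurable[of n 0] by (intro S.finite_measure_mono) auto
  also have "\<dots> \<le> (\<integral>X. (norm (emp_process n X))\<^sup>2 \<partial>sample_law n 0) / x"
    by (rule integral_Markov_inequality_measure[OF i, where A = "{}"]) (use x in auto)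
  also have "\<dots> \<le> 1 / x" using b x by (intro divide_right_mono) auto
  finally show ?thesis .
qed

section \<open>Limit laws\<close>

lemma kl_sd_le: "kl_sd j \<le> kl_sd 0"
  unfolding kl_sd_def by (intro divide_left_mono mult_left_mono) auto

text \<open>
  One squared Gaussian is singled out: its density provides the regularity of the limit law,
  whatever the remaining factor is.
\<close>

lemma chi_factor_law:
  assumes m: "m > 0"
  shows "\<exists>R K. has_laplace R K \<and> has_laplace (chi_law ((kl_sd 0)\<^sup>2) \<star> R) (chi_factor m)"
proof -
  obtain k where k: "m = Suc k" using m by (cases m) auto
  have "\<exists>R. has_laplace R (\<lambda>l. \<Prod>j<k. 1 / sqrt (1 + 2 * l * (kl_sd (Suc j))\<^sup>2))"
  proof (rule has_laplace_prod)
    fix j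
    show "\<exists>R. has_laplace R (\<lambda>l. 1 / sqrt (1 + 2 * l * (kl_sd (Suc j))\<^sup>2))"
      by (rule exI, rule has_laplace_chi) simp
  qed
  then obtain R where R: "has_laplace R (\<lambda>l. \<Prod>j<k. 1 / sqrt (1 + 2 * l * (kl_sd (Suc j))\<^sup>2))" ..
  have "has_laplace (chi_law ((kl_sd 0)\<^sup>2) \<star> R) (chi_factor m)"
    by (rule has_laplace_cong[OF has_laplace_convolution[OF has_laplace_chi R]])
      (auto simp: chi_factor_def k prod.lessThan_Suc_shift simp del: prod.lessThan_Suc)
  then show ?thesis using R by blast
qed

lemma shift_factor_law:
  "\<exists>V. has_laplace V (\<lambda>l. shift_factor m H l * exp (- (l * (norm (resid sinb m H))\<^sup>2)))"
proof -
  have "\<exists>V. has_laplace V (\<lambda>l. \<Prod>j<m. exp (- (l * (inner H (sinb j))\<^sup>2 / (1 + 2 * l * (kl_sd j)\<^sup>2))))"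
    by (intro has_laplace_prod has_laplace_noncentral) (simp_all add: kl_sd_pos less_imp_neq[OF kl_sd_pos, symmetric])
  then obtain V where "has_laplace V (shift_factor m H)" by (auto simp: shift_factor_def[abs_def])
  from has_laplace_convolution[OF this has_laplace_return[of "(norm (resid sinb m H))\<^sup>2"]]
  show ?thesis by auto
qed

text \<open>
  All factors \<open>1 + 2 l a\<^sub>j\<^sup>2\<close> lie between 1 and the one with \<open>j =
  0\<close>, so the transform is controlled by the norm of the drift alone.
\<close>

lemma shift_factor_bounds:
  assumes l: "l \<ge> 0"
  shows "exp (- (l * (norm H)\<^sup>2)) \<le> shift_factor m H l * exp (- (l * (norm (resid sinb m H))\<^sup>2))"
    and "shift_factor m H l * exp (- (l * (norm (resid sinb m H))\<^sup>2)) \<le> exp (- (l * (norm H)\<^sup>2 / (1 + 2 * l * (kl_sd 0)\<^sup>2)))"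
proof -
  define x where "x j = (inner H (sinb j))\<^sup>2" for j
  define r where "r = (norm (resid sinb m H))\<^sup>2"
  have H: "(norm H)\<^sup>2 = (\<Sum>j<m. x j) + r"
    unfolding x_def r_def by (rule norm_resid[OF orthonormal_sinb])
  have "shift_factor m H l * exp (- (l * (norm (resid sinb m H))\<^sup>2)) = exp (- ((\<Sum>j<m. l * x j / (1 + 2 * l * (kl_sd j)\<^sup>2)) + l * r))"
    by (simp add: shift_factor_def x_def r_def exp_sum[symmetric] exp_add[symmetric] sum_negf)
  then have eq: "shift_factor m H l * exp (- (l * (norm (resid sinb m H))\<^sup>2)) = exp (- ((\<Sum>j<m. l * x j / (1 + 2 * l * (kl_sd j)\<^sup>2)) + l * r))" .
  have p: "1 \<le> 1 + 2 * l * (kl_sd j)\<^sup>2" "1 + 2 * l * (kl_sd j)\<^sup>2 \<le> 1 + 2 * l * (kl_sd 0)\<^sup>2" for j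
    using l kl_sd_le[of j] kl_sd_pos[of j] by (auto intro!: mult_left_mono power_mono)
  have lx: "0 \<le> l * x j" for j using l by (simp add: x_def)
  have "(\<Sum>j<m. l * x j / (1 + 2 * l * (kl_sd j)\<^sup>2)) \<le> (\<Sum>j<m. l * x j)"
    using p(1) lx by (intro sum_mono) (simp add: divide_le_eq mult_right_le_one_le order_trans[OF _ mult_left_mono[OF p(1) lx]])
  then show "exp (- (l * (norm H)\<^sup>2)) \<le> shift_factor m H l * exp (- (l * (norm (resid sinb m H))\<^sup>2))"
    unfolding eq H by (simp add: distrib_left sum_distrib_left)
  have "l * (norm H)\<^sup>2 / (1 + 2 * l * (kl_sd 0)\<^sup>2) = (\<Sum>j<m. l * x j / (1 + 2 * l * (kl_sd 0)\<^sup>2)) + l * r / (1 + 2 * l * (kl_sd 0)\<^sup>2)"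
    unfolding H by (simp add: distrib_left sum_distrib_left add_divide_distrib sum_divide_distrib)
  also have "\<dots> \<le> (\<Sum>j<m. l * x j / (1 + 2 * l * (kl_sd j)\<^sup>2)) + l * r / 1"
    using p lx l by (intro add_mono sum_mono divide_left_mono mult_pos_pos)
      (auto simp: r_def intro: less_le_trans[OF zero_less_one])
  finally show "shift_factor m H l * exp (- (l * (norm (resid sinb m H))\<^sup>2)) \<le> exp (- (l * (norm H)\<^sup>2 / (1 + 2 * l * (kl_sd 0)\<^sup>2)))"
    unfolding eq by simp
qed

text \<open>
  The Chernoff bound at \<open>l = 1 / (2 a\<^sub>0\<^sup>2)\<close>, where the denominators are
  at most 2 and the transform is at most \<open>exp (- l \<epsilon> / 2)\<close>. The bound does
  not depend on \<open>m\<close> or on how the drift is distributed over frequencies.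
\<close>

lemma shift_law_small_ball:
  assumes V: "has_laplace V (\<lambda>l. shift_factor m H l * exp (- (l * (norm (resid sinb m H))\<^sup>2)))"
    and H: "\<epsilon> \<le> (norm H)\<^sup>2"
  shows "measure V {..<\<epsilon> / 4} \<le> 1 - (1 - exp (- (\<epsilon> / (8 * (kl_sd 0)\<^sup>2))))"
proof -
  define l where "l = 1 / (2 * (kl_sd 0)\<^sup>2)"
  have b: "0 < (kl_sd 0)\<^sup>2" using kl_sd_pos[of 0] by simp
  have l: "l \<ge> 0" "1 + 2 * l * (kl_sd 0)\<^sup>2 = 2" using b by (auto simp: l_def)
  have "measure V {..<\<epsilon> / 4} \<le> exp (l * (\<epsilon> / 4)) * (shift_factor m H l * exp (- (l * (norm (resid sinb m H))\<^sup>2)))"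
    by (rule has_laplace_small_ball[OF V l(1)])
  also have "\<dots> \<le> exp (l * (\<epsilon> / 4)) * exp (- (l * (norm H)\<^sup>2 / 2))"
    using shift_factor_bounds(2)[OF l(1), of m H] l(2) by (intro mult_left_mono) auto
  also have "\<dots> = exp (l * (\<epsilon> / 4) - l * (norm H)\<^sup>2 / 2)" by (simp flip: exp_add)
  also have "\<dots> \<le> exp (- (l * \<epsilon> / 4))"
  proof -
    have "l * \<epsilon> \<le> l * (norm H)\<^sup>2" by (rule mult_left_mono[OF H l(1)])
    then have "l * (\<epsilon> / 4) - l * (norm H)\<^sup>2 / 2 \<le> - (l * \<epsilon> / 4)" by (simp add: field_simps)
    then show ?thesis by simp
  qed
  also have "l * \<epsilon> / 4 = \<epsilon> / (8 * (kl_sd 0)\<^sup>2)" by (simp add: l_def)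
  finally show ?thesis by simp
qed

text \<open>
  A Levy type comparison of distribution functions, restricted to arguments up to
  \<open>T\<close>.
\<close>

definition cdf_near :: "real \<Rightarrow> real \<Rightarrow> real \<Rightarrow> real measure \<Rightarrow> real measure \<Rightarrow> bool" where
  "cdf_near T d h M N \<longleftrightarrow> (\<forall>t\<le>T. measure M {..t} \<le> measure N {..t + d} + h \<and>
     measure N {..t} \<le> measure M {..t + d} + h)"

text \<open>
  The approximating law may change with \<open>i\<close>, and it is specified by its transform:
  whichever law has transform \<open>L i\<close> is eventually near \<open>Q i\<close>.
\<close>

definition cdf_tracks :: "real \<Rightarrow> real \<Rightarrow> real \<Rightarrow> (nat \<Rightarrow> real measure) \<Rightarrow> (nat \<Rightarrow> real \<Rightarrow> real) \<Rightarrow> bool" where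
  "cdf_tracks T d h Q L \<longleftrightarrow> (\<forall>\<^sub>F i in sequentially. \<forall>\<mu>. has_laplace \<mu> (L i) \<longrightarrow> cdf_near T d h (Q i) \<mu>)"

text \<open>
  Convergence of the transform at finitely many integers is enough, and these finitely many
  eventual statements can be combined.
\<close>

lemma cdf_limit:
  fixes Q :: "nat \<Rightarrow> real measure" and L :: "nat \<Rightarrow> nat \<Rightarrow> real \<Rightarrow> real"
  assumes Q: "\<And>i. nonneg_law (Q i)"
    and lim: "\<And>l \<rho>. l \<ge> 0 \<Longrightarrow> \<rho> > 0 \<Longrightarrow>
      eventually (\<lambda>m. eventually (\<lambda>i. \<bar>laplace (Q i) l - L m i l\<bar> \<le> \<rho>) sequentially) sequentially"
    and d: "d > 0" and h: "h > 0"
  shows "eventually (\<lambda>m. cdf_tracks T d h Q (L m)) sequentially"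
proof -
  obtain k r where r: "r > 0" and close: "\<And>M N. nonneg_law M \<Longrightarrow> nonneg_law N \<Longrightarrow>
    (\<forall>i\<le>k. \<bar>laplace M (real i) - laplace N (real i)\<bar> \<le> r) \<Longrightarrow>
    (\<forall>t\<le>T. measure M {..t} \<le> measure N {..t + d} + h)"
    using laplace_close_imp_cdf_close[OF d h, of T] by blast
  have "eventually (\<lambda>m. \<forall>j\<in>{..k}. eventually (\<lambda>i. \<bar>laplace (Q i) (real j) - L m i (real j)\<bar> \<le> r) sequentially) sequentially"
    by (subst eventually_ball_finite_distrib) (use lim r in auto)
  then show ?thesis
  proof eventually_elim
    fix m assume "\<forall>j\<in>{..k}. eventually (\<lambda>i. \<bar>laplace (Q i) (real j) - L m i (real j)\<bar> \<le> r) sequentially"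
    then have "eventually (\<lambda>i. \<forall>j\<in>{..k}. \<bar>laplace (Q i) (real j) - L m i (real j)\<bar> \<le> r) sequentially"
      by (subst eventually_ball_finite_distrib) auto
    then show "cdf_tracks T d h Q (L m)"
      unfolding cdf_tracks_def
    proof eventually_elim
      fix i assume b: "\<forall>j\<in>{..k}. \<bar>laplace (Q i) (real j) - L m i (real j)\<bar> \<le> r"
      show "\<forall>\<mu>. has_laplace \<mu> (L m i) \<longrightarrow> cdf_near T d h (Q i) \<mu>"
        unfolding cdf_near_def
      proof (intro allI impI)
        fix \<mu> t assume \<mu>: "has_laplace \<mu> (L m i)" and t: "t \<le> T"
        have e: "laplace \<mu> (real j) = L m i (real j)" for j
          by (rule has_laplaceD(5)[OF \<mu>]) simp
        show "measure (Q i) {..t} \<le> measure \<mu> {..t + d} + h \<and> measure \<mu> {..t} \<le> measure (Q i) {..t + d} + h"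
          using close[OF Q[of i] has_laplace_nonneg_law[OF \<mu>]] close[OF has_laplace_nonneg_law[OF \<mu>] Q[of i]] t b
          unfolding e by (auto simp: abs_minus_commute)
      qed
    qed
  qed
qed

lemma stat_law_limit:
  fixes N :: "nat \<Rightarrow> nat"
  assumes f: "\<And>i. is_alternative (f i)" and N0: "\<And>i. N i > 0" and N: "filterlim N at_top sequentially"
    and f0: "(\<lambda>i. norm (f i)) \<longlonglongrightarrow> 0" and d: "d > 0" and h: "h > 0"
  shows "eventually (\<lambda>m. cdf_tracks T d h (\<lambda>i. stat_law (N i) (f i)) (\<lambda>i. limit_laplace m (drift (N i) (f i)))) sequentially"
  by (rule cdf_limit[OF nonneg_stat_law[OF f] _ d h])
    (unfold stat_law_laplace, rule laplace_limit[OF f N0 N f0])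

lemma null_law_limit:
  fixes N :: "nat \<Rightarrow> nat"
  assumes N0: "\<And>i. N i > 0" and N: "filterlim N at_top sequentially" and d: "d > 0" and h: "h > 0"
  shows "eventually (\<lambda>m. cdf_tracks T d h (\<lambda>i. stat_law (N i) 0) (\<lambda>_. chi_factor m)) sequentially"
proof -
  have "limit_laplace m (drift (N i) 0) = chi_factor m" for m i
    by (simp add: fun_eq_iff limit_laplace_def shift_factor_def resid_def)
  then show ?thesis using stat_law_limit[OF zero_alternative N0 N _ d h, of T] by simp
qed

lemma measure_split:
  fixes a b :: real
  assumes M: "prob_space M" "sets M = sets borel" and ab: "a \<le> b"
  shows "measure M {..b} = measure M {..a} + measure M {a<..b}"
proof -
  interpret prob_space M by (rule M(1))
  have "{..b} = {..a} \<union> {a<..b}" using ab by auto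
  then show ?thesis by (simp add: finite_measure_Union M(2) disjoint_iff)
qed

section \<open>Consistency\<close>

text \<open>
  Up to small errors, the type II error is the distribution function of \<open>|B|\<^sup>2 +
  W\<close> at the threshold, and \<open>1 - \<alpha>\<close> is that of
  \<open>|B|\<^sup>2\<close>. With probability at least \<open>p\<close> the shift
  \<open>W\<close> exceeds \<open>\<epsilon> / 4\<close>, which loses \<open>p\<close> times the
  mass \<open>g\<close> that \<open>|B|\<^sup>2\<close> puts just below the threshold. The Markov
  inequality keeps the threshold in a bounded range because the type I error tends to
  \<open>\<alpha> > 0\<close>.
\<close>

lemma consistency_criterion:
  fixes N :: "nat \<Rightarrow> nat"
  assumes f: "\<And>i. is_alternative (f i)" and N0: "\<And>i. N i > 0" and N: "filterlim N at_top sequentially"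
    and f0: "(\<lambda>i. norm (f i)) \<longlonglongrightarrow> 0"
    and \<epsilon>: "\<epsilon> > 0" and H: "\<And>i. \<epsilon> \<le> (norm (drift (N i) (f i)))\<^sup>2"
  shows "consistent N f"
  unfolding consistent_def
proof (intro ballI allI impI)
  fix \<alpha> :: real and t :: "nat \<Rightarrow> real"
  assume \<alpha>: "\<alpha> \<in> {0<..<1}" and lim: "(\<lambda>i. type1_error (N i) (t (N i))) \<longlonglongrightarrow> \<alpha>"
  define x where "x i = real (N i) * t (N i)" for i
  define Q0 where "Q0 i = measure (stat_law (N i) 0) {..x i}" for i
  define Q1 where "Q1 i = measure (stat_law (N i) (f i)) {..x i}" for i
  define b where "b = (kl_sd 0)\<^sup>2"
  define p where "p = 1 - exp (- (\<epsilon> / (8 * b)))"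
  define q where "q = (1 - \<alpha>) / 2"
  define T where "T = 2 / \<alpha>"
  have b: "b > 0" using kl_sd_pos[of 0] by (simp add: b_def)
  have p: "0 < p" "p < 1" using b \<epsilon> by (auto simp: p_def)
  have q: "q > 0" using \<alpha> by (simp add: q_def)
  have T: "T > 0" using \<alpha> by (simp add: T_def)
  obtain g where g: "g > 0" "\<And>R K u. has_laplace R K \<Longrightarrow> u \<le> T + 1 \<Longrightarrow> q \<le> measure (chi_law b \<star> R) {..u} \<Longrightarrow>
    g \<le> measure (chi_law b \<star> R) {u - \<epsilon> / 4<..u}"
    using chi_convolution_gap[OF b, of "\<epsilon> / 4" q "T + 1"] \<epsilon> q by auto
  \<comment> \<open>The loss \<open>p g\<close> has to absorb three errors \<open>h\<close> and the fluctuation of the level, and \<open>d\<close> is such that intervals of length \<open>2 d\<close> have mass at most \<open>h\<close>. The second bound on \<open>h\<close> keeps the limit law above \<open>q\<close> at the threshold.\<close>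
  define h where "h = min (p * g / 8) ((1 - \<alpha>) / 8)"
  define d where "d = min 1 (b * h\<^sup>2 / 2)"
  have h: "h > 0" "h \<le> p * g / 8" "h \<le> (1 - \<alpha>) / 8" proof -
    show "h > 0" using p g \<alpha> by (simp add: h_def)
    show "h \<le> p * g / 8" unfolding h_def by (rule min.cobounded1)
    show "h \<le> (1 - \<alpha>) / 8" unfolding h_def by (rule min.cobounded2)
  qed
  have d: "d > 0" "d \<le> 1" using b h by (auto simp: d_def)
  have sd: "sqrt (2 * d / b) \<le> h"
  proof (rule real_le_lsqrt)
    have "2 * d \<le> b * h\<^sup>2" by (simp add: d_def)
    then show "2 * d / b \<le> h\<^sup>2" using b by (simp add: divide_le_eq mult.commute)
  qed (use h d b in auto)
  have Q0: "Q0 \<longlonglongrightarrow> 1 - \<alpha>"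
  proof -
    have "(\<lambda>i. 1 - type1_error (N i) (t (N i))) \<longlonglongrightarrow> 1 - \<alpha>" by (intro tendsto_intros lim)
    then show ?thesis by (simp add: Q0_def[abs_def] x_def type1_error_eq[OF N0])
  qed
  have "eventually (\<lambda>m. m > 0 \<and> cdf_tracks T d h (\<lambda>i. stat_law (N i) (f i)) (\<lambda>i. limit_laplace m (drift (N i) (f i))) \<and>
      cdf_tracks T d h (\<lambda>i. stat_law (N i) 0) (\<lambda>_. chi_factor m)) sequentially"
    by (intro eventually_conj eventually_gt_at_top stat_law_limit[OF f N0 N f0 d(1) h(1)] null_law_limit[OF N0 N d(1) h(1)])
  then obtain m where m: "m > 0"
    and E1: "\<forall>\<^sub>F i in sequentially. \<forall>\<mu>. has_laplace \<mu> (limit_laplace m (drift (N i) (f i))) \<longrightarrow> cdf_near T d h (stat_law (N i) (f i)) \<mu>"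
    and E2: "\<forall>\<^sub>F i in sequentially. \<forall>\<mu>. has_laplace \<mu> (chi_factor m) \<longrightarrow> cdf_near T d h (stat_law (N i) 0) \<mu>"
    unfolding cdf_tracks_def using eventually_happens'[OF sequentially_bot] by blast
  obtain R K where R: "has_laplace R K" and \<mu>: "has_laplace (chi_law b \<star> R) (chi_factor m)"
    using chi_factor_law[OF m] unfolding b_def by blast
  define \<mu> where "\<mu> = (chi_law b \<star> R)"
  note \<mu>L = \<mu>[folded \<mu>_def]
  have E3: "eventually (\<lambda>i. Q0 i < 1 - \<alpha> + p * g / 8) sequentially"
    using order_tendstoD(2)[OF Q0, of "1 - \<alpha> + p * g / 8"] p g by simp
  have E4: "eventually (\<lambda>i. Q0 i > 3 / 4 * (1 - \<alpha>)) sequentially"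
    using order_tendstoD(1)[OF Q0, of "3 / 4 * (1 - \<alpha>)"] \<alpha> by simp
  have E5: "eventually (\<lambda>i. Q0 i < 1 - \<alpha> / 2) sequentially"
    using order_tendstoD(2)[OF Q0, of "1 - \<alpha> / 2"] \<alpha> by simp
  from E1 E2 E3 E4 E5 have "eventually (\<lambda>i. Q1 i \<le> 1 - \<alpha> - p * g / 2) sequentially"
  proof eventually_elim
    fix i
    assume c1: "\<forall>\<mu>. has_laplace \<mu> (limit_laplace m (drift (N i) (f i))) \<longrightarrow> cdf_near T d h (stat_law (N i) (f i)) \<mu>"
      and "\<forall>\<mu>. has_laplace \<mu> (chi_factor m) \<longrightarrow> cdf_near T d h (stat_law (N i) 0) \<mu>"
    then have c2: "cdf_near T d h (stat_law (N i) 0) \<mu>" using \<mu>L by blast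
    assume q1: "Q0 i < 1 - \<alpha> + p * g / 8" and q2: "Q0 i > 3 / 4 * (1 - \<alpha>)" and q3: "Q0 i < 1 - \<alpha> / 2"
    define H where "H = drift (N i) (f i)"
    obtain V where V: "has_laplace V (\<lambda>l. shift_factor m H l * exp (- (l * (norm (resid sinb m H))\<^sup>2)))"
      using shift_factor_law by blast
    have xT: "x i \<le> T"
    proof (rule ccontr)
      assume "\<not> x i \<le> T"
      then have xi: "x i > T" by simp
      have "1 - Q0 i \<le> 1 / x i" unfolding Q0_def by (rule null_tail[OF N0]) (use xi T in linarith)
      also have "\<dots> < 1 / T" using xi T by (intro divide_strict_left_mono) auto
      also have "\<dots> = \<alpha> / 2" by (simp add: T_def)
      finally show False using q3 by simp
    qed
    have "has_laplace (\<mu> \<star> V) (limit_laplace m H)"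
      unfolding limit_laplace_def[abs_def] by (rule has_laplace_convolution[OF \<mu>L V])
    with c1 xT have a1: "Q1 i \<le> measure (\<mu> \<star> V) {..x i + d} + h"
      unfolding Q1_def H_def cdf_near_def by blast
    have a2: "measure (\<mu> \<star> V) {..x i + d} \<le> (1 - p) * measure \<mu> {..x i + d} + p * measure \<mu> {..x i + d - \<epsilon> / 4}"
      using shift_law_small_ball[OF V, of \<epsilon>] H[of i] \<epsilon>
      by (intro convolution_shift_bound[OF \<mu>L V]) (auto simp: p_def b_def H_def)
    have a3: "measure \<mu> {..x i + d} = measure \<mu> {..x i + d - \<epsilon> / 4} + measure \<mu> {x i + d - \<epsilon> / 4<..x i + d}"
      by (rule measure_split) (use \<epsilon> has_laplaceD[OF \<mu>L] in auto)
    have "measure (stat_law (N i) 0) {..x i} \<le> measure \<mu> {..x i + d} + h"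
      using c2 xT unfolding cdf_near_def by blast
    then have "q \<le> measure \<mu> {..x i + d}" using q2 h(3) \<alpha> unfolding Q0_def[symmetric] q_def by (simp add: field_simps)
    then have a4: "g \<le> measure \<mu> {x i + d - \<epsilon> / 4<..x i + d}"
      unfolding \<mu>_def using xT d(2) by (intro g(2)[OF R]) auto
    have "x i - d \<le> T" using xT d by simp
    then have "measure \<mu> {..x i - d} \<le> measure (stat_law (N i) 0) {..x i - d + d} + h"
      using c2 unfolding cdf_near_def by blast
    then have a5: "measure \<mu> {..x i - d} \<le> Q0 i + h" by (simp add: Q0_def)
    have "measure \<mu> {..x i + d} = measure \<mu> {..x i - d} + measure \<mu> {x i - d<..x i + d}"
      by (rule measure_split) (use d has_laplaceD[OF \<mu>L] in auto)
    moreover have "measure \<mu> {x i - d<..x i + d} \<le> sqrt (2 * d / b)"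
      using chi_convolution_concentration[OF b R, of "2 * d" "x i - d"] d unfolding \<mu>_def by (simp add: algebra_simps)
    ultimately have a6: "measure \<mu> {..x i + d} \<le> Q0 i + 2 * h" using a5 sd by simp
    have "Q1 i \<le> measure \<mu> {..x i + d} - p * measure \<mu> {x i + d - \<epsilon> / 4<..x i + d} + h"
      using a1 a2 unfolding a3 by (simp add: algebra_simps)
    also have "\<dots> \<le> Q0 i + 2 * h - p * g + h"
    proof -
      have "p * g \<le> p * measure \<mu> {x i + d - \<epsilon> / 4<..x i + d}"
        using a4 p by (intro mult_left_mono) auto
      then show ?thesis using a6 by linarith
    qed
    finally show "Q1 i \<le> 1 - \<alpha> - p * g / 2" using q1 h(2) by simp
  qed
  then have "eventually (\<lambda>i. ereal (type2_error (N i) (t (N i)) (f i)) \<le> ereal (1 - \<alpha> - p * g / 2)) sequentially"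
    by (simp add: type2_error_eq[OF N0] Q1_def x_def)
  then have "limsup (\<lambda>i. ereal (type2_error (N i) (t (N i)) (f i))) \<le> ereal (1 - \<alpha> - p * g / 2)"
    by (rule Limsup_bounded)
  also have "\<dots> < ereal (1 - \<alpha>)" using p g by simp
  finally show "limsup (\<lambda>i. ereal (type2_error (N i) (t (N i)) (f i))) < ereal (1 - \<alpha>)" .
qed

section \<open>Inconsistency\<close>

text \<open>
  The two Laplace transforms have the common limit \<open>chi_factor\<close>. The law with that
  transform gives mass at most \<open>h\<close> to intervals of length \<open>2 d\<close>, so up
  to \<open>T\<close> the distribution function under the hypothesis exceeds the one under the
  alternative by at most \<open>3 h\<close>. Beyond \<open>T\<close> both are close to 1.
\<close>

lemma inconsistency_criterion:
  fixes N :: "nat \<Rightarrow> nat"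
  assumes f: "\<And>i. is_alternative (f i)" and N0: "\<And>i. N i > 0" and N: "filterlim N at_top sequentially"
    and f0: "(\<lambda>i. norm (f i)) \<longlonglongrightarrow> 0"
    and H: "(\<lambda>i. (norm (drift (N i) (f i)))\<^sup>2) \<longlonglongrightarrow> 0"
  shows "inconsistent N f"
  unfolding inconsistent_def
proof (intro allI)
  fix t :: "nat \<Rightarrow> real"
  define x where "x i = real (N i) * t (N i)" for i
  define b where "b = (kl_sd 0)\<^sup>2"
  have b: "b > 0" using kl_sd_pos[of 0] by (simp add: b_def)
  have main: "eventually (\<lambda>i. type1_error (N i) (t (N i)) + type2_error (N i) (t (N i)) (f i) \<ge> 1 - 4 * h) sequentially"
    if h: "h > 0" for h :: real
  proof -
    define T where "T = 1 / h"
    define d where "d = b * h\<^sup>2 / 2"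
    have T: "T > 0" using h by (simp add: T_def)
    have d: "d > 0" using b h by (simp add: d_def)
    have sd: "sqrt (2 * d / b) \<le> h" using b h by (simp add: d_def)
    have lim: "eventually (\<lambda>m. eventually (\<lambda>i. \<bar>laplace (stat_law (N i) (f i)) l - chi_factor m l\<bar> \<le> \<rho>) sequentially) sequentially"
      if l: "l \<ge> 0" and \<rho>: "\<rho> > 0" for l \<rho>
    proof -
      have "eventually (\<lambda>i. (norm (drift (N i) (f i)))\<^sup>2 < \<rho> / 2 / (l + 1)) sequentially"
        using order_tendstoD(2)[OF H, of "\<rho> / 2 / (l + 1)"] l \<rho> by simp
      then have small: "eventually (\<lambda>i. l * (norm (drift (N i) (f i)))\<^sup>2 \<le> \<rho> / 2) sequentially"
      proof eventually_elim
        fix i assume a: "(norm (drift (N i) (f i)))\<^sup>2 < \<rho> / 2 / (l + 1)"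
        have "l * (norm (drift (N i) (f i)))\<^sup>2 \<le> (l + 1) * (norm (drift (N i) (f i)))\<^sup>2"
          by (intro mult_right_mono) auto
        also have "\<dots> \<le> (l + 1) * (\<rho> / 2 / (l + 1))" using a l by (intro mult_left_mono) auto
        also have "(l + 1) * (\<rho> / 2 / (l + 1)) = \<rho> / 2" using l by (simp add: field_simps)
        finally show "l * (norm (drift (N i) (f i)))\<^sup>2 \<le> \<rho> / 2" .
      qed
      have "eventually (\<lambda>m. eventually (\<lambda>i. \<bar>laplace (stat_law (N i) (f i)) l - limit_laplace m (drift (N i) (f i)) l\<bar> \<le> \<rho> / 2) sequentially) sequentially"
        unfolding stat_law_laplace by (rule laplace_limit[OF f N0 N f0 l]) (use \<rho> in simp)
      then show ?thesis
      proof eventually_elim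
        fix m assume "eventually (\<lambda>i. \<bar>laplace (stat_law (N i) (f i)) l - limit_laplace m (drift (N i) (f i)) l\<bar> \<le> \<rho> / 2) sequentially"
        with small show "eventually (\<lambda>i. \<bar>laplace (stat_law (N i) (f i)) l - chi_factor m l\<bar> \<le> \<rho>) sequentially"
        proof eventually_elim
          fix i
          define H where "H = drift (N i) (f i)"
          define W where "W = shift_factor m H l * exp (- (l * (norm (resid sinb m H))\<^sup>2))"
          assume a: "l * (norm (drift (N i) (f i)))\<^sup>2 \<le> \<rho> / 2"
            and c: "\<bar>laplace (stat_law (N i) (f i)) l - limit_laplace m (drift (N i) (f i)) l\<bar> \<le> \<rho> / 2"
          have "1 - \<rho> / 2 \<le> exp (- (l * (norm H)\<^sup>2))"
            using exp_ge_add_one_self[of "- (l * (norm H)\<^sup>2)"] a unfolding H_def by linarith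
          also have "\<dots> \<le> W" unfolding W_def by (rule shift_factor_bounds(1)[OF l])
          finally have W1: "1 - \<rho> / 2 \<le> W" .
          have "W \<le> exp (- (l * (norm H)\<^sup>2 / (1 + 2 * l * (kl_sd 0)\<^sup>2)))"
            unfolding W_def by (rule shift_factor_bounds(2)[OF l])
          also have "\<dots> \<le> 1" using l by simp
          finally have W2: "W \<le> 1" .
          have "1 / sqrt (1 + 2 * l * (kl_sd j)\<^sup>2) \<le> 1" for j
          proof -
            have "1 \<le> sqrt (1 + 2 * l * (kl_sd j)\<^sup>2)" using l by (intro real_sqrt_ge_one) simp
            then show ?thesis by (simp add: divide_le_eq_1)
          qed
          then have cf: "0 \<le> chi_factor m l" "chi_factor m l \<le> 1"
            unfolding chi_factor_def using l by (auto intro!: prod_nonneg prod_le_1)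
          have "\<bar>limit_laplace m H l - chi_factor m l\<bar> = chi_factor m l * (1 - W)"
          proof -
            have "limit_laplace m H l - chi_factor m l = - (chi_factor m l * (1 - W))"
              unfolding limit_laplace_def W_def[symmetric] by (simp add: algebra_simps)
            then show ?thesis using cf W2 by simp
          qed
          also have "\<dots> \<le> 1 * (\<rho> / 2)" using cf W1 W2 by (intro mult_mono) auto
          finally show "\<bar>laplace (stat_law (N i) (f i)) l - chi_factor m l\<bar> \<le> \<rho>"
            using c unfolding H_def[symmetric] by linarith
        qed
      qed
    qed
    have "eventually (\<lambda>m. m > 0 \<and> cdf_tracks T d h (\<lambda>i. stat_law (N i) (f i)) (\<lambda>_. chi_factor m) \<and>
        cdf_tracks T d h (\<lambda>i. stat_law (N i) 0) (\<lambda>_. chi_factor m)) sequentially"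
      by (intro eventually_conj eventually_gt_at_top cdf_limit[OF nonneg_stat_law[OF f] lim d h] null_law_limit[OF N0 N d h])
    then obtain m where m: "m > 0"
      and E1: "\<forall>\<^sub>F i in sequentially. \<forall>\<mu>. has_laplace \<mu> (chi_factor m) \<longrightarrow> cdf_near T d h (stat_law (N i) (f i)) \<mu>"
      and E2: "\<forall>\<^sub>F i in sequentially. \<forall>\<mu>. has_laplace \<mu> (chi_factor m) \<longrightarrow> cdf_near T d h (stat_law (N i) 0) \<mu>"
      unfolding cdf_tracks_def using eventually_happens'[OF sequentially_bot] by blast
    obtain R K where R: "has_laplace R K" and \<mu>: "has_laplace (chi_law b \<star> R) (chi_factor m)"
      using chi_factor_law[OF m] unfolding b_def by blast
    define \<mu> where "\<mu> = (chi_law b \<star> R)"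
    note \<mu>L = \<mu>[folded \<mu>_def]
    from E1 E2 show ?thesis
    proof eventually_elim
      fix i
      assume "\<forall>\<mu>. has_laplace \<mu> (chi_factor m) \<longrightarrow> cdf_near T d h (stat_law (N i) (f i)) \<mu>"
        and "\<forall>\<mu>. has_laplace \<mu> (chi_factor m) \<longrightarrow> cdf_near T d h (stat_law (N i) 0) \<mu>"
      then have c1: "cdf_near T d h (stat_law (N i) (f i)) \<mu>" and c2: "cdf_near T d h (stat_law (N i) 0) \<mu>"
        using \<mu>L by blast+
      have low: "measure (stat_law (N i) 0) {..s} \<le> measure (stat_law (N i) (f i)) {..s} + 3 * h" if s: "s \<le> T" for s
      proof -
        have "measure (stat_law (N i) 0) {..s} \<le> measure \<mu> {..s + d} + h" using c2 s unfolding cdf_near_def by blast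
        moreover have "measure \<mu> {..s + d} = measure \<mu> {..s - d} + measure \<mu> {s - d<..s + d}"
          by (rule measure_split) (use d has_laplaceD[OF \<mu>L] in auto)
        moreover have "measure \<mu> {s - d<..s + d} \<le> sqrt (2 * d / b)"
          using chi_convolution_concentration[OF b R, of "2 * d" "s - d"] d unfolding \<mu>_def by (simp add: algebra_simps)
        moreover have "s - d \<le> T" using s d by simp
        then have "measure \<mu> {..s - d} \<le> measure (stat_law (N i) (f i)) {..s - d + d} + h" using c1 unfolding cdf_near_def by blast
        ultimately show ?thesis using sd by simp
      qed
      have "measure (stat_law (N i) 0) {..x i} \<le> measure (stat_law (N i) (f i)) {..x i} + 4 * h"
      proof (cases "x i \<le> T")
        case True
        then show ?thesis using low[of "x i"] h by simp
      next
        case False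
        interpret Q: prob_space "stat_law (N i) (f i)" using nonneg_stat_law[OF f] by (simp add: nonneg_law_def)
        interpret Q0: prob_space "stat_law (N i) 0" using nonneg_stat_law[OF zero_alternative] by (simp add: nonneg_law_def)
        have "1 - measure (stat_law (N i) 0) {..T} \<le> h"
          using null_tail[OF N0 T, of i] by (simp add: T_def)
        moreover have "measure (stat_law (N i) (f i)) {..T} \<le> measure (stat_law (N i) (f i)) {..x i}"
          using False by (intro Q.finite_measure_mono) (auto simp: stat_law_def)
        moreover have "measure (stat_law (N i) 0) {..x i} \<le> 1" by simp
        moreover have "measure (stat_law (N i) 0) {..T} \<le> measure (stat_law (N i) (f i)) {..T} + 3 * h"
          by (rule low) simp
        ultimately show ?thesis by linarith
      qed
      then show "1 - 4 * h \<le> type1_error (N i) (t (N i)) + type2_error (N i) (t (N i)) (f i)"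
        by (simp add: type1_error_eq[OF N0] type2_error_eq[OF N0] x_def)
    qed
  qed
  show "1 \<le> liminf (\<lambda>i. ereal (type1_error (N i) (t (N i)) + type2_error (N i) (t (N i)) (f i)))"
    unfolding le_Liminf_iff
  proof (intro allI impI)
    fix y :: ereal assume y: "y < 1"
    obtain z :: real where z: "y < ereal z" "z < 1"
      using ereal_dense2[OF y] by (metis ereal_less(3) less_ereal.simps(1) one_ereal_def)
    have "1 - 4 * ((1 - z) / 4) = z" by (simp add: field_simps)
    then have "eventually (\<lambda>i. type1_error (N i) (t (N i)) + type2_error (N i) (t (N i)) (f i) \<ge> z) sequentially"
      using main[of "(1 - z) / 4"] z by (simp only:)
    then show "eventually (\<lambda>i. y < ereal (type1_error (N i) (t (N i)) + type2_error (N i) (t (N i)) (f i))) sequentially"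
    proof eventually_elim
      fix i assume "z \<le> type1_error (N i) (t (N i)) + type2_error (N i) (t (N i)) (f i)"
      then have "ereal z \<le> ereal (type1_error (N i) (t (N i)) + type2_error (N i) (t (N i)) (f i))"
        by (simp only: ereal_less_eq)
      with z(1) show "y < ereal (type1_error (N i) (t (N i)) + type2_error (N i) (t (N i)) (f i))" by (rule less_le_trans)
    qed
  qed
qed


section \<open>The maxiset property\<close>

lemma alternatives_of_rateD:
  assumes "alternatives_of_rate r c C N f" and r: "r > 0"
  shows "\<And>i. is_alternative (f i)" "\<And>i. N i > 0" "filterlim N at_top sequentially" "(\<lambda>i. norm (f i)) \<longlonglongrightarrow> 0"
proof -
  have N: "strict_mono N" and a: "\<And>i. is_alternative (f i)"
    and lo: "\<And>i. c * real (N i) powr (- r) < norm (f i)" and up: "\<And>i. norm (f i) < C * real (N i) powr (- r)"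
    using assms(1) by (auto simp: alternatives_of_rate_def)
  show "\<And>i. is_alternative (f i)" by (rule a)
  show "N i > 0" for i
  proof (rule ccontr)
    assume "\<not> N i > 0"
    then have "norm (f i) < 0" using up[of i] by simp
    then show False using norm_ge_zero[of "f i"] by linarith
  qed
  show lim: "filterlim N at_top sequentially" by (rule filterlim_subseq[OF N])
  have "((\<lambda>n. C * real n powr (- r)) \<longlongrightarrow> C * 0) sequentially"
    by (intro tendsto_intros tendsto_neg_powr filterlim_real_sequentially) (use r in simp)
  then have "(\<lambda>i. C * real (N i) powr (- r)) \<longlonglongrightarrow> 0"
    using filterlim_compose[OF _ lim] by simp
  then show "(\<lambda>i. norm (f i)) \<longlonglongrightarrow> 0"
    by (rule Lim_null_comparison[rotated]) (use up in \<open>simp add: less_imp_le\<close>)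
qed

lemma scaled_volterra_norm: "(norm (drift n f))\<^sup>2 = real n * (norm (volterra f))\<^sup>2"
  by (simp add: power_mult_distrib)

text \<open>
  The body forces half of the squared norm of \<open>f\<close> into frequencies up to \<open>u = K
  n\<^sup>e\<close> with \<open>e = r / s = (1 - 2 r) / 2\<close>. On these the integration
  operator divides by at most \<open>\<pi> u\<close>, and the powers of \<open>n\<close> cancel
  exactly.
\<close>

lemma besov_consistent:
  assumes r: "0 < r" "r < 1 / 2" and s: "s = 2 * r / (1 - 2 * r)" and P: "P > 0"
    and c: "0 < c" and \<gamma>: "\<gamma> > 0"
    and rate: "alternatives_of_rate r c C N f"
    and body: "\<And>i. f i \<in> (*\<^sub>R) \<gamma> ` besov_body s P"
  shows "consistent N f"
proof -
  have s0: "s > 0" using r s by simp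
  define e where "e = (1 - 2 * r) / 2"
  have es: "2 * s * e = 2 * r" using r s by (simp add: e_def)
  have e0: "e > 0" using r by (simp add: e_def)
  \<comment> \<open>Large enough for the tail beyond \<open>K n\<^sup>e\<close> to have at most half of the lower bound \<open>c\<^sup>2 n\<^bsup>-2r\<^esup>\<close> of the squared norm.\<close>
  define K where "K = max 1 ((2 * \<gamma>\<^sup>2 * P / c\<^sup>2) powr (1 / (2 * s)))"
  have K1: "K \<ge> 1" by (simp add: K_def)
  have K2: "2 * \<gamma>\<^sup>2 * P / c\<^sup>2 \<le> K powr (2 * s)"
  proof -
    have "2 * \<gamma>\<^sup>2 * P / c\<^sup>2 = ((2 * \<gamma>\<^sup>2 * P / c\<^sup>2) powr (1 / (2 * s))) powr (2 * s)"
      using s0 P \<gamma> c by (simp add: powr_powr)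
    also have "\<dots> \<le> K powr (2 * s)" using s0 by (intro powr_mono2) (auto simp: K_def)
    finally show ?thesis .
  qed
  note D = alternatives_of_rateD[OF rate r(1)]
  define \<epsilon> where "\<epsilon> = c\<^sup>2 / (2 * pi\<^sup>2 * K\<^sup>2)"
  have \<epsilon>: "\<epsilon> > 0" using c K1 by (simp add: \<epsilon>_def)
  have "\<epsilon> \<le> (norm (drift (N i) (f i)))\<^sup>2" for i
  proof -
    define n where "n = real (N i)"
    have n: "n \<ge> 1" using D(2)[of i] by (simp add: n_def)
    define u where "u = K * n powr e"
    have u1: "u \<ge> 1" using K1 ge_one_powr_ge_zero[OF n, of e] e0 by (simp add: u_def) (metis mult_mono' mult_1 zero_le_one)
    define l where "l = nat \<lfloor>u\<rfloor>"
    have lu: "real l \<le> u" using u1 by (simp add: l_def)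
    have up: "u powr (2 * s) = K powr (2 * s) * n powr (2 * r)"
      using K1 n by (simp add: u_def powr_mult powr_powr es mult.commute[of e])
    have n2r: "n powr (2 * r) > 0" using n by simp
    have tail: "(norm (resid cosb l (f i)))\<^sup>2 \<le> c\<^sup>2 / 2 * n powr (- (2 * r))"
    proof -
      have "u powr (2 * s) * (norm (resid cosb l (f i)))\<^sup>2 \<le> \<gamma>\<^sup>2 * P"
        unfolding l_def by (rule dilation_besov_bound[OF body]) (use u1 in simp)
      moreover have "(2 * \<gamma>\<^sup>2 * P / c\<^sup>2) * (n powr (2 * r) * (norm (resid cosb l (f i)))\<^sup>2) \<le> K powr (2 * s) * (n powr (2 * r) * (norm (resid cosb l (f i)))\<^sup>2)"
        using K2 n2r by (intro mult_right_mono) auto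
      ultimately have "(2 * \<gamma>\<^sup>2 * P / c\<^sup>2) * (n powr (2 * r) * (norm (resid cosb l (f i)))\<^sup>2) \<le> \<gamma>\<^sup>2 * P"
        unfolding up by (simp add: mult.assoc)
      then have "(\<gamma>\<^sup>2 * P) * (2 / c\<^sup>2 * (n powr (2 * r) * (norm (resid cosb l (f i)))\<^sup>2)) \<le> (\<gamma>\<^sup>2 * P) * 1"
        by (simp add: mult_ac)
      then have "2 / c\<^sup>2 * (n powr (2 * r) * (norm (resid cosb l (f i)))\<^sup>2) \<le> 1"
        using \<gamma> P by (subst (asm) mult_le_cancel_left_pos) auto
      then show ?thesis using c n2r by (simp add: powr_minus field_simps)
    qed
    have "c * n powr (- r) < norm (f i)" using rate by (simp add: alternatives_of_rate_def n_def)
    then have "(c * n powr (- r))\<^sup>2 \<le> (norm (f i))\<^sup>2" using c by (intro power_mono) auto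
    moreover have "(n powr (- r))\<^sup>2 = n powr (- (2 * r))"
      by (simp add: power2_eq_square powr_add[symmetric])
    ultimately have big: "c\<^sup>2 * n powr (- (2 * r)) \<le> (norm (f i))\<^sup>2" by (simp add: power_mult_distrib)
    have head: "c\<^sup>2 / 2 * n powr (- (2 * r)) \<le> (\<Sum>j<l. (inner (f i) (cosb j))\<^sup>2)"
      using norm_resid[OF orthonormal_cosb, of "f i" l] tail big by (simp add: field_simps)
    have "(1 / (pi * u))\<^sup>2 * (c\<^sup>2 / 2 * n powr (- (2 * r))) \<le> (1 / (pi * u))\<^sup>2 * (\<Sum>j<l. (inner (f i) (cosb j))\<^sup>2)"
      using head by (intro mult_left_mono) auto
    also have "\<dots> \<le> (\<Sum>j<l. (inner (volterra (f i)) (sinb j))\<^sup>2)"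
      unfolding sum_distrib_left
    proof (rule sum_mono)
      fix j assume "j \<in> {..<l}"
      then have "real (Suc j) \<le> u" using lu by (auto simp: Suc_le_eq[symmetric] intro: order_trans[of _ "real l"])
      then have "1 / (pi * u) \<le> kl_sd j"
        unfolding kl_sd_def by (intro divide_left_mono mult_left_mono) (use u1 in auto)
      then have "(1 / (pi * u))\<^sup>2 \<le> (kl_sd j)\<^sup>2" using u1 by (intro power_mono) auto
      then show "(1 / (pi * u))\<^sup>2 * (inner (f i) (cosb j))\<^sup>2 \<le> (inner (volterra (f i)) (sinb j))\<^sup>2"
        unfolding inner_volterra_sinb[OF D(1)] power_mult_distrib by (intro mult_right_mono) auto
    qed
    also have "\<dots> \<le> (norm (volterra (f i)))\<^sup>2" by (rule bessel[OF orthonormal_sinb])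
    finally have "n * ((1 / (pi * u))\<^sup>2 * (c\<^sup>2 / 2 * n powr (- (2 * r)))) \<le> n * (norm (volterra (f i)))\<^sup>2"
      using n by (intro mult_left_mono) auto
    moreover have "n * ((1 / (pi * u))\<^sup>2 * (c\<^sup>2 / 2 * n powr (- (2 * r)))) = \<epsilon>"
    proof -
      have "(n powr e)\<^sup>2 * n powr (2 * r) = n powr (e + e + 2 * r)"
        by (simp only: power2_eq_square powr_add)
      also have "e + e + 2 * r = 1" by (simp add: e_def)
      finally have "(n powr e)\<^sup>2 * n powr (2 * r) = n" using n by simp
      then have ne: "(n powr e)\<^sup>2 = n * n powr (- (2 * r))" using n2r by (simp add: powr_minus field_simps)
      have "n * ((1 / (pi * u))\<^sup>2 * (c\<^sup>2 / 2 * n powr (- (2 * r)))) = c\<^sup>2 / (2 * pi\<^sup>2 * K\<^sup>2) * ((n * n powr (- (2 * r))) / (n powr e)\<^sup>2)"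
        by (simp add: u_def power_mult_distrib power_divide mult_ac)
      also have "(n * n powr (- (2 * r))) / (n powr e)\<^sup>2 = 1" unfolding ne using n by simp
      finally show ?thesis by (simp add: \<epsilon>_def)
    qed
    ultimately show ?thesis unfolding scaled_volterra_norm n_def by simp
  qed
  then show ?thesis by (rule consistency_criterion[OF D \<epsilon>])
qed

text \<open>
  For each \<open>M\<close> there is a tail \<open>g\<close> of \<open>f\<close> beyond some
  frequency \<open>u\<close> whose squared norm exceeds \<open>M u\<^bsup>-2s\<^esup>\<close>. The
  sample size \<open>n\<close> is chosen so that \<open>n\<^sup>-\<^sup>r\<close> matches the norm
  of \<open>g\<close>. The squared norm of the drift is then at most of order \<open>n |g|\<^sup>2
  / u\<^sup>2\<close>, which is at most \<open>M\<^bsup>-1/s\<^esup>\<close>. Iterating with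
  \<open>M\<close> equal to the previous sample size makes the sample sizes increase.
\<close>

lemma besov_inconsistent:
  assumes r: "0 < r" "r < 1 / 2" and s: "s = 2 * r / (1 - 2 * r)" and P: "P > 0"
    and h: "has_cos_coeffs f \<theta>" and nd: "f \<notin> dilations (besov_body s P)"
    and tails: "\<forall>l>l0. is_alternative (cos_tail \<theta> l)"
    and V: "convex V" "ortho_symmetric V" "f \<in> V"
  shows "\<exists>c C N g. 0 < c \<and> c < C \<and> alternatives_of_rate r c C N g \<and> (\<forall>i. g i \<in> V) \<and> inconsistent N g"
proof -
  have s0: "s > 0" using r s by simp
  have span: "f \<in> cos_span" using h by (simp add: has_cos_coeffs_iff cos_span_def)
  then have lim: "(\<lambda>m. resid cosb m f) \<longlonglongrightarrow> 0" by (simp add: cos_span_def)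
  define good where "good M g n \<longleftrightarrow> M < n \<and> is_alternative g \<and> g \<in> V \<and>
      1 / 2 * real n powr (- r) < norm g \<and> norm g < 2 * real n powr (- r) \<and>
      real n * (norm (volterra g))\<^sup>2 \<le> real M powr (- (1 / s))" for M :: nat and g n
  have ex: "\<exists>g n. good M g n" if M: "M > 0" for M :: nat
  proof -
    \<comment> \<open>A tail of norm below \<open>\<delta>\<close> corresponds to a sample size above \<open>M\<close>.\<close>
    define \<delta> where "\<delta> = (real M + 1) powr (- r)"
    have \<delta>: "\<delta> > 0" by (simp add: \<delta>_def)
    obtain L where L: "\<And>l. l \<ge> L \<Longrightarrow> norm (resid cosb l f) < \<delta>"
      using LIMSEQ_D[OF lim \<delta>] by auto
    define L' where "L' = max L (Suc l0)"
    \<comment> \<open>The second summand bounds the weight at every \<open>u \<le> L' + 1\<close>, so exceeding \<open>K\<close> forces a frequency beyond \<open>L'\<close>.\<close>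
    define K where "K = real M + (real L' + 1) powr (2 * s) * (norm f)\<^sup>2"
    have K: "K > 0" using M by (auto simp: K_def intro!: add_pos_nonneg)
    obtain u where u: "u > 0" "K < besov_weight s u f"
      using not_dilation_unbounded[OF span nd P K] by blast
    define l where "l = nat \<lfloor>u\<rfloor>"
    define g where "g = resid cosb l f"
    define G where "G = norm g"
    have uL: "u > real L' + 1"
    proof (rule ccontr)
      assume "\<not> u > real L' + 1"
      then have "u powr (2 * s) \<le> (real L' + 1) powr (2 * s)" using u(1) s0 by (intro powr_mono2) auto
      then have "besov_weight s u f \<le> (real L' + 1) powr (2 * s) * (norm f)\<^sup>2"
        by (intro mult_mono power_mono norm_resid_le[OF orthonormal_cosb]) auto
      then show False using u(2) M by (simp add: K_def)
    qed
    have lL: "l \<ge> L'" using uL unfolding l_def by linarith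
    have ul: "u \<le> real (Suc l)" using u(1) unfolding l_def by linarith
    have alt: "is_alternative g"
    proof -
      have "l0 < l" using lL by (simp add: L'_def)
      then have "is_alternative (cos_tail \<theta> l)" using tails by blast
      then show ?thesis by (simp only: g_def cos_tail_eq_resid[OF h])
    qed
    have gV: "g \<in> V" unfolding g_def by (rule resid_in_convex_ortho_symmetric[OF V h])
    have G\<delta>: "G < \<delta>" unfolding G_def g_def by (rule L) (use lL in \<open>simp add: L'_def\<close>)
    have Gu: "real M < u powr (2 * s) * G\<^sup>2"
    proof -
      have "real M \<le> K" by (simp add: K_def)
      then show ?thesis using u(2) by (simp add: G_def g_def l_def)
    qed
    have G0: "G > 0"
    proof (rule ccontr)
      assume "\<not> G > 0"
      then have "G = 0" by (simp add: G_def)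
      then show False using Gu M by simp
    qed
    define w where "w = G powr (- (1 / r))"
    have w: "w > 0" "w powr (- r) = G" using G0 r by (auto simp: w_def powr_powr)
    have wM: "real M + 1 < w"
    proof -
      have "real M + 1 = \<delta> powr (- (1 / r))" using r by (simp add: \<delta>_def powr_powr)
      also have "\<dots> < w" unfolding w_def using G0 G\<delta> r by (intro powr_less_mono2_neg) auto
      finally show ?thesis .
    qed
    define n where "n = nat \<lceil>w\<rceil>"
    have nw: "w \<le> real n" "real n \<le> 2 * w" using wM M unfolding n_def by linarith+
    have Mn: "M < n" using nw wM by linarith
    have lo: "1 / 2 * real n powr (- r) < G"
    proof -
      have "real n powr (- r) \<le> w powr (- r)" using nw w r by (intro powr_mono2') auto
      then show ?thesis using w(2) G0 by simp
    qed
    have up: "G < 2 * real n powr (- r)"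
    proof -
      have "(2 * w) powr (- r) \<le> real n powr (- r)" using nw w r by (intro powr_mono2') auto
      then have "2 powr (- r) * G \<le> real n powr (- r)" using w by (simp add: powr_mult)
      moreover have "2 powr (- 1) < 2 powr (- r :: real)" using r by (intro powr_less_mono) auto
      then have "1 / 2 * G < 2 powr (- r) * G" using G0 by (intro mult_strict_right_mono) (auto simp: powr_minus)
      ultimately show ?thesis by simp
    qed
    have small: "real n * (norm (volterra g))\<^sup>2 \<le> real M powr (- (1 / s))"
    proof -
      have "norm (volterra g) \<le> kl_sd l * G"
        unfolding g_def G_def by (rule volterra_tail_bound[OF lim])
      also have "\<dots> \<le> 1 / (pi * u) * G"
        unfolding kl_sd_def using ul u(1) G0 by (intro mult_right_mono divide_left_mono mult_left_mono) auto
      finally have "(norm (volterra g))\<^sup>2 \<le> (1 / (pi * u) * G)\<^sup>2" by (intro power_mono) auto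
      then have "real n * (norm (volterra g))\<^sup>2 \<le> (2 * w) * (1 / (pi * u) * G)\<^sup>2"
        using nw w by (intro mult_mono) auto
      also have "\<dots> = 2 / pi\<^sup>2 * (w * G\<^sup>2 / u\<^sup>2)" by (simp add: power_mult_distrib power_divide)
      also have "w * G\<^sup>2 = (G\<^sup>2) powr (- (1 / s))"
      proof -
        have "1 / s = (1 - 2 * r) / (2 * r)" using s by simp
        then have e: "2 - 1 / r = 2 * (- (1 / s))" using r by (simp add: field_simps)
        have "w * G\<^sup>2 = G powr (- (1 / r)) * G powr 2" using G0 by (simp add: w_def)
        also have "\<dots> = G powr (2 - 1 / r)" by (simp add: powr_add[symmetric])
        also have "\<dots> = (G powr 2) powr (- (1 / s))" unfolding e powr_powr ..
        finally show ?thesis using G0 by simp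
      qed
      also have "(G\<^sup>2) powr (- (1 / s)) \<le> (real M * u powr (- (2 * s))) powr (- (1 / s))"
      proof (rule powr_mono2')
        have "0 < u powr (2 * s)" using u(1) by simp
        then show "real M * u powr (- (2 * s)) \<le> G\<^sup>2" using Gu by (simp add: powr_minus field_simps)
      qed (use s0 M u(1) in auto)
      also have "\<dots> = real M powr (- (1 / s)) * u\<^sup>2"
        using s0 u(1) by (simp add: powr_mult powr_powr)
      finally have "real n * (norm (volterra g))\<^sup>2 \<le> 2 / pi\<^sup>2 * (real M powr (- (1 / s)) * u\<^sup>2 / u\<^sup>2)"
        by (simp add: divide_right_mono mult_left_mono)
      also have "\<dots> = 2 / pi\<^sup>2 * real M powr (- (1 / s))" using u(1) by simp
      also have "\<dots> \<le> 1 * real M powr (- (1 / s))"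
      proof (rule mult_right_mono)
        have "3 * 3 \<le> pi * pi" using pi_gt3 by (intro mult_mono) auto
        then show "2 / pi\<^sup>2 \<le> 1" by (simp add: divide_le_eq power2_eq_square)
      qed simp
      finally show ?thesis by simp
    qed
    show ?thesis using Mn alt gV lo up small unfolding good_def G_def by blast
  qed
  obtain g n where gn: "\<And>M. M > 0 \<Longrightarrow> good M (g M) (n M)" using ex by metis
  \<comment> \<open>Each sample size serves as the lower bound \<open>M\<close> for the next one.\<close>
  define Ms where "Ms = rec_nat 1 (\<lambda>_ M. n M)"
  have Ms: "Ms 0 = 1" "\<And>i. Ms (Suc i) = n (Ms i)" by (simp_all add: Ms_def)
  have Mi: "Ms i \<ge> Suc i" for i
  proof (induction i)
    case (Suc i)
    then have "Ms i < n (Ms i)" using gn[of "Ms i"] by (simp add: good_def)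
    with Suc show ?case by (simp add: Ms)
  qed (simp add: Ms)
  have G: "good (Ms i) (g (Ms i)) (Ms (Suc i))" for i
    using gn[of "Ms i"] Mi[of i] by (simp add: Ms(2))
  define N where "N i = Ms (Suc i)" for i
  have mono: "strict_mono N"
    unfolding strict_mono_Suc_iff N_def using G by (simp add: good_def)
  have rate: "alternatives_of_rate r (1 / 2) 2 N (\<lambda>i. g (Ms i))"
    using mono G by (auto simp: alternatives_of_rate_def good_def N_def)
  have "inconsistent N (\<lambda>i. g (Ms i))"
  proof (rule inconsistency_criterion[OF alternatives_of_rateD[OF rate r(1)]])
    have "((\<lambda>i. real (Suc i) powr (- (1 / s))) \<longlongrightarrow> 0) sequentially"
      using s0 by (intro tendsto_neg_powr filterlim_compose[OF filterlim_real_sequentially filterlim_Suc]) auto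
    then show "(\<lambda>i. (norm (drift (N i) (g (Ms i))))\<^sup>2) \<longlonglongrightarrow> 0"
    proof (rule Lim_null_comparison[rotated], intro always_eventually allI)
      fix i
      have "real (N i) * (norm (volterra (g (Ms i))))\<^sup>2 \<le> real (Ms i) powr (- (1 / s))"
        using G[of i] by (simp add: good_def N_def)
      also have "\<dots> \<le> real (Suc i) powr (- (1 / s))"
        using Mi[of i] s0 by (intro powr_mono2') auto
      finally show "norm ((norm (drift (N i) (g (Ms i))))\<^sup>2) \<le> real (Suc i) powr (- (1 / s))"
        unfolding scaled_volterra_norm by simp
    qed
  qed
  moreover have "\<forall>i. g (Ms i) \<in> V" using G by (simp add: good_def)
  ultimately show ?thesis using rate by (intro exI[of _ "1 / 2"] exI[of _ 2] exI[of _ N] exI[of _ "\<lambda>i. g (Ms i)"]) auto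
qed

theorem theorem7p2:
  fixes r s P\<^sub>0 :: real
  assumes "0 < r" and "r < 1 / 2"
    and "s = 2 * r / (1 - 2 * r)"
    and "P\<^sub>0 > 0"
  shows "cvm_maxiset r (besov_body s P\<^sub>0)"
  unfolding cvm_maxiset_def
proof (intro conjI allI impI)
  show "bounded (besov_body s P\<^sub>0)" "closed (besov_body s P\<^sub>0)" "convex (besov_body s P\<^sub>0)" "ortho_symmetric (besov_body s P\<^sub>0)"
    by (rule bounded_besov_body closed_besov_body convex_besov_body ortho_symmetric_besov_body)+
next
  fix \<gamma> c C N f
  assume "0 < \<gamma>" "0 < c" "c < C" "alternatives_of_rate r c C N f" "\<forall>i. f i \<in> (*\<^sub>R) \<gamma> ` besov_body s P\<^sub>0"
  then show "consistent N f" by (intro besov_consistent[OF assms(1,2,3,4)]) auto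
next
  fix f \<theta> V
  assume "has_cos_coeffs f \<theta>" "f \<notin> dilations (besov_body s P\<^sub>0)"
    "\<exists>l\<^sub>0. \<forall>l>l\<^sub>0. is_alternative (cos_tail \<theta> l)" "convex V" "ortho_symmetric V" "f \<in> V"
  then show "\<exists>c C N g. 0 < c \<and> c < C \<and> alternatives_of_rate r c C N g \<and> (\<forall>i. g i \<in> V) \<and> inconsistent N g"
    using besov_inconsistent[OF assms(1,2,3,4)] by blast
qed

end
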